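(* Let $B$ be a finite simplicial complex and $\pi:E\to B$ a circle bundle. Assume that $H^2(B;\mathbb{Z})$ has no elements of order two. Assume there exists a simplicial $2$-cocycle $e$ on $B$ taking values in $\{\pm1,\pm2\}$ on the $2$-simplices such that (1) $e$ represents the integer Euler class of the bundle, and (2) there is a simplicial $1$-cochain $a\in C^1(B;\mathbb{Z})$ taking only the values $\pm1$ with $e=\mathcal{G}_a$. Then the circle bundle admits a classical triangulation over the given triangulation of $B$.
   Context: A circle bundle is a principal $S^1$-bundle; its integer Euler class lies in $H^2(B;\mathbb{Z})$. A classical triangulation of $\pi:E\to B$ over the simplicial complex $B$ is a representation of $E$ as a finite simplicial complex such that $\pi$ is simplicial. Simplicial cochains are evaluated on oriented simplices and change sign under odd reorderings; $d$ is the simplicial coboundary, so $da([v_0,v_1,v_2])=a([v_1,v_2])-a([v_0,v_2])+a([v_0,v_1])$. If $a$ takes values $\pm1$ only, then $da$ takes values in $\{\pm1,\pm3\}$. Define $\mathcal{F}:\{\pm1,\pm3\}\to\{\pm1/4\}$ by $\mathcal{F}(3)=\mathcal{F}(-1)=1/4$ and $\mathcal{F}(-3)=\mathcal{F}(1)=-1/4$, applied valuewise to $2$-cochains, and set $\mathcal{G}_a=\mathcal{F}(da)-\tfrac{3}{4}\,da\in C^2(B;\mathbb{Z})$ (an integer cochain with values in $\{\pm1,\pm2\}$). *)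

theory Defs
  imports "HOL-Complex_Analysis.Complex_Analysis"
begin

definition simplicial_complex :: "'v set \<Rightarrow> 'v set set \<Rightarrow> bool" where
  "simplicial_complex V K \<longleftrightarrow> finite V
     \<and> (\<forall>\<sigma>\<in>K. \<sigma> \<noteq> {} \<and> \<sigma> \<subseteq> V)
     \<and> (\<forall>\<sigma>\<in>K. \<forall>\<tau>. \<tau> \<noteq> {} \<and> \<tau> \<subseteq> \<sigma> \<longrightarrow> \<tau> \<in> K)
     \<and> (\<forall>v\<in>V. {v} \<in> K)"

text \<open>Geometric realization in barycentric coordinates (product topology on functions).\<close>
definition geom :: "'v set set \<Rightarrow> ('v \<Rightarrow> real) set" where
  "geom K = {x. (\<forall>v. 0 \<le> x v) \<and> {v. x v \<noteq> 0} \<in> K \<and> sum x {v. x v \<noteq> 0} = 1}"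

definition skel1 :: "'v set set \<Rightarrow> 'v set set" where
  "skel1 K = {\<sigma>\<in>K. card \<sigma> \<le> 2}"

definition faces :: "'v set \<Rightarrow> 'v set set" where
  "faces \<sigma> = {\<tau>. \<tau> \<noteq> {} \<and> \<tau> \<subseteq> \<sigma>}"

definition vtx :: "'v \<Rightarrow> 'v \<Rightarrow> real" where
  "vtx v = (\<lambda>x. if x = v then 1 else 0)"

definition seg :: "('v \<Rightarrow> real) \<Rightarrow> ('v \<Rightarrow> real) \<Rightarrow> real \<Rightarrow> 'v \<Rightarrow> real" where
  "seg p q t = (\<lambda>x. (1 - t) * p x + t * q x)"

definition bdry :: "'v \<Rightarrow> 'v \<Rightarrow> 'v \<Rightarrow> real \<Rightarrow> 'v \<Rightarrow> real" where
  "bdry u v w t = (if t \<le> 1/3 then seg (vtx u) (vtx v) (3 * t)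
                   else if t \<le> 2/3 then seg (vtx v) (vtx w) (3 * t - 1)
                   else seg (vtx w) (vtx u) (3 * t - 2))"

definition alt1 :: "'v set set \<Rightarrow> ('v \<Rightarrow> 'v \<Rightarrow> 'a::ab_group_add) \<Rightarrow> bool" where
  "alt1 K b \<longleftrightarrow> (\<forall>u v. {u, v} \<in> K \<and> u \<noteq> v \<longrightarrow> b v u = - b u v)"

definition alt2 :: "'v set set \<Rightarrow> ('v \<Rightarrow> 'v \<Rightarrow> 'v \<Rightarrow> 'a::ab_group_add) \<Rightarrow> bool" where
  "alt2 K c \<longleftrightarrow> (\<forall>u v w. {u, v, w} \<in> K \<and> distinct [u, v, w] \<longrightarrow>
      c v u w = - c u v w \<and> c u w v = - c u v w)"

definition cobd1 :: "('v \<Rightarrow> 'v \<Rightarrow> 'a::ab_group_add) \<Rightarrow> 'v \<Rightarrow> 'v \<Rightarrow> 'v \<Rightarrow> 'a" where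
  "cobd1 b u v w = b v w - b u w + b u v"

definition cobd2 :: "('v \<Rightarrow> 'v \<Rightarrow> 'v \<Rightarrow> 'a::ab_group_add) \<Rightarrow> 'v \<Rightarrow> 'v \<Rightarrow> 'v \<Rightarrow> 'v \<Rightarrow> 'a" where
  "cobd2 c v0 v1 v2 v3 = c v1 v2 v3 - c v0 v2 v3 + c v0 v1 v3 - c v0 v1 v2"

definition cocycle2 :: "'v set set \<Rightarrow> ('v \<Rightarrow> 'v \<Rightarrow> 'v \<Rightarrow> int) \<Rightarrow> bool" where
  "cocycle2 K c \<longleftrightarrow> alt2 K c \<and>
     (\<forall>v0 v1 v2 v3. {v0, v1, v2, v3} \<in> K \<and> distinct [v0, v1, v2, v3] \<longrightarrow> cobd2 c v0 v1 v2 v3 = 0)"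

definition coboundary2 :: "'v set set \<Rightarrow> ('v \<Rightarrow> 'v \<Rightarrow> 'v \<Rightarrow> int) \<Rightarrow> bool" where
  "coboundary2 K c \<longleftrightarrow> (\<exists>b. alt1 K b \<and>
     (\<forall>u v w. {u, v, w} \<in> K \<and> distinct [u, v, w] \<longrightarrow> c u v w = cobd1 b u v w))"

definition no_2torsion_H2 :: "'v set set \<Rightarrow> bool" where
  "no_2torsion_H2 K \<longleftrightarrow> (\<forall>c. cocycle2 K c \<and> coboundary2 K (\<lambda>u v w. 2 * c u v w)
      \<longrightarrow> coboundary2 K c)"

definition FF :: "int \<Rightarrow> real" where
  "FF x = (if x = 3 \<or> x = -1 then 1/4 else if x = -3 \<or> x = 1 then -1/4 else 0)"

definition GG :: "('v \<Rightarrow> 'v \<Rightarrow> int) \<Rightarrow> 'v \<Rightarrow> 'v \<Rightarrow> 'v \<Rightarrow> real" where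
  "GG a u v w = FF (cobd1 a u v w) - 3/4 * of_int (cobd1 a u v w)"

definition local_triv ::
  "'e topology \<Rightarrow> ('e \<Rightarrow> 'b::topological_space) \<Rightarrow> (complex \<Rightarrow> 'e \<Rightarrow> 'e) \<Rightarrow> 'b set
     \<Rightarrow> ('e \<Rightarrow> 'b \<times> complex) \<Rightarrow> bool" where
  "local_triv E p act U \<phi> \<longleftrightarrow>
     homeomorphic_map (subtopology E {x \<in> topspace E. p x \<in> U})
                      (prod_topology (top_of_set U) (top_of_set (sphere 0 1))) \<phi>
   \<and> (\<forall>x\<in>topspace E. p x \<in> U \<longrightarrow> fst (\<phi> x) = p x \<and>
        (\<forall>z\<in>sphere 0 1. \<phi> (act z x) = (p x, z * snd (\<phi> x))))"

definition circle_bundle ::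
  "'e topology \<Rightarrow> ('e \<Rightarrow> 'b::topological_space) \<Rightarrow> (complex \<Rightarrow> 'e \<Rightarrow> 'e) \<Rightarrow> 'b set \<Rightarrow> bool" where
  "circle_bundle E p act X \<longleftrightarrow>
     continuous_map E (top_of_set X) p \<and> p ` topspace E = X
   \<and> continuous_map (prod_topology (top_of_set (sphere 0 1)) E) E (\<lambda>(z, x). act z x)
   \<and> (\<forall>x\<in>topspace E. act 1 x = x \<and> (\<forall>z\<in>sphere 0 1. act z x \<in> topspace E \<and> p (act z x) = p x
        \<and> (\<forall>w\<in>sphere 0 1. act z (act w x) = act (z * w) x)))
   \<and> (\<forall>y\<in>X. \<exists>U. openin (top_of_set X) U \<and> y \<in> U \<and> (\<exists>\<phi>. local_triv E p act U \<phi>))"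

text \<open>The integer 2-cochain e represents the Euler class: it is cohomologous to the
  obstruction cocycle of some section over the 1-skeleton, whose value on an oriented
  2-simplex [u,v,w] is the winding number of the section along the boundary loop,
  read in any equivariant trivialization over the closed simplex.\<close>
definition represents_euler ::
  "'v set set \<Rightarrow> 'e topology \<Rightarrow> ('e \<Rightarrow> 'v \<Rightarrow> real) \<Rightarrow> (complex \<Rightarrow> 'e \<Rightarrow> 'e)
     \<Rightarrow> ('v \<Rightarrow> 'v \<Rightarrow> 'v \<Rightarrow> int) \<Rightarrow> bool" where
  "represents_euler K E p act e \<longleftrightarrow>
    (\<exists>s b. continuous_map (top_of_set (geom (skel1 K))) E s
       \<and> (\<forall>x\<in>geom (skel1 K). p (s x) = x)
       \<and> alt1 K b
       \<and> (\<forall>u v w. {u, v, w} \<in> K \<and> distinct [u, v, w] \<longrightarrow>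
            (\<forall>\<phi>. local_triv E p act (geom (faces {u, v, w})) \<phi> \<longrightarrow>
               complex_of_int (e u v w - cobd1 b u v w)
                 = winding_number (\<lambda>t. snd (\<phi> (s (bdry u v w t)))) 0)))"

definition classical_triangulation ::
  "'v set set \<Rightarrow> 'e topology \<Rightarrow> ('e \<Rightarrow> 'v \<Rightarrow> real) \<Rightarrow> bool" where
  "classical_triangulation K E p \<longleftrightarrow>
    (\<exists>(W::nat set) L h f. simplicial_complex W L
       \<and> homeomorphic_map (top_of_set (geom L)) E h
       \<and> (\<forall>\<sigma>\<in>L. f ` \<sigma> \<in> K)
       \<and> (\<forall>x\<in>geom L. p (h x) = (\<lambda>v. \<Sum>w\<in>{w\<in>W. f w = v}. x w)))"

end

theory Submission
  imports Defs
begin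

text \<open>
  Put \<open>\<epsilon> = 4 e + 3 da = 4 \<F>(da)\<close>. Its values are \<open>\<plusminus>1\<close>, and the cocycle condition for \<open>e\<close> is Huntington's
  transitivity axiom, so \<open>\<epsilon>\<close> is a coherent family of cyclic orders on the simplices. Over a point \<open>x\<close>
  of the base we view the fibre as \<open>\<real>/4\<int>\<close> with a mark \<open>m\<^sub>v\<close> for every vertex \<open>v\<close> of the carrier of \<open>x\<close>, where
  \<open>m\<^sub>v - m\<^sub>u = a(u,v) + (\<Sum>\<^sub>z \<epsilon>(u,v,z) x\<^sub>z)\<close>. The arcs of radius \<open>x\<^sub>v\<close> around \<open>m\<^sub>v\<close> and \<open>m\<^sub>v + 2\<close> tile the circle
  in the cyclic order given by \<open>\<epsilon>\<close>; bisecting them yields a fibrewise subdivision with four vertices over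
  every \<open>v\<close>, which is a simplicial complex mapping simplicially to the base.

  The differences of marks add up to \<open>da + \<epsilon> = 4 (e + da)\<close> around a triangle. As \<open>e\<close> represents the Euler
  class, the transition angles between trivialisations over the closed stars can be lifted to real functions
  whose Cech coboundary cancels this, so that the marks can be realised in the given bundle by averaging
  with the barycentric coordinates.
\<close>

section \<open>Angles in quarter turns\<close>

definition qcis :: "real \<Rightarrow> complex" where
  "qcis r = cis (pi / 2 * r)"

lemma qcis_0 [simp]: "qcis 0 = 1"
  and qcis_1 [simp]: "qcis 1 = \<i>"
  and qcis_minus_1 [simp]: "qcis (- 1) = - \<i>"
  and qcis_2 [simp]: "qcis 2 = - 1"
  and norm_qcis [simp]: "norm (qcis r) = 1"
  and qcis_nonzero [simp]: "qcis r \<noteq> 0"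
  by (simp_all add: qcis_def cis_pi_half cis_minus_pi_half)

lemma qcis_add: "qcis (r + t) = qcis r * qcis t"
  by (simp add: qcis_def cis_mult distrib_left)

lemma qcis_minus: "qcis (- r) = inverse (qcis r)"
  by (simp add: qcis_def cis_inverse)

lemma qcis_diff: "qcis (r - t) = qcis r / qcis t"
  using qcis_add[of r "- t"] by (simp add: qcis_minus divide_inverse)

lemma qcis_eq_1_iff: "qcis r = 1 \<longleftrightarrow> (\<exists>n::int. r = 4 * n)"
proof -
  have "qcis r = 1 \<longleftrightarrow> exp (\<i> * complex_of_real (pi / 2 * r)) = 1"
    by (simp add: qcis_def cis_conv_exp)
  also have "\<dots> \<longleftrightarrow> (\<exists>n::int. pi / 2 * r = of_int (2 * n) * pi)"
    by (simp add: exp_eq_1)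
  also have "\<dots> \<longleftrightarrow> (\<exists>n::int. r = 4 * n)"
    by (simp add: field_simps)
  finally show ?thesis .
qed

lemma qcis_eq_iff: "qcis r = qcis t \<longleftrightarrow> (\<exists>n::int. r - t = 4 * n)"
  by (simp add: qcis_diff flip: qcis_eq_1_iff)

lemma continuous_on_qcis [continuous_intros]:
  "continuous_on S f \<Longrightarrow> continuous_on S (\<lambda>x. qcis (f x))"
  unfolding qcis_def by (intro continuous_intros)

lemma unit_eq_qcis:
  assumes "norm q = 1"
  obtains r where "q = qcis r" "- 2 < r" "r \<le> 2"
proof
  have "q \<noteq> 0" using assms by auto
  then show "q = qcis (Arg q * 2 / pi)"
    using assms by (simp add: qcis_def cis_Arg sgn_div_norm)
  show "- 2 < Arg q * 2 / pi" "Arg q * 2 / pi \<le> 2"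
    using Arg_bounded[of q] by (auto simp: field_simps)
qed

lemma exp_eq_qcis:
  assumes "norm (exp z) = 1" shows "exp z = qcis (2 / pi * Im z)"
proof -
  have "exp (Re z) = 1" using assms by simp
  then show ?thesis by (simp add: exp_eq_polar qcis_def)
qed

lemma qcis_lift_difference:
  fixes g h :: "'a::topological_space \<Rightarrow> real"
  assumes "connected S" "continuous_on S g" "continuous_on S h"
    and lift: "\<And>x. x \<in> S \<Longrightarrow> qcis (g x) = qcis (h x)" and "x \<in> S" "y \<in> S"
  shows "g x - h x = g y - h y"
proof -
  have "(\<lambda>x. g x - h x) constant_on S"
  proof (rule continuous_discrete_range_constant[OF \<open>connected S\<close>])
    show "continuous_on S (\<lambda>x. g x - h x)"
      using assms by (intro continuous_intros)
    have "4 \<le> norm ((g v - h v) - (g u - h u))"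
      if "u \<in> S" "v \<in> S" and ne: "g v - h v \<noteq> g u - h u" for u v
    proof -
      obtain m n :: int where "g u - h u = 4 * m" "g v - h v = 4 * n"
        using lift \<open>u \<in> S\<close> \<open>v \<in> S\<close> unfolding qcis_eq_iff by fastforce
      with ne show ?thesis by auto
    qed
    then show "\<exists>e>0. \<forall>v. v \<in> S \<and> g v - h v \<noteq> g u - h u \<longrightarrow> e \<le> norm ((g v - h v) - (g u - h u))"
      if "u \<in> S" for u
      using that by (intro exI[of _ 4]) auto
  qed
  then show ?thesis using assms(5,6) by (auto simp: constant_on_def)
qed

lemma winding_number_qcis_lift:
  assumes "continuous_on {0..1} g" and unit: "\<And>t. t \<in> {0..1} \<Longrightarrow> norm (g t) = 1"
  obtains h where "continuous_on {0..1} h" "\<And>t. t \<in> {0..1} \<Longrightarrow> g t = qcis (h t)"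
    "winding_number g 0 = complex_of_real ((h 1 - h 0) / 4)"
proof -
  have "path g" "0 \<notin> path_image g"
    using assms by (force simp: path_def path_image_def)+
  then obtain l where "path l"
    and wind: "pathfinish l - pathstart l = 2 * of_real pi * \<i> * winding_number g 0"
    and log: "\<And>t. t \<in> {0..1} \<Longrightarrow> g t = exp (l t)"
    using winding_number_as_continuous_log[of g 0] by (auto simp: path_def)
  define h where "h t = 2 / pi * Im (l t)" for t
  show thesis
  proof
    show "continuous_on {0..1} h"
      unfolding h_def using \<open>path l\<close> by (intro continuous_intros) (auto simp: path_def)
    show "g t = qcis (h t)" if "t \<in> {0..1}" for t
      using exp_eq_qcis[of "l t"] log[OF that] unit[OF that] by (simp add: h_def)
    have "Re (l t) = 0" if "t \<in> {0..1}" for t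
      using log[OF that] unit[OF that] by simp
    then have l_eq: "l t = \<i> * of_real (pi / 2 * h t)" if "t \<in> {0..1}" for t
      using that by (simp add: h_def complex_eq_iff)
    have "2 * of_real pi * \<i> * winding_number g 0 = \<i> * of_real (pi / 2 * h 1) - \<i> * of_real (pi / 2 * h 0)"
      using wind l_eq[of 0] l_eq[of 1] by (simp add: pathfinish_def pathstart_def del: of_real_mult)
    also have "\<dots> = 2 * of_real pi * \<i> * of_real ((h 1 - h 0) / 4)"
      by (simp add: right_diff_distrib diff_divide_distrib)
    finally show "winding_number g 0 = of_real ((h 1 - h 0) / 4)"
      by (simp del: of_real_divide of_real_diff)
  qed
qed

section \<open>Topological preliminaries\<close>

lemma Hausdorff_space_top_of_set_fun:
  "Hausdorff_space (top_of_set S)" for S :: "('a \<Rightarrow> 'b::metric_space) set"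
proof -
  have "Hausdorff_space (product_topology (\<lambda>_::'a. euclidean :: 'b topology) UNIV)"
    by (simp add: Hausdorff_space_product_topology)
  then show ?thesis by (simp add: euclidean_product_topology Hausdorff_space_subtopology)
qed

lemma atin_within_openin:
  assumes "openin X S" "a \<in> S" shows "atin_within X a S = atin X a"
proof -
  have "\<forall>\<^sub>F x in atin X a. x \<in> S"
    unfolding eventually_atin using assms by blast
  then have "eventually P (atin_within X a S) \<longleftrightarrow> eventually P (atin X a)" for P
    by (subst eventually_within_imp) (rule eventually_subst, erule eventually_mono, simp)
  then show ?thesis by (simp add: filter_eq_iff)
qed

lemma continuous_map_dominated:
  fixes F :: "'a \<Rightarrow> 'b::real_normed_vector"
  assumes r: "continuous_map X euclideanreal r"
    and F: "continuous_map (subtopology X {x \<in> topspace X. r x \<noteq> 0}) euclidean F"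
    and dominated: "\<And>x. x \<in> topspace X \<Longrightarrow> norm (F x) \<le> B * \<bar>r x\<bar>"
  shows "continuous_map X euclidean F"
proof -
  let ?N = "{x \<in> topspace X. r x \<noteq> 0}"
  have "(F \<longlongrightarrow> F x) (atin X x)" if x: "x \<in> topspace X" for x
  proof (cases "r x = 0")
    case True
    have "(r \<longlongrightarrow> r x) (atin X x)"
      using r x by (simp add: continuous_map_atin)
    then have "((\<lambda>y. B * \<bar>r y\<bar>) \<longlongrightarrow> B * \<bar>r x\<bar>) (atin X x)"
      by (intro tendsto_intros)
    then have "((\<lambda>y. B * \<bar>r y\<bar>) \<longlongrightarrow> 0) (atin X x)" using True by simp
    moreover have "\<forall>\<^sub>F y in atin X x. norm (F y) \<le> B * \<bar>r y\<bar>"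
      unfolding eventually_atin using dominated by (blast intro: openin_topspace)
    ultimately have "(F \<longlongrightarrow> 0) (atin X x)" by (rule Lim_null_comparison[rotated])
    then show ?thesis using dominated[OF x] True by simp
  next
    case False
    have "openin X ?N"
      using openin_continuous_map_preimage[OF r, of "- {0}"] by (simp add: open_Compl)
    then have "atin_within X x ?N = atin X x"
      using x False by (intro atin_within_openin) simp_all
    moreover have "(F \<longlongrightarrow> F x) (atin_within X x ?N)"
      using limit_continuous_map_within[OF F] x False by simp
    ultimately show ?thesis by simp
  qed
  then show ?thesis by (simp add: continuous_map_atin)
qed

lemma continuous_on_mult_vanishing:
  fixes r F :: "'a::topological_space \<Rightarrow> real"
  assumes r: "continuous_on D r" and C: "compact C" "continuous_on C F"
    and sub: "{x \<in> D. r x \<noteq> 0} \<subseteq> C"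
  shows "continuous_on D (\<lambda>x. r x * F x)"
proof -
  let ?N = "{x \<in> D. r x \<noteq> 0}"
  have "bounded (F ` C)"
    using C by (intro compact_imp_bounded compact_continuous_image)
  then obtain B where B: "\<And>x. x \<in> C \<Longrightarrow> \<bar>F x\<bar> \<le> B"
    unfolding bounded_real by blast
  have "continuous_map (top_of_set D) euclideanreal (\<lambda>x. r x * F x)"
  proof (rule continuous_map_dominated[where r = r and B = B])
    have "continuous_on ?N (\<lambda>x. r x * F x)"
      using continuous_on_subset[OF r, of ?N] continuous_on_subset[OF C(2) sub]
      by (intro continuous_intros) auto
    moreover have "D \<inter> ?N = ?N" by auto
    ultimately show "continuous_map (subtopology (top_of_set D) {x \<in> topspace (top_of_set D). r x \<noteq> 0})
        euclidean (\<lambda>x. r x * F x)"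
      by (simp add: subtopology_subtopology)
    show "norm (r x * F x) \<le> B * \<bar>r x\<bar>" if "x \<in> topspace (top_of_set D)" for x
      using B[of x] sub that mult_left_mono[of "\<bar>F x\<bar>" B "\<bar>r x\<bar>"]
      by (cases "r x = 0") (auto simp: abs_mult mult.commute)
  qed (use r in simp)
  then show ?thesis by simp
qed

lemma compact_Hausdorff_bump:
  assumes "compact_space X" "Hausdorff_space X" and U: "openin X U" "x \<in> U"
  obtains \<rho> where "continuous_map X euclideanreal \<rho>" "\<forall>y\<in>topspace X - U. \<rho> y = 0" "\<rho> x = 1"
proof -
  have "completely_regular_space X"
    using assms(1,2)
    by (intro normal_imp_completely_regular_space compact_Hausdorff_or_regular_imp_normal_space)
      auto
  moreover have "closedin X (topspace X - U)" "x \<in> topspace X - (topspace X - U)"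
    using U openin_subset[OF U(1)] by auto
  ultimately have "\<exists>f. continuous_map X (top_of_set {0..1::real}) f \<and> f x = 0 \<and> f ` (topspace X - U) \<subseteq> {1}"
    unfolding completely_regular_space_def by blast
  then obtain f where "continuous_map X euclideanreal f" "f x = 0" "f ` (topspace X - U) \<subseteq> {1}"
    unfolding continuous_map_in_subtopology by blast
  then show thesis
    by (intro that[of "\<lambda>y. 1 - f y"]) (auto intro!: continuous_intros)
qed

lemma compact_Hausdorff_bumps:
  fixes X :: "'a topology"
  assumes X: "compact_space X" "Hausdorff_space X"
    and nbhd: "\<And>x. x \<in> topspace X \<Longrightarrow> \<exists>U. openin X U \<and> x \<in> U \<and> P U"
  obtains I :: "'a set" and U \<rho> where "finite I" "\<And>i. i \<in> I \<Longrightarrow> openin X (U i) \<and> P (U i)"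
    "\<And>i. i \<in> I \<Longrightarrow> continuous_map X euclideanreal (\<rho> i)"
    "\<And>i x. i \<in> I \<Longrightarrow> x \<in> topspace X - U i \<Longrightarrow> \<rho> i x = 0"
    "\<And>x. x \<in> topspace X \<Longrightarrow> \<exists>i\<in>I. 1 / 2 < \<rho> i x"
proof -
  have "\<exists>U \<rho>. openin X U \<and> P U \<and> continuous_map X euclideanreal \<rho>
      \<and> (\<forall>y\<in>topspace X - U. \<rho> y = 0) \<and> \<rho> x = 1" if x: "x \<in> topspace X" for x
  proof -
    obtain U where U: "openin X U" "x \<in> U" "P U" using nbhd[OF x] by blast
    obtain \<rho> where "continuous_map X euclideanreal \<rho>" "\<forall>y\<in>topspace X - U. \<rho> y = 0" "\<rho> x = 1"
      using compact_Hausdorff_bump[OF X U(1,2)] .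
    with U show ?thesis by blast
  qed
  then obtain U \<rho> where bump: "\<forall>x\<in>topspace X. openin X (U x) \<and> P (U x)
      \<and> continuous_map X euclideanreal (\<rho> x) \<and> (\<forall>y\<in>topspace X - U x. \<rho> x y = 0) \<and> \<rho> x x = (1::real)"
    by metis
  define peak where "peak x = {y \<in> topspace X. 1 / 2 < \<rho> x y}" for x
  have "openin X (peak x)" if "x \<in> topspace X" for x
    using openin_continuous_map_preimage[of X euclideanreal "\<rho> x" "{1/2<..}"] bump that
    by (auto simp: peak_def)
  moreover have "topspace X \<subseteq> \<Union> (peak ` topspace X)"
    using bump by (force simp: peak_def)
  moreover have "compactin X (topspace X)"
    using X(1) by (simp add: compact_space_def)
  ultimately obtain \<F> where \<F>: "finite \<F>" "\<F> \<subseteq> peak ` topspace X" "topspace X \<subseteq> \<Union> \<F>"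
    using compactinD[of X "topspace X" "peak ` topspace X"] by auto
  obtain I where I: "finite I" "I \<subseteq> topspace X" "\<F> = peak ` I"
    using finite_subset_image[OF \<F>(1,2)] by blast
  show thesis
  proof (rule that[OF I(1)])
    show "\<exists>i\<in>I. 1 / 2 < \<rho> i x" if "x \<in> topspace X" for x
      using that \<F>(3) I(3) by (auto simp: peak_def)
  qed (use bump I(2) in blast)+
qed

lemma compact_pos_lower_bound:
  fixes f :: "'a::topological_space \<Rightarrow> real"
  assumes "compact C" "continuous_on C f" "\<And>x. x \<in> C \<Longrightarrow> 0 < f x"
  obtains d where "0 < d" "\<And>x. x \<in> C \<Longrightarrow> d \<le> f x"
proof (cases "C = {}")
  case True
  then show ?thesis using that[of 1] by simp
next
  case False
  then show ?thesis
    using continuous_attains_inf[OF assms(1) False assms(2)] assms(3) that by blast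
qed

lemma pos_near_diagonal:
  fixes f :: "real \<times> real \<times> 'a::topological_space \<Rightarrow> real"
  assumes S: "compact S" and f: "continuous_on ({0..1} \<times> {0..1} \<times> S) f"
    and pos: "\<And>t x. t \<in> {0..1} \<Longrightarrow> x \<in> S \<Longrightarrow> 0 < f (t, t, x)"
  obtains d where "0 < d"
    "\<And>t t' x. t \<in> {0..1} \<Longrightarrow> t' \<in> {0..1} \<Longrightarrow> x \<in> S \<Longrightarrow> \<bar>t - t'\<bar> < d \<Longrightarrow> 0 < f (t, t', x)"
proof -
  let ?D = "{0..1::real} \<times> {0..1::real} \<times> S"
  define bad where "bad = ?D \<inter> f -` {..0}"
  have "compact ?D" by (intro compact_Times S) auto
  moreover have "closedin (top_of_set ?D) bad"
    unfolding bad_def using f by (intro continuous_closedin_preimage) auto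
  ultimately have "compact bad" by (rule closedin_compact)
  moreover have "continuous_on bad (\<lambda>y. \<bar>fst y - fst (snd y)\<bar>)"
    by (intro continuous_intros)
  moreover have "0 < \<bar>fst y - fst (snd y)\<bar>" if "y \<in> bad" for y
  proof -
    obtain t t' x where y: "y = (t, t', x)" by (cases y)
    have "t \<noteq> t'" using that pos[of t x] by (auto simp: y bad_def)
    then show ?thesis by (simp add: y)
  qed
  ultimately obtain d where d: "0 < d" "\<And>y. y \<in> bad \<Longrightarrow> d \<le> \<bar>fst y - fst (snd y)\<bar>"
    using compact_pos_lower_bound by blast
  show thesis
  proof (rule that[OF d(1)], rule ccontr)
    fix t t' x assume "t \<in> {0..1}" "t' \<in> {0..1}" "x \<in> S" "\<bar>t - t'\<bar> < d" "\<not> 0 < f (t, t', x)"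
    moreover from this have "(t, t', x) \<in> bad" by (simp add: bad_def)
    ultimately show False using d(2) by fastforce
  qed
qed

lemma exp_sum_Ln_ratios:
  fixes g :: "nat \<Rightarrow> complex"
  assumes "\<And>j. j \<le> n \<Longrightarrow> g j \<noteq> 0"
  shows "exp (Ln (g 0) + (\<Sum>j<n. Ln (g (Suc j) / g j))) = g n"
  using assms
proof (induction n)
  case (Suc n)
  then show ?case
    using Suc.prems[of n] Suc.prems[of "Suc n"] by (simp add: exp_add flip: mult.assoc)
qed simp

section \<open>Geometric realisations\<close>

definition supp :: "('v \<Rightarrow> real) \<Rightarrow> 'v set" where
  "supp x = {v. x v \<noteq> 0}"

lemma geom_iff:
  "x \<in> geom K \<longleftrightarrow> (\<forall>v. 0 \<le> x v) \<and> supp x \<in> K \<and> sum x (supp x) = 1"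
  by (simp add: geom_def supp_def)

lemma sum_supp: "finite A \<Longrightarrow> supp x \<subseteq> A \<Longrightarrow> sum x (supp x) = sum x A"
  by (rule sum.mono_neutral_left) (auto simp: supp_def)

lemma geom_sum: "x \<in> geom K \<Longrightarrow> finite A \<Longrightarrow> supp x \<subseteq> A \<Longrightarrow> sum x A = 1"
  using sum_supp[of A x] by (simp add: geom_iff)

lemma supp_vtx [simp]: "supp (vtx v) = {v}"
  by (auto simp: supp_def vtx_def)

lemma vtx_in_geom: "{v} \<in> K \<Longrightarrow> vtx v \<in> geom K"
  by (auto simp: geom_iff) (auto simp: vtx_def)

lemma geom_faces_iff:
  assumes "finite \<sigma>"
  shows "x \<in> geom (faces \<sigma>) \<longleftrightarrow> (\<forall>v. 0 \<le> x v) \<and> supp x \<subseteq> \<sigma> \<and> sum x \<sigma> = 1"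
  using sum_supp[OF assms, of x] by (auto simp: geom_iff faces_def)

lemma geom_faces_mono: "\<tau> \<subseteq> \<sigma> \<Longrightarrow> geom (faces \<tau>) \<subseteq> geom (faces \<sigma>)"
  by (auto simp: geom_def faces_def)

lemma vtx_in_geom_faces: "v \<in> \<sigma> \<Longrightarrow> vtx v \<in> geom (faces \<sigma>)"
  by (intro vtx_in_geom) (simp add: faces_def)

lemma compact_geom_faces:
  fixes \<sigma> :: "'v set"
  assumes "finite \<sigma>" shows "compact (geom (faces \<sigma>))"
proof -
  define cube :: "('v \<Rightarrow> real) set" where "cube = (\<Pi>\<^sub>E v\<in>UNIV. {0..1})"
  have "compactin (product_topology (\<lambda>_. euclidean) UNIV) cube"
    unfolding cube_def by (subst compactin_PiE) auto
  then have "compact cube" by (simp add: euclidean_product_topology)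
  define \<Delta> where "\<Delta> = (\<Inter>v. {x. 0 \<le> x v}) \<inter> (\<Inter>v\<in>-\<sigma>. {x::'v \<Rightarrow> real. x v = 0}) \<inter> {x. sum x \<sigma> = 1}"
  have "closed \<Delta>"
    unfolding \<Delta>_def
    by (intro closed_Int closed_INT ballI closed_Collect_le closed_Collect_eq continuous_intros
        continuous_on_product_coordinates)
  have geom_eq: "geom (faces \<sigma>) = \<Delta>"
    by (auto simp: geom_faces_iff[OF assms] \<Delta>_def supp_def)
  have "x v \<le> 1" if "x \<in> \<Delta>" for x v
    using that member_le_sum[of v \<sigma> x] assms by (cases "v \<in> \<sigma>") (auto simp: \<Delta>_def)
  then have "\<Delta> = cube \<inter> \<Delta>"
    by (auto simp: cube_def \<Delta>_def)
  then show ?thesis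
    using compact_Int_closed[OF \<open>compact cube\<close> \<open>closed \<Delta>\<close>] by (simp add: geom_eq)
qed

locale finite_complex =
  fixes V :: "'v set" and K :: "'v set set"
  assumes complex: "simplicial_complex V K"
begin

lemma finite_vertices: "finite V"
  and simplex_nonempty: "\<sigma> \<in> K \<Longrightarrow> \<sigma> \<noteq> {}"
  and simplex_subset: "\<sigma> \<in> K \<Longrightarrow> \<sigma> \<subseteq> V"
  and face: "\<sigma> \<in> K \<Longrightarrow> \<tau> \<subseteq> \<sigma> \<Longrightarrow> \<tau> \<noteq> {} \<Longrightarrow> \<tau> \<in> K"
  and vertex: "v \<in> V \<Longrightarrow> {v} \<in> K"
  using complex unfolding simplicial_complex_def by metis+

lemma finite_simplex: "\<sigma> \<in> K \<Longrightarrow> finite \<sigma>"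
  using simplex_subset finite_vertices finite_subset by metis

lemma finite_simplices: "finite K"
  using simplex_subset finite_vertices by (intro finite_subset[of K "Pow V"]) auto

lemma geom_nonneg: "x \<in> geom K \<Longrightarrow> 0 \<le> x v"
  and supp_in_complex: "x \<in> geom K \<Longrightarrow> supp x \<in> K"
  by (auto simp: geom_iff)

lemma finite_supp: "x \<in> geom K \<Longrightarrow> finite (supp x)"
  and supp_nonempty: "x \<in> geom K \<Longrightarrow> supp x \<noteq> {}"
  and supp_subset: "x \<in> geom K \<Longrightarrow> supp x \<subseteq> V"
  using supp_in_complex finite_simplex simplex_nonempty simplex_subset by blast+

lemma geom_sum_vertices: "x \<in> geom K \<Longrightarrow> sum x V = 1"
  by (rule geom_sum[OF _ finite_vertices supp_subset])

lemma geom_le_1: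
  assumes "x \<in> geom K" shows "x v \<le> 1"
proof (cases "v \<in> V")
  case True
  then show ?thesis
    using member_le_sum[of v V x] geom_nonneg[OF assms] finite_vertices geom_sum_vertices[OF assms]
    by auto
next
  case False
  then have "x v = 0" using supp_subset[OF assms] by (auto simp: supp_def)
  then show ?thesis by simp
qed

lemma supp_pos: "x \<in> geom K \<Longrightarrow> v \<in> supp x \<Longrightarrow> 0 < x v"
  using geom_nonneg[of x v] by (auto simp: supp_def less_le)

lemma supp_face: "x \<in> geom K \<Longrightarrow> \<tau> \<subseteq> supp x \<Longrightarrow> \<tau> \<noteq> {} \<Longrightarrow> \<tau> \<in> K"
  by (rule face[OF supp_in_complex])

lemma seg_in_geom:
  assumes x: "x \<in> geom K" and y: "y \<in> geom K" and "0 \<le> t" "t \<le> 1" and xy: "supp x \<union> supp y \<in> K"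
  shows "seg x y t \<in> geom K" and "supp (seg x y t) \<subseteq> supp x \<union> supp y"
proof -
  show sub: "supp (seg x y t) \<subseteq> supp x \<union> supp y" by (auto simp: supp_def seg_def)
  let ?\<sigma> = "supp x \<union> supp y"
  have fin: "finite ?\<sigma>" using finite_simplex[OF xy] .
  have "sum (seg x y t) ?\<sigma> = (1 - t) * sum x ?\<sigma> + t * sum y ?\<sigma>"
    by (simp add: seg_def sum.distrib sum_distrib_left)
  also have "\<dots> = 1" using geom_sum[OF x fin] geom_sum[OF y fin] by simp
  finally have "sum (seg x y t) (supp (seg x y t)) = 1" using sum_supp[OF fin sub] by simp
  moreover from this have "supp (seg x y t) \<noteq> {}" by auto
  moreover have "0 \<le> seg x y t v" for v
    using assms geom_nonneg by (simp add: seg_def)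
  ultimately show "seg x y t \<in> geom K"
    using face[OF xy sub] by (simp add: geom_iff)
qed

end

lemma finite_complex_faces: "finite \<sigma> \<Longrightarrow> finite_complex \<sigma> (faces \<sigma>)"
  by unfold_locales (auto simp: simplicial_complex_def faces_def)

lemma seg_in_edge:
  assumes "0 \<le> t" "t \<le> 1" shows "seg (vtx u) (vtx v) t \<in> geom (faces {u, v})"
proof -
  interpret finite_complex "{u, v}" "faces {u, v}" by (rule finite_complex_faces) simp
  show ?thesis
    using assms by (intro seg_in_geom(1) vtx_in_geom_faces) (auto simp: faces_def)
qed

lemma edge_subset_skel1:
  assumes "simplicial_complex V K" "{u, v} \<in> K"
  shows "geom (faces {u, v}) \<subseteq> geom (skel1 K)"
proof -
  interpret finite_complex V K using assms(1) by unfold_locales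
  have "\<tau> \<in> skel1 K" if "\<tau> \<subseteq> {u, v}" "\<tau> \<noteq> {}" for \<tau>
  proof -
    have "card \<tau> \<le> card {u, v}" using that by (intro card_mono) auto
    also have "\<dots> \<le> 2" by (simp add: card_insert_if)
    finally show ?thesis using face[OF assms(2)] that by (simp add: skel1_def)
  qed
  then show ?thesis by (auto simp: geom_iff faces_def)
qed

subsection \<open>Simplicial maps\<close>

definition push :: "'w set \<Rightarrow> ('w \<Rightarrow> 'v) \<Rightarrow> ('w \<Rightarrow> real) \<Rightarrow> 'v \<Rightarrow> real" where
  "push W f x = (\<lambda>v. \<Sum>w\<in>{w\<in>W. f w = v}. x w)"

lemma continuous_on_push: "continuous_on S (push W f)"
  unfolding push_def
  by (intro continuous_on_coordinatewise_then_product continuous_intros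
      continuous_on_subset[OF continuous_on_product_coordinates]) auto

lemma push_push:
  assumes "finite W" shows "push (f ` W) g (push W f x) = push W (g \<circ> f) x"
proof
  fix v
  have "push (f ` W) g (push W f x) v = (\<Sum>u\<in>{u \<in> f ` W. g u = v}. \<Sum>w\<in>{w \<in> {w\<in>W. g (f w) = v}. f w = u}. x w)"
    unfolding push_def by (intro sum.cong) auto
  also have "\<dots> = push W (g \<circ> f) x v"
    unfolding push_def o_def using assms by (intro sum.group) auto
  finally show "push (f ` W) g (push W f x) v = push W (g \<circ> f) x v" .
qed

lemma push_ident:
  assumes "supp x \<subseteq> W" "\<And>w. w \<in> W \<Longrightarrow> f w = w" shows "push W f x = x"
proof
  fix v
  have "{w \<in> W. f w = v} = (if v \<in> W then {v} else {})" using assms(2) by auto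
  then show "push W f x v = x v" using assms(1) by (auto simp: push_def supp_def)
qed

lemma supp_push:
  assumes "finite W" "\<And>w. 0 \<le> x w" "supp x \<subseteq> W"
  shows "supp (push W f x) = f ` supp x"
proof -
  have "push W f x v = 0 \<longleftrightarrow> (\<forall>w\<in>W. f w = v \<longrightarrow> x w = 0)" for v
    unfolding push_def using assms(1,2) by (subst sum_nonneg_eq_0_iff) auto
  then show ?thesis using assms(3) unfolding supp_def by blast
qed

lemma push_in_geom:
  assumes L: "simplicial_complex W L" and x: "x \<in> geom L" and f: "\<And>\<sigma>. \<sigma> \<in> L \<Longrightarrow> f ` \<sigma> \<in> K"
  shows "push W f x \<in> geom K"
proof -
  interpret finite_complex W L using L by unfold_locales
  have supp: "supp (push W f x) = f ` supp x"
    using supp_push[OF finite_vertices geom_nonneg[OF x] supp_subset[OF x]] .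
  have "sum (push W f x) (supp (push W f x)) = (\<Sum>v\<in>f ` supp x. \<Sum>w\<in>{w \<in> supp x. f w = v}. x w)"
    unfolding supp using supp_subset[OF x] finite_vertices unfolding push_def
    by (intro sum.cong[OF refl sum.mono_neutral_right]) (auto simp: supp_def)
  also have "\<dots> = sum x (supp x)"
    using finite_supp[OF x] by (intro sum.group) auto
  finally have "sum (push W f x) (supp (push W f x)) = 1"
    using x by (simp add: geom_iff)
  then show ?thesis
    using f[OF supp_in_complex[OF x]] geom_nonneg[OF x]
    by (simp add: geom_iff supp) (simp add: push_def sum_nonneg)
qed

lemma simplicial_complex_image:
  assumes "simplicial_complex W L" shows "simplicial_complex (f ` W) ((`) f ` L)"
proof -
  interpret finite_complex W L using assms by unfold_locales
  have "\<tau> \<in> (`) f ` L" if "\<sigma> \<in> L" "\<tau> \<subseteq> f ` \<sigma>" "\<tau> \<noteq> {}" for \<sigma> \<tau>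
  proof -
    have "\<tau> = f ` {w \<in> \<sigma>. f w \<in> \<tau>}" using \<open>\<tau> \<subseteq> f ` \<sigma>\<close> by auto
    moreover from this have "{w \<in> \<sigma>. f w \<in> \<tau>} \<in> L"
      using \<open>\<tau> \<noteq> {}\<close> by (intro face[OF \<open>\<sigma> \<in> L\<close>]) auto
    ultimately show ?thesis by blast
  qed
  moreover have "{f w} \<in> (`) f ` L" if "w \<in> W" for w
    using vertex[OF that] by (intro image_eqI[of _ _ "{w}"]) auto
  ultimately show ?thesis
    unfolding simplicial_complex_def using finite_vertices simplex_nonempty simplex_subset
    by (auto simp: image_mono)
qed

lemma homeomorphic_maps_push_inj:
  assumes L: "simplicial_complex W L" and inj: "inj_on f W"
  shows "homeomorphic_maps (top_of_set (geom L)) (top_of_set (geom ((`) f ` L)))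
    (push W f) (push (f ` W) (inv_into W f))"
proof -
  interpret L: finite_complex W L using L by unfold_locales
  interpret fL: finite_complex "f ` W" "(`) f ` L"
    using simplicial_complex_image[OF L] by unfold_locales
  let ?g = "inv_into W f"
  have push_f: "push W f x \<in> geom ((`) f ` L)" if "x \<in> geom L" for x
    by (rule push_in_geom[OF L that]) simp
  have push_g: "push (f ` W) ?g y \<in> geom L" if "y \<in> geom ((`) f ` L)" for y
  proof (rule push_in_geom[OF fL.complex that])
    fix \<tau> assume "\<tau> \<in> (`) f ` L"
    then obtain \<sigma> where "\<sigma> \<in> L" "\<tau> = f ` \<sigma>" by blast
    then show "?g ` \<tau> \<in> L" using inv_into_image_cancel[OF inj L.simplex_subset] by simp
  qed
  have "push (f ` W) ?g (push W f x) = x" if "x \<in> geom L" for x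
    using push_push[OF L.finite_vertices, of f ?g x]
      push_ident[OF L.supp_subset[OF that], of "?g \<circ> f"] inj
    by simp
  moreover have "push W f (push (f ` W) ?g y) = y" if "y \<in> geom ((`) f ` L)" for y
    using push_push[OF fL.finite_vertices, of ?g f y] inv_into_image_cancel[OF inj order_refl]
      push_ident[OF fL.supp_subset[OF that], of "f \<circ> ?g"]
    by (simp add: f_inv_into_f)
  ultimately show ?thesis
    unfolding homeomorphic_maps_def using push_f push_g
    by (auto simp: continuous_on_push continuous_map_in_subtopology)
qed

lemma classical_triangulationI:
  assumes L: "simplicial_complex W L"
    and g: "homeomorphic_map E (top_of_set (geom L)) g"
    and simplicial: "\<And>\<sigma>. \<sigma> \<in> L \<Longrightarrow> f ` \<sigma> \<in> K"
    and p: "\<And>\<xi>. \<xi> \<in> topspace E \<Longrightarrow> p \<xi> = push W f (g \<xi>)"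
  shows "classical_triangulation K E p"
proof -
  interpret finite_complex W L using L by unfold_locales
  obtain \<iota> :: "'a \<Rightarrow> nat" where inj: "inj_on \<iota> W"
    using finite_imp_inj_to_nat_seg[OF finite_vertices] by blast
  let ?X = "top_of_set (geom ((`) \<iota> ` L))" and ?back = "push (\<iota> ` W) (inv_into W \<iota>)"
  have relabel: "homeomorphic_maps (top_of_set (geom L)) ?X (push W \<iota>) ?back"
    by (rule homeomorphic_maps_push_inj[OF L inj])
  obtain h where h: "homeomorphic_maps E (top_of_set (geom L)) g h"
    using g homeomorphic_map_maps by blast
  have "homeomorphic_map ?X E (h \<circ> ?back)"
    by (rule homeomorphic_map_compose)
      (use h relabel homeomorphic_map_maps homeomorphic_maps_sym in blast)+
  moreover have "p ((h \<circ> ?back) y) = push (\<iota> ` W) (f \<circ> inv_into W \<iota>) y"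
    if y: "y \<in> geom ((`) \<iota> ` L)" for y
  proof -
    have "?back y \<in> geom L"
      using relabel y unfolding homeomorphic_maps_def
      by (auto simp: continuous_map_def)
    then have "h (?back y) \<in> topspace E" "g (h (?back y)) = ?back y"
      using h unfolding homeomorphic_maps_def by (auto simp: continuous_map_def)
    then have "p (h (?back y)) = push W f (?back y)" using p by simp
    then show ?thesis
      using push_push[of "\<iota> ` W" "inv_into W \<iota>" f y] finite_vertices
        inv_into_image_cancel[OF inj order_refl]
      by simp
  qed
  moreover have "(f \<circ> inv_into W \<iota>) ` \<tau> \<in> K" if \<tau>: "\<tau> \<in> (`) \<iota> ` L" for \<tau>
  proof -
    obtain \<sigma> where \<sigma>: "\<sigma> \<in> L" "\<tau> = \<iota> ` \<sigma>" using \<tau> by blast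
    then have "(f \<circ> inv_into W \<iota>) ` \<tau> = f ` \<sigma>"
      unfolding image_comp[symmetric] using inv_into_image_cancel[OF inj simplex_subset] by simp
    then show ?thesis using simplicial[OF \<sigma>(1)] by simp
  qed
  ultimately show ?thesis
    unfolding classical_triangulation_def push_def using simplicial_complex_image[OF L, of \<iota>]
    by blast
qed

section \<open>Lifting along the rays of a star-shaped set\<close>

definition star_at :: "('v \<Rightarrow> real) \<Rightarrow> ('v \<Rightarrow> real) set \<Rightarrow> bool" where
  "star_at c S \<longleftrightarrow> c \<in> S \<and> (\<forall>x\<in>S. \<forall>t\<in>{0..1}. seg c x t \<in> S)"

lemma star_at_center: "star_at c S \<Longrightarrow> c \<in> S"
  and star_at_seg: "star_at c S \<Longrightarrow> x \<in> S \<Longrightarrow> 0 \<le> t \<Longrightarrow> t \<le> 1 \<Longrightarrow> seg c x t \<in> S"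
  by (auto simp: star_at_def)

lemma seg_simps [simp]: "seg p q 0 = p" "seg p q 1 = q"
  by (auto simp: seg_def)

lemma continuous_on_seg:
  fixes g :: "'a::topological_space \<Rightarrow> 'v \<Rightarrow> real"
  assumes "continuous_on A f" "continuous_on A g" "continuous_on A h"
  shows "continuous_on A (\<lambda>x. seg (g x) (h x) (f x))"
  unfolding seg_def
  by (intro continuous_on_coordinatewise_then_product continuous_intros assms
      continuous_on_product_then_coordinatewise[OF assms(2)]
        continuous_on_product_then_coordinatewise[OF assms(3)])

lemma continuous_on_compose_seg:
  fixes f :: "('v \<Rightarrow> real) \<Rightarrow> 'a::topological_space"
  assumes "continuous_on S f" "star_at c S" "continuous_on A g" "continuous_on A h"
    and "\<And>y. y \<in> A \<Longrightarrow> h y \<in> S \<and> 0 \<le> g y \<and> g y \<le> 1"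
  shows "continuous_on A (\<lambda>y. f (seg c (h y) (g y)))"
  by (rule continuous_on_compose2[OF assms(1)])
    (use assms in \<open>auto simp: star_at_def intro!: continuous_on_seg continuous_on_const\<close>)

lemma star_at_connected:
  assumes "star_at c S" shows "connected S"
proof -
  let ?ray = "\<lambda>x. seg c x ` {0..1::real}"
  have ends: "c \<in> ?ray x" "x \<in> ?ray x" for x
    by (rule image_eqI[of _ _ 0], auto) (rule image_eqI[of _ _ 1], auto)
  have "S = (\<Union>x\<in>S. ?ray x)"
    using assms ends(2) by (auto simp: star_at_def)
  moreover have "connected (\<Union>x\<in>S. ?ray x)"
  proof (rule connected_Union)
    show "connected T" if "T \<in> ?ray ` S" for T
      using that
      by (auto intro!: connected_continuous_image continuous_on_seg continuous_on_id
          continuous_on_const)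
    show "\<Inter> (?ray ` S) \<noteq> {}" using ends(1) by blast
  qed
  ultimately show ?thesis by simp
qed

lemma star_at_uniform_steps:
  fixes N :: "('v \<Rightarrow> real) \<Rightarrow> ('v \<Rightarrow> real) \<Rightarrow> real"
  assumes S: "compact S" "star_at c S"
    and N: "continuous_on (S \<times> S) (\<lambda>(x, y). N x y)" and pos: "\<And>x. x \<in> S \<Longrightarrow> 0 < N x x"
  obtains M :: nat where "M > 0"
    "\<And>j x. j < M \<Longrightarrow> x \<in> S \<Longrightarrow> 0 < N (seg c x (real j / M)) (seg c x (real (Suc j) / M))"
proof -
  define ends where "ends = (\<lambda>(t, t', x). (seg c x t, seg c x t'))"
  let ?D = "{0..1::real} \<times> {0..1::real} \<times> S"
  have "continuous_on ?D ends"
    unfolding ends_def case_prod_unfold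
    by (intro continuous_on_Pair continuous_on_seg continuous_intros)
  moreover have "ends ` ?D \<subseteq> S \<times> S"
    by (auto simp: ends_def star_at_seg[OF S(2)])
  ultimately have "continuous_on ?D (\<lambda>y. (\<lambda>(x, y). N x y) (ends y))"
    by (rule continuous_on_compose2[OF N])
  then obtain d where "0 < d" and near: "\<And>t t' x. t \<in> {0..1} \<Longrightarrow> t' \<in> {0..1} \<Longrightarrow> x \<in> S \<Longrightarrow>
      \<bar>t - t'\<bar> < d \<Longrightarrow> 0 < N (seg c x t) (seg c x t')"
    by (rule pos_near_diagonal[OF S(1)]) (use pos star_at_seg[OF S(2)] in \<open>auto simp: ends_def\<close>)
  obtain M :: nat where M: "1 / d < real M" using reals_Archimedean2 by blast
  have "M > 0" using M \<open>0 < d\<close> by (cases "M = 0") auto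
  show thesis
  proof (rule that[OF \<open>M > 0\<close>], rule near)
    fix j assume "j < M"
    then show "real j / M \<in> {0..1}" "real (Suc j) / M \<in> {0..1}" by auto
    have "\<bar>real j / M - real (Suc j) / M\<bar> = 1 / M"
      using \<open>M > 0\<close> by (simp add: diff_divide_distrib[symmetric])
    then show "\<bar>real j / M - real (Suc j) / M\<bar> < d"
      using M \<open>M > 0\<close> \<open>0 < d\<close> by (simp add: field_simps)
  qed
qed

lemma star_at_log:
  fixes f :: "('v \<Rightarrow> real) \<Rightarrow> complex"
  assumes S: "compact S" "star_at c S" and f: "continuous_on S f" and nz: "\<And>x. x \<in> S \<Longrightarrow> f x \<noteq> 0"
  obtains F where "continuous_on S F" "\<And>x. x \<in> S \<Longrightarrow> f x = exp (F x)"
proof -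
  have "continuous_on (S \<times> S) (\<lambda>(x, y). Re (f y / f x))"
    unfolding case_prod_unfold
    by (intro continuous_intros continuous_on_compose2[OF f]) (auto simp: nz)
  moreover have "0 < Re (f x / f x)" if "x \<in> S" for x
    using nz[OF that] by simp
  ultimately obtain M :: nat where "M > 0" and step:
      "\<And>j x. j < M \<Longrightarrow> x \<in> S \<Longrightarrow> 0 < Re (f (seg c x (real (Suc j) / M)) / f (seg c x (real j / M)))"
    using star_at_uniform_steps[OF S] by blast
  define g where "g x j = f (seg c x (real j / M))" for x j
  have nz_g: "g x j \<noteq> 0" if "x \<in> S" "j \<le> M" for x j
    unfolding g_def using that by (intro nz star_at_seg[OF S(2)]) (auto simp: divide_le_eq_1)
  define F where "F x = Ln (f c) + (\<Sum>j<M. Ln (g x (Suc j) / g x j))" for x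
  have "continuous_on S (\<lambda>x. g x (Suc j) / g x j)" if "j < M" for j
    using that nz_g unfolding g_def
    by (intro continuous_intros continuous_on_compose_seg[OF f S(2)]) auto
  moreover have "g x (Suc j) / g x j \<notin> \<real>\<^sub>\<le>\<^sub>0" if "j < M" "x \<in> S" for j x
    using step[OF that] by (auto simp: g_def complex_nonpos_Reals_iff)
  ultimately have "continuous_on S F"
    unfolding F_def
    by (intro continuous_on_add continuous_on_const continuous_on_sum continuous_on_Ln') auto
  moreover have "f x = exp (F x)" if x: "x \<in> S" for x
    using exp_sum_Ln_ratios[of M "g x"] nz_g[OF x] \<open>M > 0\<close> by (simp add: F_def g_def)
  ultimately show thesis by (rule that)
qed

lemma star_at_qcis_lift_extends:
  fixes f :: "('v \<Rightarrow> real) \<Rightarrow> complex"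
  assumes S: "compact S" "star_at c S" and f: "continuous_on S f" "\<And>x. x \<in> S \<Longrightarrow> norm (f x) = 1"
    and T: "connected T" "T \<subseteq> S" "y \<in> T"
    and g: "continuous_on T g" "\<And>x. x \<in> T \<Longrightarrow> f x = qcis (g x)"
  obtains h where "continuous_on S h" "\<And>x. x \<in> S \<Longrightarrow> f x = qcis (h x)" "\<And>x. x \<in> T \<Longrightarrow> h x = g x"
proof -
  have "f x \<noteq> 0" if "x \<in> S" for x using f(2)[OF that] by auto
  then obtain F where F: "continuous_on S F" "\<And>x. x \<in> S \<Longrightarrow> f x = exp (F x)"
    using star_at_log[OF S f(1)] by blast
  define h where "h x = 2 / pi * Im (F x)" for x
  have h: "continuous_on S h" "\<And>x. x \<in> S \<Longrightarrow> f x = qcis (h x)"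
    unfolding h_def using F f(2) exp_eq_qcis by (auto intro!: continuous_intros)
  have same: "qcis (h x) = qcis (g x)" if "x \<in> T" for x
    using h(2) g(2) that T(2) by force
  then have "h x - g x = h y - g y" if "x \<in> T" for x
    using that T continuous_on_subset[OF h(1) T(2)] g(1) by (intro qcis_lift_difference[of T]) auto
  then have "h x - (h y - g y) = g x" if "x \<in> T" for x
    using that by (simp add: algebra_simps)
  moreover have "qcis (h y - g y) = 1" using same[OF T(3)] by (simp add: qcis_diff)
  ultimately show thesis
    using h
    by (intro that[of "\<lambda>x. h x - (h y - g y)"]) (auto simp: qcis_diff intro!: continuous_intros)
qed

subsection \<open>Closed stars\<close>

definition cstar :: "'v set set \<Rightarrow> 'v set \<Rightarrow> ('v \<Rightarrow> real) set" where
  "cstar K \<tau> = {x \<in> geom K. supp x \<union> \<tau> \<in> K}"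

lemma cstar_subset: "cstar K \<tau> \<subseteq> geom K"
  by (auto simp: cstar_def)

lemma cstar_empty: "cstar K {} = geom K"
  by (auto simp: cstar_def geom_iff)

context finite_complex
begin

lemma cstar_mono:
  assumes "\<tau> \<subseteq> \<tau>'" shows "cstar K \<tau>' \<subseteq> cstar K \<tau>"
proof
  fix x assume "x \<in> cstar K \<tau>'"
  then have x: "x \<in> geom K" "supp x \<union> \<tau>' \<in> K" by (auto simp: cstar_def)
  then have "supp x \<union> \<tau> \<in> K"
    using assms supp_nonempty by (intro face[OF x(2)]) auto
  then show "x \<in> cstar K \<tau>" using x by (simp add: cstar_def)
qed

lemma star_at_cstar:
  assumes \<tau>: "\<tau> \<in> K" "v \<in> \<tau>" shows "star_at (vtx v) (cstar K \<tau>)"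
  unfolding star_at_def
proof (intro conjI ballI)
  have v: "vtx v \<in> geom K"
    using face[OF \<tau>(1), of "{v}"] \<tau>(2) by (intro vtx_in_geom) auto
  then show "vtx v \<in> cstar K \<tau>" using \<tau> by (auto simp: cstar_def insert_absorb)
  fix x and t :: real assume "x \<in> cstar K \<tau>" and t: "t \<in> {0..1}"
  then have x: "x \<in> geom K" "supp x \<union> \<tau> \<in> K" by (auto simp: cstar_def)
  have "supp (vtx v) \<union> supp x \<in> K"
    by (rule face[OF x(2)]) (use \<tau> in auto)
  note seg = seg_in_geom[OF v x(1) _ _ this, of t]
  have "supp (seg (vtx v) x t) \<union> \<tau> \<in> K"
    by (rule face[OF x(2)]) (use seg t \<tau> in auto)
  then show "seg (vtx v) x t \<in> cstar K \<tau>" using seg t by (auto simp: cstar_def)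
qed

lemma cstar_eq_Union: "cstar K \<tau> = (\<Union>\<sigma>\<in>{\<sigma>\<in>K. \<tau> \<subseteq> \<sigma>}. geom (faces \<sigma>))"
proof
  show "cstar K \<tau> \<subseteq> (\<Union>\<sigma>\<in>{\<sigma>\<in>K. \<tau> \<subseteq> \<sigma>}. geom (faces \<sigma>))"
  proof
    fix x assume x: "x \<in> cstar K \<tau>"
    then have "x \<in> geom (faces (supp x \<union> \<tau>))"
      using simplex_nonempty[of "supp x"] by (auto simp: cstar_def geom_iff faces_def)
    then show "x \<in> (\<Union>\<sigma>\<in>{\<sigma>\<in>K. \<tau> \<subseteq> \<sigma>}. geom (faces \<sigma>))"
      using x by (auto simp: cstar_def)
  qed
  show "(\<Union>\<sigma>\<in>{\<sigma>\<in>K. \<tau> \<subseteq> \<sigma>}. geom (faces \<sigma>)) \<subseteq> cstar K \<tau>"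
  proof
    fix x assume "x \<in> (\<Union>\<sigma>\<in>{\<sigma>\<in>K. \<tau> \<subseteq> \<sigma>}. geom (faces \<sigma>))"
    then obtain \<sigma> where "\<sigma> \<in> K" "\<tau> \<subseteq> \<sigma>" "x \<in> geom (faces \<sigma>)" by auto
    moreover from this have "supp x \<in> K" "supp x \<union> \<tau> \<in> K"
      by (auto intro!: face[of \<sigma>] simp: geom_iff faces_def)
    ultimately show "x \<in> cstar K \<tau>" by (simp add: cstar_def geom_iff)
  qed
qed

lemma compact_cstar: "compact (cstar K \<tau>)"
  unfolding cstar_eq_Union
  using finite_simplices finite_simplex by (intro compact_UN compact_geom_faces) auto

lemma compact_geom: "compact (geom K)"
  using compact_cstar[of "{}"] by (simp add: cstar_empty)

lemma geom_faces_subset_cstar: "\<sigma> \<in> K \<Longrightarrow> \<tau> \<subseteq> \<sigma> \<Longrightarrow> geom (faces \<sigma>) \<subseteq> cstar K \<tau>"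
  unfolding cstar_eq_Union by blast

end

lemma star_at_geom_faces:
  assumes "finite \<sigma>" "v \<in> \<sigma>" shows "star_at (vtx v) (geom (faces \<sigma>))"
proof -
  interpret finite_complex \<sigma> "faces \<sigma>" by (rule finite_complex_faces[OF assms(1)])
  have "geom (faces \<sigma>) = cstar (faces \<sigma>) {v}"
    using assms by (auto simp: cstar_def geom_iff faces_def)
  then show ?thesis using star_at_cstar[of "{v}" v] assms by (auto simp: faces_def)
qed

subsection \<open>Winding numbers along the boundary of a triangle\<close>

lemma bdry_eq:
  "t \<le> 1/3 \<Longrightarrow> bdry u v w t = seg (vtx u) (vtx v) (3 * t)"
  "1/3 \<le> t \<Longrightarrow> t \<le> 2/3 \<Longrightarrow> bdry u v w t = seg (vtx v) (vtx w) (3 * t - 1)"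
  "2/3 \<le> t \<Longrightarrow> bdry u v w t = seg (vtx w) (vtx u) (3 * t - 2)"
proof -
  show "t \<le> 1/3 \<Longrightarrow> bdry u v w t = seg (vtx u) (vtx v) (3 * t)"
    by (simp add: bdry_def)
  show "bdry u v w t = seg (vtx v) (vtx w) (3 * t - 1)" if "1/3 \<le> t" "t \<le> 2/3"
  proof (cases "t = 1/3")
    case True
    show ?thesis unfolding True by (simp add: bdry_def)
  qed (use that in \<open>simp add: bdry_def\<close>)
  show "bdry u v w t = seg (vtx w) (vtx u) (3 * t - 2)" if "2/3 \<le> t"
  proof (cases "t = 2/3")
    case True
    show ?thesis unfolding True by (simp add: bdry_def)
  qed (use that in \<open>simp add: bdry_def\<close>)
qed

lemma continuous_on_bdry: "continuous_on {0..1} (bdry u v w)"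
proof -
  have "t = 1/3 \<Longrightarrow> seg (vtx u) (vtx v) (3 * t) = seg (vtx v) (vtx w) (3 * t - 1)"
    "t = 2/3 \<Longrightarrow> seg (vtx v) (vtx w) (3 * t - 1) = seg (vtx w) (vtx u) (3 * t - 2)" for t :: real
    by (simp_all only:) simp_all
  then show ?thesis
    unfolding bdry_def[abs_def]
    by (intro continuous_on_cases_le continuous_on_seg continuous_intros) force+
qed

lemma bdry_subset_edges:
  "bdry u v w ` {0..1} \<subseteq> geom (faces {u, v}) \<union> geom (faces {v, w}) \<union> geom (faces {w, u})"
proof (rule image_subsetI)
  fix t :: real assume t: "t \<in> {0..1}"
  consider "t \<le> 1/3" | "1/3 \<le> t" "t \<le> 2/3" | "2/3 \<le> t" by linarith
  then show "bdry u v w t \<in> geom (faces {u, v}) \<union> geom (faces {v, w}) \<union> geom (faces {w, u})"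
    using t by cases (auto simp: bdry_eq intro!: seg_in_edge)
qed

lemma qcis_lift_along_edge:
  assumes h: "continuous_on {a..b} h" "\<And>t. t \<in> {a..b} \<Longrightarrow> F (seg (vtx u) (vtx v) (3 * t - m)) = qcis (h t)"
    and f: "continuous_on (geom (faces {u, v})) f" "\<And>y. y \<in> geom (faces {u, v}) \<Longrightarrow> F y = qcis (f y)"
    and ab: "3 * a = m" "3 * b = m + 1"
  shows "h b - h a = f (vtx v) - f (vtx u)"
proof -
  let ?f = "\<lambda>t. f (seg (vtx u) (vtx v) (3 * t - m))"
  have edge: "seg (vtx u) (vtx v) (3 * t - m) \<in> geom (faces {u, v})" if "t \<in> {a..b}" for t
    using that ab by (intro seg_in_edge) auto
  have "continuous_on {a..b} ?f"
    using edge by (intro continuous_on_compose2[OF f(1)] continuous_on_seg continuous_intros) auto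
  then have "h b - ?f b = h a - ?f a"
    using h f(2) edge ab by (intro qcis_lift_difference[of "{a..b}"]) force+
  then show ?thesis using ab by simp
qed

lemma winding_number_bdry:
  fixes F :: "('v \<Rightarrow> real) \<Rightarrow> complex"
  assumes F: "continuous_on (geom (faces {u, v}) \<union> geom (faces {v, w}) \<union> geom (faces {w, u})) F"
    and uv: "continuous_on (geom (faces {u, v})) f\<^sub>1"
      "\<And>y. y \<in> geom (faces {u, v}) \<Longrightarrow> F y = qcis (f\<^sub>1 y)"
    and vw: "continuous_on (geom (faces {v, w})) f\<^sub>2"
      "\<And>y. y \<in> geom (faces {v, w}) \<Longrightarrow> F y = qcis (f\<^sub>2 y)"
    and wu: "continuous_on (geom (faces {w, u})) f\<^sub>3"
      "\<And>y. y \<in> geom (faces {w, u}) \<Longrightarrow> F y = qcis (f\<^sub>3 y)"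
  shows "winding_number (\<lambda>t. F (bdry u v w t)) 0
    = of_real ((f\<^sub>1 (vtx v) - f\<^sub>1 (vtx u) + (f\<^sub>2 (vtx w) - f\<^sub>2 (vtx v)) + (f\<^sub>3 (vtx u) - f\<^sub>3 (vtx w))) / 4)"
proof -
  have "continuous_on {0..1} (\<lambda>t. F (bdry u v w t))"
    by (rule continuous_on_compose2[OF F continuous_on_bdry bdry_subset_edges])
  moreover have "norm (F (bdry u v w t)) = 1" if "t \<in> {0..1}" for t
    using subsetD[OF bdry_subset_edges imageI[OF that], of u v w] uv(2) vw(2) wu(2) by auto
  ultimately obtain h where h: "continuous_on {0..1} h"
    "\<And>t. t \<in> {0..1} \<Longrightarrow> F (bdry u v w t) = qcis (h t)"
    and wind: "winding_number (\<lambda>t. F (bdry u v w t)) 0 = of_real ((h 1 - h 0) / 4)"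
    using winding_number_qcis_lift by blast
  have "h (1/3) - h 0 = f\<^sub>1 (vtx v) - f\<^sub>1 (vtx u)"
    by (rule qcis_lift_along_edge[OF continuous_on_subset[OF h(1)] _ uv, where m = 0])
      (use h(2) in \<open>auto simp flip: bdry_eq(1)[of _ u v w]\<close>)
  moreover have "h (2/3) - h (1/3) = f\<^sub>2 (vtx w) - f\<^sub>2 (vtx v)"
    by (rule qcis_lift_along_edge[OF continuous_on_subset[OF h(1)] _ vw, where m = 1])
      (use h(2) in \<open>auto simp flip: bdry_eq(2)[of _ u v w]\<close>)
  moreover have "h 1 - h (2/3) = f\<^sub>3 (vtx u) - f\<^sub>3 (vtx w)"
    by (rule qcis_lift_along_edge[OF continuous_on_subset[OF h(1)] _ wu, where m = 2])
      (use h(2) in \<open>auto simp flip: bdry_eq(3)[of _ u v w]\<close>)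
  ultimately have "h 1 - h 0 = f\<^sub>1 (vtx v) - f\<^sub>1 (vtx u) + (f\<^sub>2 (vtx w) - f\<^sub>2 (vtx v)) + (f\<^sub>3 (vtx u) - f\<^sub>3 (vtx w))"
    by linarith
  then show ?thesis using wind by simp
qed

section \<open>Weights on one fibre\<close>

definition unit_sign :: "bool \<Rightarrow> complex" where
  "unit_sign s = (if s then 1 else - 1)"

lemma unit_sign_simps [simp]:
  "unit_sign True = 1" "unit_sign False = - 1" "unit_sign (\<not> s) = - unit_sign s"
  "norm (unit_sign s) = 1" "unit_sign s \<noteq> 0" "unit_sign s * (unit_sign s * z) = z"
  by (auto simp: unit_sign_def)

lemma arccos_Re_qcis:
  assumes "\<bar>r\<bar> \<le> 2" shows "2 / pi * arccos (Re (qcis r)) = \<bar>r\<bar>"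
proof -
  have "cos (pi / 2 * r) = cos (pi / 2 * \<bar>r\<bar>)"
    by (cases "r \<ge> 0") (auto simp: abs_if)
  moreover have "arccos (cos (pi / 2 * \<bar>r\<bar>)) = pi / 2 * \<bar>r\<bar>"
    by (rule arccos_cos) (use assms in \<open>auto simp: field_simps\<close>)
  ultimately show ?thesis by (simp add: qcis_def field_simps)
qed

lemma arccos_Re_minus_qcis:
  assumes "\<bar>r\<bar> \<le> 2" shows "2 / pi * arccos (Re (- qcis r)) = 2 - \<bar>r\<bar>"
proof -
  have "\<bar>Re (qcis r)\<bar> \<le> 1" by (metis abs_Re_le_cmod norm_qcis)
  then have "arccos (Re (- qcis r)) = pi - arccos (Re (qcis r))"
    by (simp add: arccos_minus abs_le_iff)
  then show ?thesis using arccos_Re_qcis[OF assms] by (simp add: field_simps)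
qed

lemma arcsin_Im_qcis:
  assumes "- 1 \<le> r" "r \<le> 3"
  shows "2 / pi * arcsin (Im (qcis r)) = (if r \<le> 1 then r else 2 - r)"
proof -
  have small: "2 / pi * arcsin (Im (qcis t)) = t" if "\<bar>t\<bar> \<le> 1" for t
  proof -
    have "arcsin (sin (pi / 2 * t)) = pi / 2 * t"
      by (rule arcsin_sin)
        (use that mult_left_mono[of "- 1" t pi] in \<open>auto simp: field_simps abs_le_iff\<close>)
    then show ?thesis by (simp add: qcis_def field_simps)
  qed
  have "Im (qcis r) = Im (qcis (2 - r))"
    by (simp add: qcis_def right_diff_distrib sin_diff)
  then show ?thesis using small[of r] small[of "2 - r"] assms by auto
qed

lemma arcsin_Im_minus:
  assumes "norm q = 1" shows "arcsin (Im (- q)) = - arcsin (Im q)"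
proof -
  have "\<bar>Im q\<bar> \<le> 1" by (metis abs_Im_le_cmod assms)
  then show ?thesis by (simp add: arcsin_minus abs_le_iff)
qed

text \<open>Here \<open>q\<close> is the position in the fibre relative to the mark of a vertex \<open>v\<close>, and \<open>x\<close> the barycentric
  coordinate of \<open>v\<close>. Index \<open>(True, s)\<close> is the vertex at the centre of an arc of \<open>v\<close>, index
  \<open>(False, s)\<close> the one sitting in the gap that follows it; \<open>s\<close> distinguishes antipodal copies.\<close>

definition weight :: "bool \<times> bool \<Rightarrow> complex \<Rightarrow> real \<Rightarrow> real" where
  "weight i q x = (if fst i then max 0 (x - 2 / pi * arccos (Re (unit_sign (snd i) * q)))
               else min x (max 0 (2 / pi * arcsin (Im (unit_sign (snd i) * q)))))"

lemma weight_arc: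
  assumes "\<bar>r\<bar> \<le> x" "x \<le> 1"
  shows "weight i (unit_sign s * qcis r) x =
    (if i = (True, s) then x - \<bar>r\<bar> else if i = (False, s) then max 0 r
     else if i = (False, \<not> s) then max 0 (- r) else 0)"
proof -
  obtain k t where i: "i = (k, t)" by (cases i)
  have arccos: "2 / pi * arccos (Re (qcis r)) = \<bar>r\<bar>" "2 / pi * arccos (Re (- qcis r)) = 2 - \<bar>r\<bar>"
    using assms by (intro arccos_Re_qcis arccos_Re_minus_qcis; simp)+
  have arcsin: "2 / pi * arcsin (Im (qcis r)) = r" "2 / pi * arcsin (Im (- qcis r)) = - r"
    using arcsin_Im_qcis[of r] arcsin_Im_minus[of "qcis r"] assms by auto
  show ?thesis
    using arccos arcsin assms
    by (cases "t = s") (auto simp: i weight_def unit_sign_def split: if_splits)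
qed

lemma weight_gap:
  assumes "x \<le> r" "r \<le> 2 - x" "0 \<le> x"
  shows "weight i (unit_sign s * qcis r) x = (if i = (False, s) then x else 0)"
proof -
  obtain k t where i: "i = (k, t)" by (cases i)
  have arccos: "2 / pi * arccos (Re (qcis r)) = r" "2 / pi * arccos (Re (- qcis r)) = 2 - r"
    using arccos_Re_qcis[of r] arccos_Re_minus_qcis[of r] assms by auto
  have arcsin: "x \<le> 2 / pi * arcsin (Im (qcis r))" "2 / pi * arcsin (Im (- qcis r)) \<le> - x"
    using arcsin_Im_qcis[of r] arcsin_Im_minus[of "qcis r"] assms by (auto split: if_splits)
  show ?thesis
    using arccos arcsin assms
    by (cases "t = s") (auto simp: i weight_def unit_sign_def split: if_splits)
qed

lemma arc_or_gap:
  assumes "norm q = 1" "0 \<le> x" "x \<le> 1"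
  obtains (arc) s r where "\<bar>r\<bar> < x" "q = unit_sign s * qcis r"
    | (gap) s r where "x \<le> r" "r \<le> 2 - x" "q = unit_sign s * qcis r"
proof -
  obtain r where r: "q = qcis r" "- 2 < r" "r \<le> 2" using unit_eq_qcis assms(1) by blast
  have antipode: "qcis r = unit_sign False * qcis (r - 2)" "qcis r = unit_sign False * qcis (r + 2)"
    by (simp_all add: qcis_diff qcis_add)
  consider "\<bar>r\<bar> < x" | "x \<le> r" "r \<le> 2 - x" | "\<bar>r - 2\<bar> < x" | "\<bar>r + 2\<bar> < x"
    | "x \<le> r + 2" "r + 2 \<le> 2 - x"
    using r assms by linarith
  then show thesis
    using arc[of r True] gap[of r True] arc[of "r - 2" False] arc[of "r + 2" False]
      gap[of "r + 2" False] r antipode by cases simp_all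
qed

lemma sum_bool_pair:
  "(\<Sum>i\<in>UNIV. f i) = f (True, s) + f (True, \<not> s) + f (False, s) + f (False, \<not> s)"
  for f :: "bool \<times> bool \<Rightarrow> 'a::comm_monoid_add"
  by (cases s)
    (simp_all add: UNIV_bool UNIV_Times_UNIV[symmetric] sum.cartesian_product[symmetric] ac_simps
      del: UNIV_Times_UNIV)

lemma weight_sum:
  assumes "norm q = 1" "0 \<le> x" "x \<le> 1"
  shows "(\<Sum>i\<in>UNIV. weight i q x) = x"
  using assms
proof (cases rule: arc_or_gap)
  case (arc s r)
  then show ?thesis using assms by (simp add: sum_bool_pair[of _ s] weight_arc)
next
  case (gap s r)
  then show ?thesis using assms by (simp add: weight_gap)
qed

lemma weight_nonneg: "0 \<le> x \<Longrightarrow> 0 \<le> weight i q x"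
  by (simp add: weight_def)

lemma weight_le:
  assumes "norm q = 1" "0 \<le> x" "x \<le> 1" shows "weight i q x \<le> x"
  using member_le_sum[of i UNIV "\<lambda>i. weight i q x"] weight_sum[OF assms] weight_nonneg[OF assms(2)]
  by simp

lemma continuous_on_weight: "continuous_on (sphere 0 1 \<times> UNIV) (\<lambda>(q, x). weight i q x)"
proof -
  have "- 1 \<le> Re (unit_sign (snd i) * q) \<and> Re (unit_sign (snd i) * q) \<le> 1"
    "- 1 \<le> Im (unit_sign (snd i) * q) \<and> Im (unit_sign (snd i) * q) \<le> 1" if "norm q = 1" for q
    using abs_Re_le_cmod[of "unit_sign (snd i) * q"] abs_Im_le_cmod[of "unit_sign (snd i) * q"] that
    unfolding norm_mult abs_le_iff by auto
  then show ?thesis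
    unfolding weight_def case_prod_unfold
    by (cases "fst i") (auto intro!: continuous_intros continuous_on_arccos' continuous_on_arcsin'
        simp del: times_complex.sel)
qed

lemma weight_arcE:
  assumes "norm q = 1" "0 \<le> x" "x \<le> 1" and pos: "weight (True, s) q x \<noteq> 0"
  obtains r where "\<bar>r\<bar> < x" "q = unit_sign s * qcis r"
  using assms(1-3)
proof (cases rule: arc_or_gap)
  case (arc t r)
  then have "t = s" using weight_arc[of r x "(True, s)" t] pos assms(3) by (auto split: if_splits)
  then show ?thesis using that arc by blast
next
  case (gap t r)
  then show ?thesis using weight_gap[of x r "(True, s)" t] pos assms(2) by auto
qed

lemma weight_arc_inj:
  assumes "norm q = 1" "norm q' = 1" and x: "0 \<le> x" "x \<le> 1" and pos: "weight (True, s) q x \<noteq> 0"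
    and eq: "\<And>i. weight i q' x = weight i q x"
  shows "q' = q"
proof -
  obtain r where r: "\<bar>r\<bar> < x" "q = unit_sign s * qcis r"
    using weight_arcE[OF assms(1) x pos] .
  obtain r' where r': "\<bar>r'\<bar> < x" "q' = unit_sign s * qcis r'"
    using weight_arcE[OF assms(2) x] pos eq[of "(True, s)"] by metis
  have "max 0 r' = max 0 r" "max 0 (- r') = max 0 (- r)"
    using eq[of "(False, s)"] eq[of "(False, \<not> s)"] r r' x by (simp_all add: weight_arc)
  then have "r' = r" by (auto simp: max_def split: if_splits)
  then show ?thesis using r r' by simp
qed

lemma weight_arc_exists:
  fixes y :: "bool \<times> bool \<Rightarrow> real"
  assumes q: "norm q = 1" "0 \<le> x" "x \<le> 1" and y: "\<And>i. 0 \<le> y i" "\<And>i. y i \<noteq> 0 \<Longrightarrow> weight i q x \<noteq> 0"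
    and pos: "y (True, s) \<noteq> 0" and total: "(\<Sum>i\<in>UNIV. y i) \<le> 1"
  obtains r where "\<bar>r\<bar> < (\<Sum>i\<in>UNIV. y i)" "\<And>i. weight i (unit_sign s * qcis r) (\<Sum>i\<in>UNIV. y i) = y i"
proof -
  obtain r\<^sub>0 where r\<^sub>0: "\<bar>r\<^sub>0\<bar> < x" "q = unit_sign s * qcis r\<^sub>0"
    using weight_arcE[OF q y(2)[OF pos]] .
  then have weights: "weight i q x = (if i = (True, s) then x - \<bar>r\<^sub>0\<bar> else if i = (False, s) then max 0 r\<^sub>0
     else if i = (False, \<not> s) then max 0 (- r\<^sub>0) else 0)" for i
    using weight_arc[of r\<^sub>0 x i s] q by simp
  have y_zero: "y i = 0" if "weight i q x = 0" for i using y(2) that by blast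
  have zero: "y (True, \<not> s) = 0" "y (False, s) = 0 \<or> y (False, \<not> s) = 0"
    using y_zero[of "(True, \<not> s)"] y_zero[of "(False, s)"] y_zero[of "(False, \<not> s)"]
    by (cases "0 \<le> r\<^sub>0"; simp add: weights)+
  define r where "r = y (False, s) - y (False, \<not> s)"
  have r: "max 0 r = y (False, s)" "max 0 (- r) = y (False, \<not> s)"
    using zero(2) y(1)[of "(False, s)"] y(1)[of "(False, \<not> s)"] by (auto simp: r_def)
  then have "\<bar>r\<bar> = y (False, s) + y (False, \<not> s)" by (auto simp: max_def split: if_splits)
  then have sum: "(\<Sum>i\<in>UNIV. y i) = y (True, s) + \<bar>r\<bar>"
    using zero(1) by (simp add: sum_bool_pair[of _ s])
  have "0 < y (True, s)" using pos y(1)[of "(True, s)"] by simp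
  show thesis
  proof
    show less: "\<bar>r\<bar> < (\<Sum>i\<in>UNIV. y i)" using sum \<open>0 < y (True, s)\<close> by simp
    show "weight i (unit_sign s * qcis r) (\<Sum>i\<in>UNIV. y i) = y i" for i
    proof -
      have "i \<in> {(True, s), (True, \<not> s), (False, s), (False, \<not> s)}" by (cases i) auto
      then show ?thesis using weight_arc[of r _ i s] less total r zero(1) sum by auto
    qed
  qed
qed

definition upper :: "complex \<Rightarrow> bool" where
  "upper q \<longleftrightarrow> 0 < Im q"

definition gap_offset :: "complex \<Rightarrow> real" where
  "gap_offset q = 2 / pi * arccos (Re (unit_sign (upper q) * q))"

lemma gap_offset_eq:
  assumes "0 < r" "r < 2"
  shows "upper (unit_sign s * qcis r) = s" "gap_offset (unit_sign s * qcis r) = r"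
    "Im (unit_sign s * qcis r) \<noteq> 0"
proof -
  have "0 < Im (qcis r)"
    using assms by (simp add: qcis_def sin_gt_zero)
  then show "upper (unit_sign s * qcis r) = s" "Im (unit_sign s * qcis r) \<noteq> 0"
    by (auto simp: upper_def unit_sign_def)
  then show "gap_offset (unit_sign s * qcis r) = r"
    using arccos_Re_qcis[of r] assms by (simp add: gap_offset_def)
qed

lemma gap_offset:
  assumes "norm q = 1" "Im q \<noteq> 0"
  shows "q = unit_sign (upper q) * qcis (gap_offset q)" "0 < gap_offset q" "gap_offset q < 2"
proof -
  obtain r where r: "q = qcis r" "- 2 < r" "r \<le> 2" using unit_eq_qcis assms(1) by blast
  have "r \<noteq> 0" "r \<noteq> 2" using assms(2) r(1) by auto
  then obtain s t where "0 < t" "t < 2" "q = unit_sign s * qcis t"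
    using r that[of r True] that[of "r + 2" False] by (cases "0 < r") (auto simp: qcis_add)
  then show "q = unit_sign (upper q) * qcis (gap_offset q)" "0 < gap_offset q" "gap_offset q < 2"
    using gap_offset_eq[of t s] by simp_all
qed

lemma weight_gap_pos:
  assumes "norm q = 1" "0 \<le> x" "weight (False, s) q x \<noteq> 0"
  shows "upper q = s" "Im q \<noteq> 0"
proof -
  have "0 < arcsin (Im (unit_sign s * q))"
  proof (rule ccontr)
    assume "\<not> ?thesis"
    then have "2 / pi * arcsin (Im (unit_sign s * q)) \<le> 0" by (simp only: mult_le_0_iff) simp
    then show False using assms(2,3) by (simp add: weight_def max_absorb1 del: times_complex.sel)
  qed
  moreover have "\<bar>Im (unit_sign s * q)\<bar> \<le> 1"
    using abs_Im_le_cmod[of "unit_sign s * q"] assms(1) by (simp add: norm_mult)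
  moreover have "0 < y" if "0 < arcsin y" "\<bar>y\<bar> \<le> 1" for y :: real
    using arcsin_le_arcsin[of y 0] that by (fastforce simp: abs_le_iff)
  ultimately have "0 < Im (unit_sign s * q)" by blast
  then show "upper q = s" "Im q \<noteq> 0"
    by (auto simp: upper_def unit_sign_def split: if_splits)
qed

lemma outside_arcs:
  assumes "norm q = 1" "0 < x" "x \<le> 1" "\<And>s. weight (True, s) q x = 0"
  shows "Im q \<noteq> 0" "x \<le> gap_offset q" "gap_offset q \<le> 2 - x"
proof -
  obtain s r where "x \<le> r" "r \<le> 2 - x" "q = unit_sign s * qcis r"
    using assms arc_or_gap[of q x] weight_arc[of _ x "(True, _)"]
    by (metis (no_types, lifting) abs_ge_zero diff_gt_0_iff_gt less_eq_real_def order_less_irrefl)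
  then show "Im q \<noteq> 0" "x \<le> gap_offset q" "gap_offset q \<le> 2 - x"
    using gap_offset_eq[of r s] assms(2) by simp_all
qed

section \<open>Cyclic orders on the simplices\<close>

locale cyclic_system = finite_complex V K for V :: "'v set" and K :: "'v set set" +
  fixes a :: "'v \<Rightarrow> 'v \<Rightarrow> int" and eps :: "'v \<Rightarrow> 'v \<Rightarrow> 'v \<Rightarrow> int"
  assumes a_alt: "alt1 K a"
    and a_unit: "{u, v} \<in> K \<Longrightarrow> u \<noteq> v \<Longrightarrow> a u v = 1 \<or> a u v = - 1"
    and eps_cocycle: "cocycle2 K eps"
    and eps_bound: "{u, v, w} \<in> K \<Longrightarrow> distinct [u, v, w] \<Longrightarrow> \<bar>eps u v w\<bar> \<le> 1"
    and eps_degenerate: "\<not> distinct [u, v, w] \<Longrightarrow> eps u v w = 0"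
begin

lemma a_swap: "{u, v} \<in> K \<Longrightarrow> u \<noteq> v \<Longrightarrow> a v u = - a u v"
  using a_alt by (simp add: alt1_def)

lemma eps_swap:
  assumes "{u, v, w} \<in> K"
  shows "eps v u w = - eps u v w" "eps u w v = - eps u v w"
  using assms eps_cocycle eps_degenerate[of u v w] eps_degenerate[of v u w] eps_degenerate[of u w v]
  by (cases "distinct [u, v, w]"; auto simp: cocycle2_def alt2_def)+

lemma eps_eq_cobd:
  assumes uvwz: "{u, v, w, z} \<in> K" and uvw_distinct: "distinct [u, v, w]"
  shows "eps v w z - eps u w z + eps u v z = eps u v w"
proof -
  have uvw: "{u, v, w} \<in> K" by (rule face[OF uvwz]) auto
  consider (eq_u) "z = u" | (eq_v) "z = v" | (eq_w) "z = w" | (distinct) "distinct [u, v, w, z]"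
    using uvw_distinct by auto
  then show ?thesis
  proof cases
    case eq_u
    have "eps v w u = - eps v u w" "eps v u w = - eps u v w"
      using eps_swap(1)[OF uvw] eps_swap(2)[of v u w] uvw by (simp_all add: insert_commute)
    then show ?thesis using eq_u by (simp add: eps_degenerate)
  next
    case eq_v
    then show ?thesis using eps_swap(2)[OF uvw] by (simp add: eps_degenerate)
  next
    case eq_w
    then show ?thesis by (simp add: eps_degenerate)
  next
    case distinct
    then have "cobd2 eps u v w z = 0" using uvwz eps_cocycle by (simp add: cocycle2_def)
    then show ?thesis by (simp add: cobd2_def)
  qed
qed

definition drift :: "'v \<Rightarrow> 'v \<Rightarrow> ('v \<Rightarrow> real) \<Rightarrow> real" where
  "drift u v x = (\<Sum>z\<in>V. of_int (eps u v z) * x z)"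

definition mark_diff :: "'v \<Rightarrow> 'v \<Rightarrow> ('v \<Rightarrow> real) \<Rightarrow> real" where
  "mark_diff u v x = of_int (a u v) + drift u v x"

lemma continuous_on_mark_diff: "continuous_on S (mark_diff u v)"
  unfolding mark_diff_def[abs_def] drift_def
  by (intro continuous_intros continuous_on_subset[OF continuous_on_product_coordinates]) auto

lemma sum_minus_edge:
  assumes "x \<in> geom K" "u \<in> supp x" "v \<in> supp x" "u \<noteq> v"
  shows "sum x (V - {u, v}) = 1 - x u - x v"
  using assms supp_subset[of x] finite_vertices geom_sum_vertices[of x]
    sum.subset_diff[of "{u, v}" V x]
  by (simp add: subset_iff)

lemma drift_eq_sum_minus_edge: "drift u v x = (\<Sum>z\<in>V - {u, v}. of_int (eps u v z) * x z)"
  unfolding drift_def using finite_vertices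
  by (intro sum.mono_neutral_right) (auto simp: eps_degenerate)

lemma drift_bound:
  assumes x: "x \<in> geom K" and u: "u \<in> supp x" and v: "v \<in> supp x" and ne: "u \<noteq> v"
  shows "\<bar>drift u v x\<bar> \<le> 1 - x u - x v"
proof -
  have "\<bar>of_int (eps u v z) * x z\<bar> \<le> x z" for z
  proof (cases "z \<in> supp x")
    case True
    then have "{u, v, z} \<in> K" using u v by (intro supp_face[OF x]) auto
    then have "\<bar>eps u v z\<bar> \<le> 1"
      using eps_bound eps_degenerate by (cases "distinct [u, v, z]") auto
    then have "\<bar>of_int (eps u v z) :: real\<bar> \<le> 1" by linarith
    then show ?thesis
      using geom_nonneg[OF x] by (simp add: abs_mult mult_left_le_one_le)
  qed (simp add: supp_def)
  then have "(\<Sum>z\<in>V - {u, v}. \<bar>of_int (eps u v z) * x z\<bar>) \<le> sum x (V - {u, v})"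
    by (rule sum_mono)
  then show ?thesis
    using sum_abs[of "\<lambda>z. of_int (eps u v z) * x z" "V - {u, v}"] sum_minus_edge[OF x u v ne]
    unfolding drift_eq_sum_minus_edge by linarith
qed

lemma drift_less_1:
  assumes x: "x \<in> geom K" and u: "u \<in> supp x" and v: "v \<in> supp x" and "u \<noteq> v"
  shows "\<bar>drift u v x\<bar> < 1"
  using drift_bound[OF assms] supp_pos[OF x u] supp_pos[OF x v] by linarith

lemma drift_maximal:
  assumes x: "x \<in> geom K" and uv: "u \<in> supp x" "v \<in> supp x" "u \<noteq> v"
    and eps_1: "\<And>z. z \<in> supp x \<Longrightarrow> z \<noteq> u \<Longrightarrow> z \<noteq> v \<Longrightarrow> eps u v z = 1"
  shows "drift u v x = 1 - x u - x v"
proof -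
  have "of_int (eps u v z) * x z = x z" if "z \<in> V - {u, v}" for z
    using that eps_1 by (cases "z \<in> supp x") (auto simp: supp_def)
  then have "drift u v x = sum x (V - {u, v})"
    unfolding drift_eq_sum_minus_edge by (rule sum.cong[OF refl])
  then show ?thesis by (simp add: sum_minus_edge[OF x uv])
qed

lemma drift_swap:
  assumes x: "x \<in> geom K" and u: "u \<in> supp x" and v: "v \<in> supp x"
  shows "drift v u x = - drift u v x"
proof -
  have "of_int (eps v u z) * x z = - (of_int (eps u v z) * x z)" for z
    using eps_swap(1)[OF supp_face[OF x, of "{u, v, z}"]] u v
    by (cases "z \<in> supp x") (auto simp: supp_def)
  then show ?thesis by (simp add: drift_def sum_negf)
qed

lemma drift_cobd:
  assumes x: "x \<in> geom K" and uvw: "u \<in> supp x" "v \<in> supp x" "w \<in> supp x" "distinct [u, v, w]"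
  shows "drift v w x - drift u w x + drift u v x = of_int (eps u v w)"
proof -
  have "of_int (eps v w z) * x z - of_int (eps u w z) * x z + of_int (eps u v z) * x z
      = of_int (eps u v w) * x z" for z
  proof (cases "z \<in> supp x")
    case True
    then have "{u, v, w, z} \<in> K" using uvw by (intro supp_face[OF x]) auto
    then have "of_int (eps v w z - eps u w z + eps u v z) * x z = of_int (eps u v w) * x z"
      using eps_eq_cobd uvw(4) by simp
    then show ?thesis by (simp add: algebra_simps)
  qed (simp add: supp_def)
  then have "drift v w x - drift u w x + drift u v x = (\<Sum>z\<in>V. of_int (eps u v w) * x z)"
    unfolding drift_def sum_subtractf[symmetric] sum.distrib[symmetric] by simp
  also have "\<dots> = of_int (eps u v w)"
    using geom_sum_vertices[OF x] by (simp flip: sum_distrib_left)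
  finally show ?thesis .
qed

lemma mark_diff_swap:
  assumes "x \<in> geom K" "u \<in> supp x" "v \<in> supp x" "u \<noteq> v"
  shows "mark_diff v u x = - mark_diff u v x"
  using a_swap[OF supp_face[of x "{u, v}"]] drift_swap[of x u v] assms by (simp add: mark_diff_def)

text \<open>A point of the fibre over \<open>x\<close> is described by its positions \<open>q v\<close> relative to all marks.\<close>

definition compatible :: "('v \<Rightarrow> real) \<Rightarrow> ('v \<Rightarrow> complex) \<Rightarrow> bool" where
  "compatible x q \<longleftrightarrow> (\<forall>v\<in>supp x. norm (q v) = 1) \<and>
     (\<forall>u\<in>supp x. \<forall>v\<in>supp x. u \<noteq> v \<longrightarrow> q v = q u * qcis (- mark_diff u v x))"

lemma compatible_norm: "compatible x q \<Longrightarrow> v \<in> supp x \<Longrightarrow> norm (q v) = 1"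
  and compatible_eq: "compatible x q \<Longrightarrow> u \<in> supp x \<Longrightarrow> v \<in> supp x \<Longrightarrow> u \<noteq> v \<Longrightarrow>
    q v = q u * qcis (- mark_diff u v x)"
  unfolding compatible_def by blast+

lemma compatible_scale:
  assumes "compatible x q" "norm z = 1" shows "compatible x (\<lambda>v. z * q v)"
  unfolding compatible_def
proof (intro conjI ballI impI)
  show "norm (z * q v) = 1" if "v \<in> supp x" for v
    using compatible_norm[OF assms(1) that] assms(2) by (simp add: norm_mult)
  show "z * q v = z * q u * qcis (- mark_diff u v x)" if "u \<in> supp x" "v \<in> supp x" "u \<noteq> v" for u v
    using compatible_eq[OF assms(1) that] by (simp only: mult.assoc)
qed

subsection \<open>Points in an arc\<close>

lemma arc_determines_weights:
  assumes x: "x \<in> geom K" and q: "compatible x q" and v: "v \<in> supp x" and w: "w \<in> supp x" "w \<noteq> v"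
    and r: "\<bar>r\<bar> < x v" "q v = unit_sign s * qcis r"
  shows "weight i (q w) (x w) = (if i = (False, s \<noteq> (a v w = 1)) then x w else 0)"
proof -
  define t where "t = (s \<noteq> (a v w = 1))"
  define \<rho> where "\<rho> = r - drift v w x + 1"
  have "q w = unit_sign s * qcis (\<rho> + - of_int (a v w) - 1)"
    using compatible_eq[OF q v w(1)] w(2) r(2)
    by (simp add: mark_diff_def \<rho>_def mult.assoc algebra_simps flip: qcis_add)
  moreover have "a v w = 1 \<or> a v w = - 1"
    using a_unit[OF supp_face[OF x, of "{v, w}"]] v w by auto
  ultimately have "q w = unit_sign t * qcis \<rho>"
    by (auto simp: t_def qcis_diff mult.left_commute)
  moreover have "x w \<le> \<rho>" "\<rho> \<le> 2 - x w"
    using drift_bound[OF x v w(1)] w(2) r(1) by (auto simp: \<rho>_def)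
  ultimately show ?thesis
    using weight_gap[of "x w" \<rho> i t] geom_nonneg[OF x] by (simp add: t_def)
qed

subsection \<open>Points in the gaps\<close>

definition side :: "('v \<Rightarrow> bool) \<Rightarrow> 'v \<Rightarrow> 'v \<Rightarrow> int" where
  "side s u v = (if s u = s v then a u v else - a u v)"

lemma side_unit: "{u, v} \<in> K \<Longrightarrow> u \<noteq> v \<Longrightarrow> side s u v = 1 \<or> side s u v = - 1"
  using a_unit[of u v] by (auto simp: side_def)

lemma side_swap: "{u, v} \<in> K \<Longrightarrow> u \<noteq> v \<Longrightarrow> side s v u = - side s u v"
  using a_swap[of u v] by (auto simp: side_def)

lemma unit_sign_side:
  assumes "{u, v} \<in> K" "u \<noteq> v"
  shows "unit_sign (s u) * qcis (of_int (side s u v)) = unit_sign (s v) * qcis (of_int (a u v))"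
  using a_unit[OF assms] by (auto simp: side_def unit_sign_def)

lemma gap_transport:
  assumes "{u, v} \<in> K" "u \<noteq> v" and R: "R u - R v = of_int (side s u v) + drift u v x"
  shows "unit_sign (s u) * qcis (R u) * qcis (- mark_diff u v x) = unit_sign (s v) * qcis (R v)"
proof -
  have "R u + - mark_diff u v x = R v + of_int (side s u v) - of_int (a u v)"
    using R by (simp add: mark_diff_def)
  then have "qcis (R u) * qcis (- mark_diff u v x) = qcis (R v) * qcis (of_int (side s u v)) / qcis (of_int (a u v))"
    by (simp only: qcis_diff qcis_add flip: qcis_add[of "R u"])
  then have "unit_sign (s u) * qcis (R u) * qcis (- mark_diff u v x)
      = (unit_sign (s u) * qcis (of_int (side s u v))) * qcis (R v) / qcis (of_int (a u v))"
    by (simp only: mult.assoc) (simp add: ac_simps)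
  also have "\<dots> = unit_sign (s v) * qcis (R v)"
    by (simp add: unit_sign_side[OF assms(1,2)])
  finally show ?thesis .
qed

lemma gap_difference:
  assumes x: "x \<in> geom K" and q: "compatible x q" and u: "u \<in> supp x" and v: "v \<in> supp x"
    and "u \<noteq> v"
    and Im: "Im (q u) \<noteq> 0" "Im (q v) \<noteq> 0"
  shows "gap_offset (q u) - gap_offset (q v) = of_int (side (\<lambda>v. upper (q v)) u v) + drift u v x"
proof -
  let ?s = "\<lambda>v. upper (q v)" and ?R = "\<lambda>v. gap_offset (q v)"
  have uv: "{u, v} \<in> K" using u v by (intro supp_face[OF x]) auto
  note off_u = gap_offset[OF compatible_norm[OF q u] Im(1)]
    and off_v = gap_offset[OF compatible_norm[OF q v] Im(2)]
  define R where "R = ?R(u := ?R v + of_int (side ?s u v) + drift u v x)"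
  have "q v = unit_sign (?s u) * qcis (?R u) * qcis (- mark_diff u v x)"
    using compatible_eq[OF q u v \<open>u \<noteq> v\<close>] off_u(1) by simp
  moreover have "q v = unit_sign (?s u) * qcis (R u) * qcis (- mark_diff u v x)"
    using gap_transport[OF uv \<open>u \<noteq> v\<close>, of R ?s x] off_v(1) \<open>u \<noteq> v\<close> by (simp add: R_def)
  ultimately have "qcis (?R u) = qcis (R u)" by simp
  then obtain n :: int where n: "?R u - R u = 4 * n" by (auto simp: qcis_eq_iff)
  have "\<bar>drift u v x\<bar> < 1" using drift_less_1[OF x u v \<open>u \<noteq> v\<close>] .
  moreover have "\<bar>real_of_int (side ?s u v)\<bar> = 1" using side_unit[OF uv \<open>u \<noteq> v\<close>, of ?s] by auto
  ultimately have "\<bar>?R u - R u\<bar> < 4"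
    unfolding R_def fun_upd_same using off_u(2,3) off_v(2,3) by linarith
  then have "n = 0" using n by linarith
  then show ?thesis using n by (simp add: R_def)
qed

lemma side_cobd:
  assumes x: "x \<in> geom K" and q: "compatible x q"
    and uvw: "u \<in> supp x" "v \<in> supp x" "w \<in> supp x" "distinct [u, v, w]"
    and Im: "Im (q u) \<noteq> 0" "Im (q v) \<noteq> 0" "Im (q w) \<noteq> 0"
  shows "cobd1 (side (\<lambda>v. upper (q v))) u v w = - eps u v w"
proof -
  note diff = gap_difference[OF x q]
  have "real_of_int (cobd1 (side (\<lambda>v. upper (q v))) u v w) = - of_int (eps u v w)"
    using diff[of v w] diff[of u w] diff[of u v] drift_cobd[OF x uvw] uvw Im
    by (simp add: cobd1_def)
  then show ?thesis by linarith
qed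

definition in_gaps :: "('v \<Rightarrow> real) \<Rightarrow> ('v \<Rightarrow> complex) \<Rightarrow> bool" where
  "in_gaps x q \<longleftrightarrow> (\<forall>v\<in>supp x. \<forall>s. weight (True, s) (q v) (x v) = 0)"

lemma in_gaps_offset:
  assumes x: "x \<in> geom K" and q: "compatible x q" and gaps: "in_gaps x q" and v: "v \<in> supp x"
  shows "Im (q v) \<noteq> 0" "x v \<le> gap_offset (q v)" "gap_offset (q v) \<le> 2 - x v"
    "q v = unit_sign (upper (q v)) * qcis (gap_offset (q v))"
    "weight i (q v) (x v) = (if i = (False, upper (q v)) then x v else 0)"
proof -
  show off: "Im (q v) \<noteq> 0" "x v \<le> gap_offset (q v)" "gap_offset (q v) \<le> 2 - x v"
    using outside_arcs[OF compatible_norm[OF q v] supp_pos[OF x v] geom_le_1[OF x]] gaps v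
    by (simp_all add: in_gaps_def)
  show eq: "q v = unit_sign (upper (q v)) * qcis (gap_offset (q v))"
    using gap_offset(1)[OF compatible_norm[OF q v] off(1)] .
  show "weight i (q v) (x v) = (if i = (False, upper (q v)) then x v else 0)"
    using weight_gap[OF off(2,3) geom_nonneg[OF x], of i "upper (q v)"] eq by simp
qed

lemma gap_difference_ordered:
  assumes x: "x \<in> geom K" and q: "compatible x q" and u: "u \<in> supp x" and v: "v \<in> supp x"
    and "u \<noteq> v"
    and Im: "Im (q u) \<noteq> 0" "Im (q v) \<noteq> 0" and ordered: "gap_offset (q v) \<le> gap_offset (q u)"
  shows "gap_offset (q u) - gap_offset (q v) = 1 + drift u v x"
proof -
  have "{u, v} \<in> K" using u v by (intro supp_face[OF x]) auto
  then have "side (\<lambda>v. upper (q v)) u v = 1 \<or> side (\<lambda>v. upper (q v)) u v = - 1"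
    by (rule side_unit[OF _ \<open>u \<noteq> v\<close>])
  then show ?thesis
    using gap_difference[OF x q u v \<open>u \<noteq> v\<close> Im] drift_less_1[OF x u v \<open>u \<noteq> v\<close>] ordered by auto
qed

lemma gap_offset_neq:
  assumes x: "x \<in> geom K" and q: "compatible x q" and u: "u \<in> supp x" and v: "v \<in> supp x"
    and "u \<noteq> v"
    and Im: "Im (q u) \<noteq> 0" "Im (q v) \<noteq> 0"
  shows "gap_offset (q u) \<noteq> gap_offset (q v)"
  using gap_difference_ordered[OF assms] drift_less_1[OF x u v \<open>u \<noteq> v\<close>] by force

text \<open>The arcs tile the fibre, so a point outside all of them sits where two arcs meet.\<close>

lemma in_gaps_extremes:
  assumes x: "x \<in> geom K" and q: "compatible x q" and gaps: "in_gaps x q"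
  obtains u v where "u \<in> supp x" "gap_offset (q u) = 2 - x u" "v \<in> supp x" "gap_offset (q v) = x v"
proof -
  let ?R = "\<lambda>v. gap_offset (q v)"
  note off = in_gaps_offset[OF x q gaps]
  note ordered = gap_difference_ordered[OF x q _ _ _ off(1) off(1)]
  obtain u where u: "u \<in> supp x" "Max (?R ` supp x) = ?R u"
    using obtains_MAX[OF finite_supp[OF x] supp_nonempty[OF x]] .
  obtain v where v: "v \<in> supp x" "Min (?R ` supp x) = ?R v"
    using obtains_MIN[OF finite_supp[OF x] supp_nonempty[OF x]] .
  have extreme: "?R w \<le> ?R u" "?R v \<le> ?R w" if "w \<in> supp x" for w
    unfolding u(2)[symmetric] v(2)[symmetric] using that finite_supp[OF x] by simp_all
  have "?R u = 2 - x u \<and> ?R v = x v"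
  proof (cases "u = v")
    case True
    have "w = u" if w: "w \<in> supp x" for w
      using gap_offset_neq[OF x q w u(1) _ off(1)[OF w] off(1)[OF u(1)]] extreme[OF w] True
      by fastforce
    then have "supp x = {u}" using u(1) by blast
    then have "x u = 1" using x by (simp add: geom_iff)
    then show ?thesis using off(2,3)[OF u(1)] True by simp
  next
    case False
    note R_uv = ordered[OF u(1) v(1) False u(1) v(1) extreme(1)[OF v(1)]]
    have "eps u v z = 1" if z: "z \<in> supp x" "z \<noteq> u" "z \<noteq> v" for z
    proof -
      have "of_int (eps u v z) = drift v z x - drift u z x + drift u v x"
        using drift_cobd[OF x u(1) v(1) z(1)] z False by simp
      also have "\<dots> = (1::real)"
        using ordered[OF z(1) v(1) z(3) z(1) v(1) extreme(2)[OF z(1)]] drift_swap[OF x v(1) z(1)]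
          ordered[OF u(1) z(1) z(2)[symmetric] u(1) z(1) extreme(1)[OF z(1)]] R_uv by linarith
      finally show ?thesis by linarith
    qed
    then have "drift u v x = 1 - x u - x v" by (rule drift_maximal[OF x u(1) v(1) False])
    then show ?thesis using R_uv off(2)[OF v(1)] off(3)[OF u(1)] by force
  qed
  then show thesis using that u(1) v(1) by blast
qed

lemma gap_potential_exists:
  assumes x: "x \<in> geom K"
    and cobd: "\<And>u v w. u \<in> supp x \<Longrightarrow> v \<in> supp x \<Longrightarrow> w \<in> supp x \<Longrightarrow> distinct [u, v, w] \<Longrightarrow>
      cobd1 (side s) u v w = - eps u v w"
  obtains N where
    "\<And>u v. u \<in> supp x \<Longrightarrow> v \<in> supp x \<Longrightarrow> u \<noteq> v \<Longrightarrow> N u - N v = of_int (side s u v) + drift u v x"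
proof -
  obtain b where b: "b \<in> supp x" using supp_nonempty[OF x] by blast
  define N where "N v = (if v = b then 0 else - (of_int (side s b v) + drift b v x))" for v
  show thesis
  proof (rule that[of N])
    fix u v assume uv: "u \<in> supp x" "v \<in> supp x" "u \<noteq> v"
    consider (left) "u = b" | (right) "v = b" | (distinct) "distinct [b, u, v]"
      using uv
      by fastforce
    then show "N u - N v = of_int (side s u v) + drift u v x"
    proof cases
      case left
      then show ?thesis using uv by (simp add: N_def)
    next
      case right
      have "{b, u} \<in> K" using b uv by (intro supp_face[OF x]) auto
      then show ?thesis
        using right uv side_swap[of b u s] drift_swap[OF x b uv(1)] by (simp add: N_def)
    next
      case distinct
      have "real_of_int (cobd1 (side s) b u v) = - of_int (eps b u v)"
        using cobd[OF b uv(1,2) distinct] by simp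
      then show ?thesis
        using drift_cobd[OF x b uv(1,2) distinct] distinct by (auto simp: N_def cobd1_def)
    qed
  qed
qed

lemma gap_positions_exist:
  assumes x: "x \<in> geom K"
    and cobd: "\<And>u v w. u \<in> supp x \<Longrightarrow> v \<in> supp x \<Longrightarrow> w \<in> supp x \<Longrightarrow> distinct [u, v, w] \<Longrightarrow>
      cobd1 (side s) u v w = - eps u v w"
  obtains R where "\<And>v. v \<in> supp x \<Longrightarrow> x v \<le> R v \<and> R v \<le> 2 - x v"
    and "\<And>u v. u \<in> supp x \<Longrightarrow> v \<in> supp x \<Longrightarrow> u \<noteq> v \<Longrightarrow> R u - R v = of_int (side s u v) + drift u v x"
proof -
  obtain N where N: "N u - N v = of_int (side s u v) + drift u v x"
    if "u \<in> supp x" "v \<in> supp x" "u \<noteq> v" for u v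
    using gap_potential_exists[OF x cobd] by blast
  let ?m = "MAX v\<in>supp x. x v - N v"
  obtain u where u: "u \<in> supp x" "?m = x u - N u"
    using obtains_MAX[OF finite_supp[OF x] supp_nonempty[OF x]] .
  show thesis
  proof
    fix v assume v: "v \<in> supp x"
    have "x v - N v \<le> ?m"
      using v finite_supp[OF x] by (intro Max_ge) auto
    moreover have "N v + ?m \<le> 2 - x v"
    proof (cases "v = u")
      case True
      then show ?thesis using u(2) geom_le_1[OF x, of u] by simp
    next
      case False
      moreover have "{v, u} \<in> K" using v u(1) by (intro supp_face[OF x]) auto
      ultimately show ?thesis
        using N[OF v u(1) False] side_unit[of v u s] drift_bound[OF x v u(1) False] u(2)
        by fastforce
    qed
    ultimately show "x v \<le> N v + ?m \<and> N v + ?m \<le> 2 - x v" by linarith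
  next
    show "N u + ?m - (N v + ?m) = of_int (side s u v) + drift u v x"
      if "u \<in> supp x" "v \<in> supp x" "u \<noteq> v" for u v
      using N[OF that] by simp
  qed
qed

subsection \<open>The weights parametrise the fibre\<close>

lemma compatible_rotation_trivial: "compatible x q \<Longrightarrow> v \<in> supp x \<Longrightarrow> z * q v = q v \<Longrightarrow> z = 1"
  using compatible_norm by fastforce

lemma fibre_injective_arc:
  assumes x: "x \<in> geom K" and q: "compatible x q" and z: "norm z = 1" and v: "v \<in> supp x"
    and arc: "weight (True, s) (q v) (x v) \<noteq> 0"
    and eq: "\<And>i. weight i (z * q v) (x v) = weight i (q v) (x v)"
  shows "z = 1"
proof -
  have "z * q v = q v"
    using compatible_norm[OF q v] z geom_nonneg[OF x] geom_le_1[OF x] arc eq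
    by (intro weight_arc_inj[of "q v" "z * q v" "x v" s]) (simp_all add: norm_mult)
  then show ?thesis by (rule compatible_rotation_trivial[OF q v])
qed

lemma fibre_injective_gaps:
  assumes x: "x \<in> geom K" and q: "compatible x q" and z: "norm z = 1" and gaps: "in_gaps x q"
    and eq: "\<And>v i. v \<in> supp x \<Longrightarrow> weight i (z * q v) (x v) = weight i (q v) (x v)"
  shows "z = 1"
proof -
  have zq: "compatible x (\<lambda>v. z * q v)" using compatible_scale[OF q z] .
  have zgaps: "in_gaps x (\<lambda>v. z * q v)" using eq gaps by (simp add: in_gaps_def)
  note off = in_gaps_offset[OF x q gaps] and zoff = in_gaps_offset[OF x zq zgaps]
  have upper: "upper (z * q v) = upper (q v)" if v: "v \<in> supp x" for v
    using eq[OF v, of "(False, upper (q v))"] off(5)[OF v] zoff(5)[OF v] supp_pos[OF x v]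
    by (auto split: if_splits)
  obtain u v where u: "u \<in> supp x" "gap_offset (q u) = 2 - x u"
    and v: "v \<in> supp x" "gap_offset (q v) = x v"
    using in_gaps_extremes[OF x q gaps] .
  have "gap_offset (z * q u) - gap_offset (z * q v) = gap_offset (q u) - gap_offset (q v)"
  proof (cases "u = v")
    case False
    have "side (\<lambda>v. upper (z * q v)) u v = side (\<lambda>v. upper (q v)) u v"
      using upper[OF u(1)] upper[OF v(1)] by (simp add: side_def)
    then show ?thesis
      using gap_difference[OF x q u(1) v(1) False] gap_difference[OF x zq u(1) v(1) False]
        off(1) zoff(1) u(1) v(1) by simp
  qed simp
  then have "gap_offset (z * q u) = gap_offset (q u)"
    using zoff(3)[OF u(1)] zoff(2)[OF v(1)] u(2) v(2) by linarith
  then have "z * q u = unit_sign (upper (q u)) * qcis (gap_offset (q u))"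
    using zoff(4)[OF u(1)] upper[OF u(1)] by simp
  also have "\<dots> = q u" using off(4)[OF u(1)] by (rule sym)
  finally show ?thesis by (rule compatible_rotation_trivial[OF q u(1)])
qed

lemma fibre_injective:
  assumes x: "x \<in> geom K" and q: "compatible x q" and z: "norm z = 1"
    and eq: "\<And>v i. v \<in> supp x \<Longrightarrow> weight i (z * q v) (x v) = weight i (q v) (x v)"
  shows "z = 1"
  using fibre_injective_arc[OF x q z _ _ eq] fibre_injective_gaps[OF x q z _ eq]
  unfolding in_gaps_def by blast

context
  fixes x\<^sub>0 x :: "'v \<Rightarrow> real" and q\<^sub>0 q :: "'v \<Rightarrow> complex" and y :: "'v \<Rightarrow> bool \<times> bool \<Rightarrow> real"
  assumes x\<^sub>0: "x\<^sub>0 \<in> geom K" "compatible x\<^sub>0 q\<^sub>0"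
    and x: "x \<in> geom K" "compatible x q" and sub: "supp x \<subseteq> supp x\<^sub>0"
    and nonneg: "\<And>v i. 0 \<le> y v i"
    and pattern: "\<And>v i. v \<in> supp x \<Longrightarrow> y v i \<noteq> 0 \<Longrightarrow> weight i (q\<^sub>0 v) (x\<^sub>0 v) \<noteq> 0"
    and total: "\<And>v. v \<in> supp x \<Longrightarrow> (\<Sum>i\<in>UNIV. y v i) = x v"
begin

lemma weights_eq_single:
  assumes v: "v \<in> supp x" and single: "\<And>i. i \<noteq> j \<Longrightarrow> y v i = 0"
  shows "y v i = (if i = j then x v else 0)"
proof -
  have "(\<Sum>i\<in>UNIV. y v i) = y v j"
    using sum.mono_neutral_right[of UNIV "{j}" "y v"] single by simp
  then show ?thesis using total[OF v] single by simp
qed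

lemma rotation_to:
  assumes "v \<in> supp x" "norm c = 1"
  obtains z where "norm z = 1" "z * q v = c"
  using compatible_norm[OF x(2) assms(1)] assms(2)
  by (intro that[of "c / q v"]) (auto simp: norm_divide)

lemma fibre_surjective_arc:
  assumes v: "v \<in> supp x" and pos: "y v (True, s) \<noteq> 0"
  obtains z where "norm z = 1" "\<And>v i. v \<in> supp x \<Longrightarrow> weight i (z * q v) (x v) = y v i"
proof -
  have v\<^sub>0: "v \<in> supp x\<^sub>0" using v sub by blast
  have bounds: "norm (q\<^sub>0 v) = 1" "0 \<le> x\<^sub>0 v" "x\<^sub>0 v \<le> 1"
    using compatible_norm[OF x\<^sub>0(2) v\<^sub>0] geom_nonneg[OF x\<^sub>0(1)] geom_le_1[OF x\<^sub>0(1)] .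
  obtain r\<^sub>0 where r\<^sub>0: "\<bar>r\<^sub>0\<bar> < x\<^sub>0 v" "q\<^sub>0 v = unit_sign s * qcis r\<^sub>0"
    using weight_arcE[OF bounds pattern[OF v pos]] .
  obtain r where r: "\<bar>r\<bar> < x v" "\<And>i. weight i (unit_sign s * qcis r) (x v) = y v i"
    using weight_arc_exists[of "q\<^sub>0 v" "x\<^sub>0 v" "y v", OF bounds nonneg pattern[OF v] pos] total[OF v]
      geom_le_1[OF x(1)]
    by auto
  obtain z where z: "norm z = 1" "z * q v = unit_sign s * qcis r"
    using rotation_to[OF v] by (metis norm_mult norm_qcis unit_sign_simps(4) mult_1)
  show thesis
  proof (rule that[OF z(1)])
    fix w i assume w: "w \<in> supp x"
    show "weight i (z * q w) (x w) = y w i"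
    proof (cases "w = v")
      case True
      then show ?thesis using r(2) z(2) by simp
    next
      case False
      have "y w i = (if i = (False, s \<noteq> (a v w = 1)) then x w else 0)"
        using arc_determines_weights[OF x\<^sub>0 v\<^sub>0 subsetD[OF sub w] False r\<^sub>0] pattern[OF w]
        by (intro weights_eq_single[OF w]) metis
      then show ?thesis
        using arc_determines_weights[OF x(1) compatible_scale[OF x(2) z(1)] v w False r(1) z(2)]
        by simp
    qed
  qed
qed

lemma no_arc_pattern:
  assumes v: "v \<in> supp x" and no_arc: "\<And>s. y v (True, s) = 0"
  shows "y v i = (if i = (False, upper (q\<^sub>0 v)) then x v else 0)" "Im (q\<^sub>0 v) \<noteq> 0"
proof -
  have gap: "upper (q\<^sub>0 v) = s" "Im (q\<^sub>0 v) \<noteq> 0" if "y v (False, s) \<noteq> 0" for s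
    using weight_gap_pos[OF compatible_norm[OF x\<^sub>0(2) subsetD[OF sub v]] geom_nonneg[OF x\<^sub>0(1)]
        pattern[OF v that]]
    by simp_all
  show y_eq: "y v i = (if i = (False, upper (q\<^sub>0 v)) then x v else 0)" for i
  proof (rule weights_eq_single[OF v])
    fix i assume "i \<noteq> (False, upper (q\<^sub>0 v))"
    moreover obtain k t where "i = (k, t)" by (cases i)
    ultimately show "y v i = 0" using no_arc[of t] gap(1)[of t] by (cases k) auto
  qed
  show "Im (q\<^sub>0 v) \<noteq> 0"
    using gap(2)[of "upper (q\<^sub>0 v)"] y_eq[of "(False, upper (q\<^sub>0 v))"] supp_pos[OF x(1) v] by simp
qed

lemma fibre_surjective_gaps:
  assumes no_arc: "\<And>v s. v \<in> supp x \<Longrightarrow> y v (True, s) = 0"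
  obtains z where "norm z = 1" "\<And>v i. v \<in> supp x \<Longrightarrow> weight i (z * q v) (x v) = y v i"
proof -
  let ?s = "\<lambda>v. upper (q\<^sub>0 v)"
  note pattern_gap = no_arc_pattern[OF _ no_arc]
  obtain R where R: "\<And>v. v \<in> supp x \<Longrightarrow> x v \<le> R v \<and> R v \<le> 2 - x v"
    and diff: "\<And>u v. u \<in> supp x \<Longrightarrow> v \<in> supp x \<Longrightarrow> u \<noteq> v \<Longrightarrow> R u - R v = of_int (side ?s u v) + drift u v x"
  proof (rule gap_positions_exist[OF x(1)])
    show "cobd1 (side ?s) u v w = - eps u v w"
      if "u \<in> supp x" "v \<in> supp x" "w \<in> supp x" "distinct [u, v, w]" for u v w
      using side_cobd[OF x\<^sub>0] that sub pattern_gap(2) by blast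
  qed (rule that)
  obtain u where u: "u \<in> supp x" using supp_nonempty[OF x(1)] by blast
  obtain z where z: "norm z = 1" "z * q u = unit_sign (?s u) * qcis (R u)"
    using rotation_to[OF u] by (metis norm_mult norm_qcis unit_sign_simps(4) mult_1)
  have zq: "z * q v = unit_sign (?s v) * qcis (R v)" if v: "v \<in> supp x" for v
  proof (cases "u = v")
    case False
    have "{u, v} \<in> K" using u v by (intro supp_face[OF x(1)]) auto
    then show ?thesis
      using gap_transport[of u v R ?s x] compatible_eq[OF compatible_scale[OF x(2) z(1)] u v False]
        diff[OF u v False] False z(2) by simp
  qed (use z(2) in simp)
  show thesis
  proof (rule that[OF z(1)])
    show "weight i (z * q v) (x v) = y v i" if v: "v \<in> supp x" for v i
      using weight_gap[of "x v" "R v" i "?s v"] R[OF v] geom_nonneg[OF x(1)] zq[OF v]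
        pattern_gap(1)[OF v v, of i]
      by simp
  qed
qed

lemma fibre_surjective:
  obtains z where "norm z = 1" "\<And>v i. v \<in> supp x \<Longrightarrow> weight i (z * q v) (x v) = y v i"
  using fibre_surjective_arc fibre_surjective_gaps by blast

end

end

section \<open>Circle bundles over a finite complex\<close>

lemma continuous_map_mult:
  fixes f g :: "'a \<Rightarrow> 'b::real_normed_algebra"
  shows "continuous_map X euclidean f \<Longrightarrow> continuous_map X euclidean g \<Longrightarrow>
    continuous_map X euclidean (\<lambda>x. f x * g x)"
  by (simp add: continuous_map_atin tendsto_mult)

lemma continuous_map_compose_continuous_on:
  assumes "continuous_map X euclidean f" "continuous_on S g" "\<And>x. x \<in> topspace X \<Longrightarrow> f x \<in> S"
  shows "continuous_map X euclidean (\<lambda>x. g (f x))"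
proof -
  have "continuous_map X (top_of_set S) f"
    using assms(1,3) by (intro continuous_map_into_subtopology) auto
  from continuous_map_compose[OF this, of euclidean g] show ?thesis
    using assms(2) by (simp add: o_def)
qed

locale bundle_over_complex = finite_complex V K for V :: "'v set" and K :: "'v set set" +
  fixes E :: "'e topology" and p :: "'e \<Rightarrow> 'v \<Rightarrow> real" and act :: "complex \<Rightarrow> 'e \<Rightarrow> 'e"
  assumes circle_bundle: "circle_bundle E p act (geom K)"
begin

definition over :: "('v \<Rightarrow> real) set \<Rightarrow> 'e set" where
  "over S = {\<xi> \<in> topspace E. p \<xi> \<in> S}"

lemma over_iff: "\<xi> \<in> over S \<longleftrightarrow> \<xi> \<in> topspace E \<and> p \<xi> \<in> S"
  by (simp add: over_def)

lemma over_mono: "S \<subseteq> T \<Longrightarrow> over S \<subseteq> over T"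
  by (auto simp: over_def)

lemma topspace_Int_over [simp]: "topspace E \<inter> over S = over S"
  by (auto simp: over_def)

lemma p_continuous: "continuous_map E (top_of_set (geom K)) p"
  and p_image: "p ` topspace E = geom K"
  using circle_bundle by (auto simp: circle_bundle_def)

lemma p_in_geom: "\<xi> \<in> topspace E \<Longrightarrow> p \<xi> \<in> geom K"
  using p_image by blast

lemma over_geom: "over (geom K) = topspace E"
  using p_in_geom by (auto simp: over_def)

lemma p_continuous_euclidean: "continuous_map E euclidean p"
  using p_continuous continuous_map_in_subtopology by blast

lemma p_continuous_over: "continuous_map (subtopology E (over S)) (top_of_set S) p"
  using p_continuous_euclidean
  by (auto simp: continuous_map_in_subtopology continuous_map_from_subtopology over_def)

lemma p_coordinate_continuous: "continuous_map E euclideanreal (\<lambda>\<xi>. p \<xi> v)"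
  using p_continuous_euclidean
  by (rule continuous_map_compose_continuous_on) (auto intro: continuous_on_product_coordinates)

lemma act_in_total: "\<xi> \<in> topspace E \<Longrightarrow> norm z = 1 \<Longrightarrow> act z \<xi> \<in> topspace E"
  and p_act: "\<xi> \<in> topspace E \<Longrightarrow> norm z = 1 \<Longrightarrow> p (act z \<xi>) = p \<xi>"
  and act_1: "\<xi> \<in> topspace E \<Longrightarrow> act 1 \<xi> = \<xi>"
  using circle_bundle by (auto simp: circle_bundle_def)

lemma act_over: "\<xi> \<in> over S \<Longrightarrow> norm z = 1 \<Longrightarrow> act z \<xi> \<in> over S"
  by (simp add: over_iff act_in_total p_act)

definition point_over :: "('v \<Rightarrow> real) \<Rightarrow> 'e" where
  "point_over x = (SOME \<xi>. \<xi> \<in> topspace E \<and> p \<xi> = x)"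

lemma point_over:
  assumes "x \<in> geom K" shows "point_over x \<in> topspace E" "p (point_over x) = x"
proof -
  have "\<exists>\<xi>. \<xi> \<in> topspace E \<and> p \<xi> = x" using p_image assms by (metis imageE)
  from someI_ex[OF this] show "point_over x \<in> topspace E" "p (point_over x) = x"
    by (simp_all add: point_over_def)
qed

lemma point_over_in: "x \<in> S \<Longrightarrow> S \<subseteq> geom K \<Longrightarrow> point_over x \<in> over S"
  using point_over by (auto simp: over_iff)

lemma p_image_over:
  assumes "S \<subseteq> geom K" shows "p ` over S = S"
proof
  show "S \<subseteq> p ` over S"
  proof
    fix x assume "x \<in> S"
    then have "point_over x \<in> over S" "x = p (point_over x)"
      using point_over_in point_over(2) assms by auto
    then show "x \<in> p ` over S" by (rule image_eqI[rotated])
  qed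
qed (auto simp: over_def)

lemma local_trivD:
  assumes "local_triv E p act U \<phi>" "\<xi> \<in> over U"
  shows "fst (\<phi> \<xi>) = p \<xi>" "norm z = 1 \<Longrightarrow> \<phi> (act z \<xi>) = (p \<xi>, z * snd (\<phi> \<xi>))"
  using assms by (auto simp: local_triv_def over_def)

lemma local_triv_homeomorphic:
  assumes "local_triv E p act U \<phi>"
  shows "homeomorphic_map (subtopology E (over U)) (prod_topology (top_of_set U) (top_of_set (sphere 0 1))) \<phi>"
  using assms by (simp add: local_triv_def over_def)

lemma local_triv_image:
  assumes \<phi>: "local_triv E p act U \<phi>" and "D \<subseteq> U" shows "\<phi> ` over D = D \<times> sphere 0 1"
proof -
  have image: "\<phi> ` over U = U \<times> sphere 0 1"
    using homeomorphic_imp_surjective_map[OF local_triv_homeomorphic[OF \<phi>]] by simp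
  have fst: "fst (\<phi> \<xi>) = p \<xi>" if "\<xi> \<in> over U" for \<xi>
    using local_trivD(1)[OF \<phi> that] .
  have "over D = {\<xi> \<in> over U. fst (\<phi> \<xi>) \<in> D}"
    using \<open>D \<subseteq> U\<close> fst by (auto simp: over_def)
  then have "\<phi> ` over D = {t \<in> \<phi> ` over U. fst t \<in> D}" by blast
  then show ?thesis using image \<open>D \<subseteq> U\<close> by auto
qed

lemma local_triv_norm: "local_triv E p act U \<phi> \<Longrightarrow> \<xi> \<in> over U \<Longrightarrow> norm (snd (\<phi> \<xi>)) = 1"
  using local_triv_image[of U \<phi> U]
  by (metis image_eqI mem_Sigma_iff mem_sphere_0 order_refl prod.collapse)

lemma fibre_transitive:
  assumes "\<xi> \<in> topspace E" "\<eta> \<in> topspace E" "p \<xi> = p \<eta>"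
  obtains z where "norm z = 1" "\<eta> = act z \<xi>"
proof -
  obtain U \<phi> where U: "p \<xi> \<in> U" "local_triv E p act U \<phi>"
    using circle_bundle p_in_geom[OF assms(1)] unfolding circle_bundle_def by blast
  have over: "\<xi> \<in> over U" "\<eta> \<in> over U" using assms U(1) by (auto simp: over_iff)
  define z where "z = snd (\<phi> \<eta>) / snd (\<phi> \<xi>)"
  have "norm (snd (\<phi> \<xi>)) = 1" "norm (snd (\<phi> \<eta>)) = 1" using local_triv_norm[OF U(2)] over by auto
  then have z: "norm z = 1" "z * snd (\<phi> \<xi>) = snd (\<phi> \<eta>)"
    by (auto simp: z_def norm_divide)
  have "\<phi> (act z \<xi>) = \<phi> \<eta>"
    using local_trivD(2)[OF U(2) over(1) z(1)] local_trivD(1)[OF U(2) over(2)] assms(3) z(2)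
    by (simp add: prod_eq_iff)
  moreover have "inj_on \<phi> (over U)"
    using homeomorphic_imp_injective_map[OF local_triv_homeomorphic[OF U(2)]] by simp
  ultimately have "act z \<xi> = \<eta>"
    using act_over[OF over(1) z(1)] over(2) by (simp add: inj_on_def)
  then show thesis using that z(1) by blast
qed

lemma finite_atlas:
  obtains I :: "('v \<Rightarrow> real) set" and U \<phi> and \<rho> :: "('v \<Rightarrow> real) \<Rightarrow> ('v \<Rightarrow> real) \<Rightarrow> real"
  where "finite I" "\<And>i. i \<in> I \<Longrightarrow> local_triv E p act (U i) (\<phi> i)"
    "\<And>i. i \<in> I \<Longrightarrow> continuous_on (geom K) (\<rho> i)"
    "\<And>i x. i \<in> I \<Longrightarrow> x \<in> geom K \<Longrightarrow> \<rho> i x \<noteq> 0 \<Longrightarrow> x \<in> U i"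
    "\<And>x. x \<in> geom K \<Longrightarrow> \<exists>i\<in>I. 1 / 2 < \<rho> i x"
proof -
  let ?X = "top_of_set (geom K)" and ?chart = "\<lambda>U. \<exists>\<phi>. local_triv E p act U \<phi>"
  have compact: "compact_space ?X" using compact_geom by (simp add: compact_space_subtopology)
  have chart: "\<exists>U. openin ?X U \<and> x \<in> U \<and> ?chart U" if "x \<in> topspace ?X" for x
    using circle_bundle that unfolding circle_bundle_def by simp
  obtain I :: "('v \<Rightarrow> real) set" and U \<rho> where I: "finite I"
    and U: "\<And>i. i \<in> I \<Longrightarrow> openin ?X (U i) \<and> ?chart (U i)"
    and \<rho>: "\<And>i. i \<in> I \<Longrightarrow> continuous_map ?X euclideanreal (\<rho> i)"
      "\<And>i x. i \<in> I \<Longrightarrow> x \<in> topspace ?X - U i \<Longrightarrow> \<rho> i x = 0"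
      "\<And>x. x \<in> topspace ?X \<Longrightarrow> \<exists>i\<in>I. 1 / 2 < \<rho> i x"
    by (rule compact_Hausdorff_bumps[OF compact Hausdorff_space_top_of_set_fun chart], assumption,
        rule that)
  obtain \<phi> where "\<And>i. i \<in> I \<Longrightarrow> local_triv E p act (U i) (\<phi> i)" using U by metis
  with I show thesis
  proof (rule that)
    show "continuous_on (geom K) (\<rho> i)" if "i \<in> I" for i using \<rho>(1)[OF that] by simp
    show "x \<in> U i" if "i \<in> I" "x \<in> geom K" "\<rho> i x \<noteq> 0" for i x using \<rho>(2)[of i x] that by auto
    show "\<exists>i\<in>I. 1 / 2 < \<rho> i x" if "x \<in> geom K" for x using \<rho>(3) that by simp
  qed
qed

lemma compactin_over_chart:
  assumes "local_triv E p act U \<phi>" "compact D" "D \<subseteq> U" shows "compactin E (over D)"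
proof -
  have "compactin (prod_topology (top_of_set U) (top_of_set (sphere 0 1))) (\<phi> ` over D)"
    unfolding local_triv_image[OF assms(1,3)]
    using assms(2,3) by (auto simp: compactin_subtopology intro!: compact_Times)
  then have "compactin (subtopology E (over U)) (over D)"
    using homeomorphic_map_compactness[OF local_triv_homeomorphic[OF assms(1)], of "over D"]
      over_mono[OF assms(3)]
    by simp
  then show ?thesis by (simp add: compactin_subtopology)
qed

lemma compact_total: "compact_space E"
proof -
  obtain I :: "('v \<Rightarrow> real) set" and U \<phi> and \<rho> :: "('v \<Rightarrow> real) \<Rightarrow> ('v \<Rightarrow> real) \<Rightarrow> real"
    where I: "finite I" and charts: "\<And>i. i \<in> I \<Longrightarrow> local_triv E p act (U i) (\<phi> i)"
      and \<rho>: "\<And>i. i \<in> I \<Longrightarrow> continuous_on (geom K) (\<rho> i)"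
        "\<And>i x. i \<in> I \<Longrightarrow> x \<in> geom K \<Longrightarrow> \<rho> i x \<noteq> 0 \<Longrightarrow> x \<in> U i"
      and cover: "\<And>x. x \<in> geom K \<Longrightarrow> \<exists>i\<in>I. 1 / 2 < \<rho> i x"
    by (rule finite_atlas, rule that)
  define D where "D i = {x \<in> geom K. 1 / 2 \<le> \<rho> i x}" for i
  have "compactin E (over (D i))" if i: "i \<in> I" for i
  proof (rule compactin_over_chart[OF charts[OF i]])
    have "closedin (top_of_set (geom K)) (D i)"
      using continuous_closedin_preimage[OF \<rho>(1)[OF i], of "{1/2..}"]
      by (simp add: D_def vimage_def Int_def)
    then show "compact (D i)" using compact_geom closedin_compact by blast
    show "D i \<subseteq> U i" using \<rho>(2)[OF i] by (force simp: D_def)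
  qed
  then have "compactin E (\<Union>i\<in>I. over (D i))"
    using I by (intro compactin_Union) auto
  moreover have "(\<Union>i\<in>I. over (D i)) = topspace E"
    using cover p_in_geom by (fastforce simp: over_def D_def)
  ultimately show ?thesis by (simp add: compact_space_def)
qed

lemma compact_over:
  assumes "compact S" "S \<subseteq> geom K" shows "compact_space (subtopology E (over S))"
proof -
  have "closedin (top_of_set (geom K)) S"
    by (rule compactin_imp_closedin[OF Hausdorff_space_top_of_set_fun])
      (use assms in \<open>auto simp: compactin_subtopology\<close>)
  from closedin_continuous_map_preimage[OF p_continuous this] have "closedin E (over S)"
    by (simp add: over_def)
  then show ?thesis
    using compact_total closedin_compact_space compact_space_subtopology by blast
qed

lemma invariant_point_over:
  assumes inv: "\<And>\<xi> z. \<xi> \<in> over S \<Longrightarrow> norm z = 1 \<Longrightarrow> F (act z \<xi>) = F \<xi>" and \<xi>: "\<xi> \<in> over S"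
  shows "F (point_over (p \<xi>)) = F \<xi>"
proof -
  have "\<xi> \<in> topspace E" using \<xi> by (simp add: over_iff)
  then obtain z where "norm z = 1" "point_over (p \<xi>) = act z \<xi>"
    using fibre_transitive[of \<xi> "point_over (p \<xi>)"] point_over[OF p_in_geom] by metis
  then show ?thesis using inv[OF \<xi>] by simp
qed

lemma continuous_on_descent:
  assumes S: "compact S" "S \<subseteq> geom K"
    and F: "continuous_map (subtopology E (over S)) euclidean F"
    and inv: "\<And>\<xi> z. \<xi> \<in> over S \<Longrightarrow> norm z = 1 \<Longrightarrow> F (act z \<xi>) = F \<xi>"
  shows "continuous_on S (\<lambda>x. F (point_over x))"
proof -
  have "quotient_map (subtopology E (over S)) (top_of_set S) p"
    by (rule continuous_imp_quotient_map[OF p_continuous_over compact_over[OF S] Hausdorff_space_top_of_set_fun])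
      (use p_image_over[OF S(2)] in simp)
  moreover have "continuous_map (subtopology E (over S)) euclidean ((\<lambda>x. F (point_over x)) \<circ> p)"
    by (rule continuous_map_eq[OF F]) (use invariant_point_over[of S F] inv in simp)
  ultimately have "continuous_map (top_of_set S) euclidean (\<lambda>x. F (point_over x))"
    by (rule continuous_compose_quotient_map)
  then show ?thesis by simp
qed

subsection \<open>Equivariant functions and trivialisations\<close>

definition equivariant_on :: "('v \<Rightarrow> real) set \<Rightarrow> ('e \<Rightarrow> complex) \<Rightarrow> bool" where
  "equivariant_on S \<theta> \<longleftrightarrow> continuous_map (subtopology E (over S)) euclidean \<theta> \<and>
     (\<forall>\<xi>\<in>over S. \<forall>z. norm z = 1 \<longrightarrow> \<theta> (act z \<xi>) = z * \<theta> \<xi>)"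

definition trivialisation_on :: "('v \<Rightarrow> real) set \<Rightarrow> ('e \<Rightarrow> complex) \<Rightarrow> bool" where
  "trivialisation_on S \<theta> \<longleftrightarrow> equivariant_on S \<theta> \<and> (\<forall>\<xi>\<in>over S. norm (\<theta> \<xi>) = 1)"

lemma equivariant_continuous: "equivariant_on S \<theta> \<Longrightarrow> continuous_map (subtopology E (over S)) euclidean \<theta>"
  and equivariant_act: "equivariant_on S \<theta> \<Longrightarrow> \<xi> \<in> over S \<Longrightarrow> norm z = 1 \<Longrightarrow> \<theta> (act z \<xi>) = z * \<theta> \<xi>"
  and trivialisation_equivariant: "trivialisation_on S \<theta> \<Longrightarrow> equivariant_on S \<theta>"
  and trivialisation_norm: "trivialisation_on S \<theta> \<Longrightarrow> \<xi> \<in> over S \<Longrightarrow> norm (\<theta> \<xi>) = 1"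
  by (auto simp: equivariant_on_def trivialisation_on_def)

lemma trivialisation_subset: "trivialisation_on S \<theta> \<Longrightarrow> T \<subseteq> S \<Longrightarrow> trivialisation_on T \<theta>"
  unfolding trivialisation_on_def equivariant_on_def
  using over_mono[of T S] by (auto intro: continuous_map_from_subtopology_mono)

lemma trivialisation_scale:
  assumes "trivialisation_on S \<theta>" "norm c = 1" shows "trivialisation_on S (\<lambda>\<xi>. c * \<theta> \<xi>)"
  using assms unfolding trivialisation_on_def equivariant_on_def
  by (simp add: continuous_map_mult norm_mult)

lemma trivialisation_sgn:
  assumes "equivariant_on S \<theta>" "\<And>\<xi>. \<xi> \<in> over S \<Longrightarrow> \<theta> \<xi> \<noteq> 0"
  shows "trivialisation_on S (\<lambda>\<xi>. sgn (\<theta> \<xi>))"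
proof -
  have "continuous_map (subtopology E (over S)) euclidean (\<lambda>\<xi>. sgn (\<theta> \<xi>))"
    by (rule continuous_map_compose_continuous_on[OF equivariant_continuous[OF assms(1)], of "- {0}"])
      (use assms(2) in \<open>auto intro!: continuous_intros\<close>)
  then show ?thesis
    using assms equivariant_act[OF assms(1)]
    by (simp add: trivialisation_on_def equivariant_on_def norm_sgn sgn_mult)
      (simp add: sgn_div_norm)
qed

lemma trivialisation_inj:
  assumes \<theta>: "trivialisation_on S \<theta>" and \<xi>: "\<xi> \<in> over S" and \<eta>: "\<eta> \<in> over S"
    and "p \<xi> = p \<eta>" "\<theta> \<xi> = \<theta> \<eta>"
  shows "\<xi> = \<eta>"
proof -
  have "\<xi> \<in> topspace E" "\<eta> \<in> topspace E" using \<xi> \<eta> by (auto simp: over_iff)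
  then obtain z where z: "norm z = 1" "\<eta> = act z \<xi>"
    using fibre_transitive \<open>p \<xi> = p \<eta>\<close> by blast
  have "z * \<theta> \<xi> = \<theta> \<xi>"
    using equivariant_act[OF trivialisation_equivariant[OF \<theta>] \<xi> z(1)] z(2) assms(5) by simp
  moreover have "\<theta> \<xi> \<noteq> 0" using trivialisation_norm[OF \<theta> \<xi>] by auto
  ultimately have "z = 1" by simp
  then show ?thesis using z(2) act_1 \<open>\<xi> \<in> topspace E\<close> by simp
qed

lemma trivialisation_surj:
  assumes \<theta>: "trivialisation_on S \<theta>" and "x \<in> S" "S \<subseteq> geom K" "norm w = 1"
  obtains \<xi> where "\<xi> \<in> over S" "p \<xi> = x" "\<theta> \<xi> = w"
proof -
  let ?\<xi> = "point_over x"
  have \<xi>: "?\<xi> \<in> over S" using point_over_in assms(2,3) by blast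
  have z: "norm (w / \<theta> ?\<xi>) = 1" "w / \<theta> ?\<xi> * \<theta> ?\<xi> = w"
    using trivialisation_norm[OF \<theta> \<xi>] assms(4) by (auto simp: norm_divide)
  show thesis
  proof (rule that[of "act (w / \<theta> ?\<xi>) ?\<xi>"])
    show "p (act (w / \<theta> ?\<xi>) ?\<xi>) = x"
      using p_act[of ?\<xi>] point_over[of x] assms(2,3) z(1) by (simp add: subset_iff)
    show "\<theta> (act (w / \<theta> ?\<xi>) ?\<xi>) = w"
      using equivariant_act[OF trivialisation_equivariant[OF \<theta>] \<xi> z(1)] z(2) by simp
  qed (rule act_over[OF \<xi> z(1)])
qed

lemma trivialisation_local_triv:
  assumes \<theta>: "trivialisation_on S \<theta>" and S: "compact S" "S \<subseteq> geom K"
  shows "local_triv E p act S (\<lambda>\<xi>. (p \<xi>, \<theta> \<xi>))"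
proof -
  let ?P = "prod_topology (top_of_set S) (top_of_set (sphere (0::complex) 1))"
  have cont: "continuous_map (subtopology E (over S)) ?P (\<lambda>\<xi>. (p \<xi>, \<theta> \<xi>))"
    by (intro continuous_map_pairedI p_continuous_over)
      (use equivariant_continuous[OF trivialisation_equivariant[OF \<theta>]] trivialisation_norm[OF \<theta>]
        in \<open>auto simp: continuous_map_in_subtopology\<close>)
  have "homeomorphic_map (subtopology E (over S)) ?P (\<lambda>\<xi>. (p \<xi>, \<theta> \<xi>))"
  proof (rule continuous_imp_homeomorphic_map[OF cont compact_over[OF S]])
    show "Hausdorff_space ?P"
      by (auto simp: Hausdorff_space_prod_topology Hausdorff_space_top_of_set_fun
          Hausdorff_space_subtopology
          simp del: prod_topology_subtopology_eu)
    have "S \<times> sphere 0 1 \<subseteq> (\<lambda>\<xi>. (p \<xi>, \<theta> \<xi>)) ` over S"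
    proof
      fix t :: "('v \<Rightarrow> real) \<times> complex" assume t: "t \<in> S \<times> sphere 0 1"
      then have "fst t \<in> S" "norm (snd t) = 1" by auto
      from trivialisation_surj[OF \<theta> this(1) S(2) this(2)]
      obtain \<xi> where "\<xi> \<in> over S" "p \<xi> = fst t" "\<theta> \<xi> = snd t" .
      then show "t \<in> (\<lambda>\<xi>. (p \<xi>, \<theta> \<xi>)) ` over S" by (intro image_eqI[of _ _ \<xi>]) simp_all
    qed
    moreover have "(\<lambda>\<xi>. (p \<xi>, \<theta> \<xi>)) ` over S \<subseteq> S \<times> sphere 0 1"
      using trivialisation_norm[OF \<theta>] by (auto simp: over_iff)
    ultimately show "(\<lambda>\<xi>. (p \<xi>, \<theta> \<xi>)) ` topspace (subtopology E (over S)) = topspace ?P"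
      by simp
    show "inj_on (\<lambda>\<xi>. (p \<xi>, \<theta> \<xi>)) (topspace (subtopology E (over S)))"
      using trivialisation_inj[OF \<theta>] by (auto simp: inj_on_def)
  qed
  then show ?thesis
    using p_act equivariant_act[OF trivialisation_equivariant[OF \<theta>]]
    by (auto simp: local_triv_def over_def)
qed

lemma equivariant_cutoff:
  assumes \<phi>: "local_triv E p act U \<phi>" and \<rho>: "continuous_on (geom K) \<rho>"
    and supp: "\<And>x. x \<in> geom K \<Longrightarrow> \<rho> x \<noteq> 0 \<Longrightarrow> x \<in> U"
  shows "equivariant_on (geom K) (\<lambda>\<xi>. complex_of_real (\<rho> (p \<xi>)) * snd (\<phi> \<xi>))"
proof -
  let ?F = "\<lambda>\<xi>. complex_of_real (\<rho> (p \<xi>)) * snd (\<phi> \<xi>)" and ?N = "{\<xi> \<in> topspace E. \<rho> (p \<xi>) \<noteq> 0}"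
  have r: "continuous_map E euclideanreal (\<lambda>\<xi>. \<rho> (p \<xi>))"
    by (rule continuous_map_compose_continuous_on[OF p_continuous_euclidean \<rho> p_in_geom])
  have N: "?N \<subseteq> over U" using supp p_in_geom by (auto simp: over_iff)
  have "continuous_map (subtopology E (over U)) (top_of_set (sphere 0 1)) (snd \<circ> \<phi>)"
    using homeomorphic_imp_continuous_map[OF local_triv_homeomorphic[OF \<phi>]]
    by (rule continuous_map_snd_of)
  then have "continuous_map (subtopology E (over U)) euclidean (\<lambda>\<xi>. snd (\<phi> \<xi>))"
    by (simp add: continuous_map_in_subtopology o_def)
  then have snd: "continuous_map (subtopology E ?N) euclidean (\<lambda>\<xi>. snd (\<phi> \<xi>))"
    using N by (rule continuous_map_from_subtopology_mono)
  have "continuous_map E euclidean ?F"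
  proof (rule continuous_map_dominated[OF r, where B = 1])
    have "continuous_map (subtopology E ?N) euclidean (\<lambda>\<xi>. complex_of_real (\<rho> (p \<xi>)))"
      using continuous_map_from_subtopology[OF r]
      by (rule continuous_map_compose_continuous_on[where S = UNIV])
        (auto intro!: continuous_intros)
    then show "continuous_map (subtopology E ?N) euclidean ?F"
      using snd by (rule continuous_map_mult)
    show "norm (?F \<xi>) \<le> 1 * \<bar>\<rho> (p \<xi>)\<bar>" if "\<xi> \<in> topspace E" for \<xi>
      using local_triv_norm[OF \<phi>, of \<xi>] N that by (cases "\<rho> (p \<xi>) = 0") (auto simp: norm_mult)
  qed
  moreover have "?F (act z \<xi>) = z * ?F \<xi>" if "\<xi> \<in> topspace E" "norm z = 1" for z \<xi>
    using local_trivD(2)[OF \<phi> _ that(2), of \<xi>] p_act[OF that] N that(1)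
    by (cases "\<rho> (p \<xi>) = 0") auto
  ultimately show ?thesis by (simp add: equivariant_on_def over_geom)
qed

lemma equivariant_frame:
  obtains I :: "('v \<Rightarrow> real) set" and \<Phi> where "finite I" "\<And>i. i \<in> I \<Longrightarrow> equivariant_on (geom K) (\<Phi> i)"
    "\<And>\<xi>. \<xi> \<in> topspace E \<Longrightarrow> \<exists>i\<in>I. \<Phi> i \<xi> \<noteq> 0"
proof -
  obtain I :: "('v \<Rightarrow> real) set" and U \<phi> and \<rho> :: "('v \<Rightarrow> real) \<Rightarrow> ('v \<Rightarrow> real) \<Rightarrow> real"
    where I: "finite I" and charts: "\<And>i. i \<in> I \<Longrightarrow> local_triv E p act (U i) (\<phi> i)"
      and \<rho>: "\<And>i. i \<in> I \<Longrightarrow> continuous_on (geom K) (\<rho> i)"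
        "\<And>i x. i \<in> I \<Longrightarrow> x \<in> geom K \<Longrightarrow> \<rho> i x \<noteq> 0 \<Longrightarrow> x \<in> U i"
      and cover: "\<And>x. x \<in> geom K \<Longrightarrow> \<exists>i\<in>I. 1 / 2 < \<rho> i x"
    by (rule finite_atlas, rule that)
  let ?\<Phi> = "\<lambda>i \<xi>. complex_of_real (\<rho> i (p \<xi>)) * snd (\<phi> i \<xi>)"
  show thesis
  proof (rule that[of I ?\<Phi>])
    show "equivariant_on (geom K) (?\<Phi> i)" if "i \<in> I" for i
      using equivariant_cutoff[OF charts \<rho>] that by blast
    fix \<xi> assume \<xi>: "\<xi> \<in> topspace E"
    then obtain i where i: "i \<in> I" "1 / 2 < \<rho> i (p \<xi>)" using cover p_in_geom by blast
    then have "\<xi> \<in> over (U i)" using \<rho>(2)[of i "p \<xi>"] p_in_geom[OF \<xi>] \<xi> by (auto simp: over_iff)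
    then show "\<exists>i\<in>I. ?\<Phi> i \<xi> \<noteq> 0"
      using i local_triv_norm[OF charts[OF i(1)], of \<xi>] by (intro bexI[of _ i]) auto
  qed (rule I)
qed

end

subsection \<open>Trivialisations over star-shaped sets\<close>

text \<open>The functions \<open>\<Phi>\<close> embed the bundle into a trivial hermitian one. Orthogonal projection
  between sufficiently close fibres transports a fixed vector from \<open>c\<close> along the rays of \<open>S\<close>.\<close>

locale framed_bundle = bundle_over_complex V K E p act
  for V :: "'v set" and K :: "'v set set" and E :: "'e topology" and p :: "'e \<Rightarrow> 'v \<Rightarrow> real"
    and act :: "complex \<Rightarrow> 'e \<Rightarrow> 'e" +
  fixes I :: "'i set" and \<Phi> :: "'i \<Rightarrow> 'e \<Rightarrow> complex"
  assumes finite_index: "finite I"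
    and frame_equivariant: "i \<in> I \<Longrightarrow> equivariant_on (geom K) (\<Phi> i)"
    and frame_nonzero: "\<xi> \<in> topspace E \<Longrightarrow> \<exists>i\<in>I. \<Phi> i \<xi> \<noteq> 0"
begin

lemma frame_continuous: "i \<in> I \<Longrightarrow> continuous_map E euclidean (\<Phi> i)"
  using equivariant_continuous[OF frame_equivariant] by (simp add: over_geom)

lemma frame_act: "i \<in> I \<Longrightarrow> \<xi> \<in> topspace E \<Longrightarrow> norm z = 1 \<Longrightarrow> \<Phi> i (act z \<xi>) = z * \<Phi> i \<xi>"
  using equivariant_act[OF frame_equivariant] by (simp add: over_geom)

definition hprod :: "'e \<Rightarrow> 'e \<Rightarrow> complex" where
  "hprod \<xi> \<eta> = (\<Sum>i\<in>I. \<Phi> i \<xi> * cnj (\<Phi> i \<eta>))"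

lemma hprod_self_nonzero:
  assumes "\<xi> \<in> topspace E" shows "hprod \<xi> \<xi> \<noteq> 0"
proof -
  obtain i where "i \<in> I" "\<Phi> i \<xi> \<noteq> 0" using frame_nonzero[OF assms] by blast
  then have "0 < (\<Sum>i\<in>I. (norm (\<Phi> i \<xi>))\<^sup>2)"
    using finite_index by (intro sum_pos2[of I i]) auto
  moreover have "hprod \<xi> \<xi> = of_real (\<Sum>i\<in>I. (norm (\<Phi> i \<xi>))\<^sup>2)"
    by (simp only: hprod_def complex_norm_square of_real_sum)
  ultimately show ?thesis by (metis less_irrefl of_real_eq_0_iff)
qed

definition projector :: "'i \<Rightarrow> 'i \<Rightarrow> ('v \<Rightarrow> real) \<Rightarrow> complex" where
  "projector i j x = \<Phi> i (point_over x) * cnj (\<Phi> j (point_over x))"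

lemma frame_product_invariant:
  assumes "i \<in> I" "j \<in> I" "\<xi> \<in> over (geom K)" "norm z = 1"
  shows "\<Phi> i (act z \<xi>) * cnj (\<Phi> j (act z \<xi>)) = \<Phi> i \<xi> * cnj (\<Phi> j \<xi>)"
proof -
  have "z * cnj z = 1" using assms(4) by (simp flip: complex_norm_square)
  then show ?thesis using frame_act assms by (simp add: over_geom)
qed

lemma projector_p: "i \<in> I \<Longrightarrow> j \<in> I \<Longrightarrow> \<xi> \<in> topspace E \<Longrightarrow> projector i j (p \<xi>) = \<Phi> i \<xi> * cnj (\<Phi> j \<xi>)"
  unfolding projector_def
  by (rule invariant_point_over[where F = "\<lambda>\<xi>. \<Phi> i \<xi> * cnj (\<Phi> j \<xi>)" and S = "geom K"])
    (simp_all only: frame_product_invariant over_geom)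

lemma continuous_on_projector:
  assumes "i \<in> I" "j \<in> I" shows "continuous_on (geom K) (projector i j)"
  unfolding projector_def
proof (rule continuous_on_descent[OF compact_geom order_refl])
  have "continuous_map E euclidean (\<lambda>\<xi>. cnj (\<Phi> j \<xi>))"
    using frame_continuous[OF assms(2)]
    by (rule continuous_map_compose_continuous_on[where S = UNIV]) (auto intro!: continuous_intros)
  then show "continuous_map (subtopology E (over (geom K))) euclidean (\<lambda>\<xi>. \<Phi> i \<xi> * cnj (\<Phi> j \<xi>))"
    using continuous_map_mult[OF frame_continuous[OF assms(1)]] by (simp add: over_geom)
qed (rule frame_product_invariant[OF assms])

definition overlap :: "('v \<Rightarrow> real) \<Rightarrow> ('v \<Rightarrow> real) \<Rightarrow> real" where
  "overlap x y = Re (\<Sum>i\<in>I. \<Sum>j\<in>I. projector i j x * projector j i y)"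

lemma overlap_p:
  assumes "\<xi> \<in> topspace E" "\<eta> \<in> topspace E"
  shows "overlap (p \<xi>) (p \<eta>) = (norm (hprod \<xi> \<eta>))\<^sup>2"
proof -
  have "(\<Sum>i\<in>I. \<Sum>j\<in>I. projector i j (p \<xi>) * projector j i (p \<eta>))
      = (\<Sum>i\<in>I. \<Sum>j\<in>I. (\<Phi> i \<xi> * cnj (\<Phi> i \<eta>)) * (cnj (\<Phi> j \<xi>) * \<Phi> j \<eta>))"
    using assms by (simp add: projector_p mult_ac)
  also have "\<dots> = hprod \<xi> \<eta> * cnj (hprod \<xi> \<eta>)"
    by (simp add: hprod_def sum_product)
  finally show ?thesis by (simp add: overlap_def flip: complex_norm_square)
qed

primrec transport :: "('v \<Rightarrow> real) \<Rightarrow> nat \<Rightarrow> nat \<Rightarrow> ('v \<Rightarrow> real) \<Rightarrow> 'i \<Rightarrow> complex" where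
  "transport c M 0 x i = \<Phi> i (point_over c)"
| "transport c M (Suc n) x i = (\<Sum>j\<in>I. projector i j (seg c x (real (Suc n) / M)) * transport c M n x j)"

context
  fixes S :: "('v \<Rightarrow> real) set" and c :: "'v \<Rightarrow> real" and M :: nat
  assumes S: "compact S" "S \<subseteq> geom K" "star_at c S" and M: "M > 0"
    and steps: "\<And>j x. j < M \<Longrightarrow> x \<in> S \<Longrightarrow> 0 < overlap (seg c x (real j / M)) (seg c x (real (Suc j) / M))"
begin

lemma continuous_on_transport: "n \<le> M \<Longrightarrow> i \<in> I \<Longrightarrow> continuous_on S (\<lambda>x. transport c M n x i)"
proof (induction n arbitrary: i)
  case (Suc n)
  have "continuous_on S (\<lambda>x. projector i j (seg c x (real (Suc n) / M)))" if "j \<in> I" for j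
    using Suc.prems that S
    by (intro continuous_on_compose_seg[OF continuous_on_subset[OF continuous_on_projector] S(3)]
        continuous_intros)
      (auto simp del: of_nat_Suc)
  then show ?case using Suc unfolding transport.simps by (intro continuous_intros) auto
qed simp

lemma transport_multiple:
  assumes "n \<le> M" "x \<in> S" "\<xi> \<in> topspace E" "p \<xi> = seg c x (real n / M)"
  shows "\<exists>k. k \<noteq> 0 \<and> (\<forall>i\<in>I. transport c M n x i = k * \<Phi> i \<xi>)"
  using assms
proof (induction n arbitrary: \<xi>)
  case 0
  have "c \<in> geom K" using star_at_center[OF S(3)] S(2) by blast
  then obtain z where z: "norm z = 1" "point_over c = act z \<xi>"
    using fibre_transitive[of \<xi> "point_over c"] point_over[of c] 0 by auto
  then show ?case using frame_act[OF _ 0(3) z(1)] by (intro exI[of _ z]) auto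
next
  case (Suc n)
  define \<eta> where "\<eta> = point_over (seg c x (real n / M))"
  have "seg c x (real n / M) \<in> geom K"
    using star_at_seg[OF S(3) Suc.prems(2), of "real n / M"] Suc.prems(1) S(2) by auto
  then have \<eta>: "\<eta> \<in> topspace E" "p \<eta> = seg c x (real n / M)"
    using point_over by (auto simp: \<eta>_def)
  obtain k where k: "k \<noteq> 0" "\<forall>i\<in>I. transport c M n x i = k * \<Phi> i \<eta>"
    using Suc.IH[OF _ _ \<eta>] Suc.prems by auto
  have "0 < overlap (p \<eta>) (p \<xi>)"
    using steps[of n x] Suc.prems \<eta>(2) by simp
  then have "hprod \<eta> \<xi> \<noteq> 0" using overlap_p[OF \<eta>(1) Suc.prems(3)] by auto
  moreover have "transport c M (Suc n) x i = k * hprod \<eta> \<xi> * \<Phi> i \<xi>" if i: "i \<in> I" for i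
  proof -
    have "transport c M (Suc n) x i = (\<Sum>j\<in>I. projector i j (p \<xi>) * transport c M n x j)"
      by (simp add: Suc.prems(4))
    also have "\<dots> = (\<Sum>j\<in>I. k * \<Phi> i \<xi> * (\<Phi> j \<eta> * cnj (\<Phi> j \<xi>)))"
      using projector_p[OF i _ Suc.prems(3)] k by (intro sum.cong) auto
    finally show ?thesis by (simp add: hprod_def sum_distrib_left mult_ac)
  qed
  ultimately show ?case using k(1) by (intro exI[of _ "k * hprod \<eta> \<xi>"]) auto
qed

lemma trivialisation_transport:
  "trivialisation_on S (\<lambda>\<xi>. sgn (\<Sum>i\<in>I. \<Phi> i \<xi> * cnj (transport c M M (p \<xi>) i)))"
proof (rule trivialisation_sgn)
  let ?\<theta> = "\<lambda>\<xi>. \<Sum>i\<in>I. \<Phi> i \<xi> * cnj (transport c M M (p \<xi>) i)"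
  have "continuous_map (subtopology E (over S)) euclidean (\<lambda>\<xi>. \<Phi> i \<xi> * cnj (transport c M M (p \<xi>) i))"
    if i: "i \<in> I" for i
  proof (intro continuous_map_mult continuous_map_from_subtopology[OF frame_continuous[OF i]])
    have "continuous_on S (\<lambda>x. cnj (transport c M M x i))"
      using continuous_on_transport[OF order_refl i] by (intro continuous_intros)
    then show "continuous_map (subtopology E (over S)) euclidean (\<lambda>\<xi>. cnj (transport c M M (p \<xi>) i))"
      by (rule continuous_map_compose_continuous_on[OF continuous_map_from_subtopology[OF p_continuous_euclidean]])
        (simp add: over_iff)
  qed
  then have "continuous_map (subtopology E (over S)) euclidean ?\<theta>"
    using finite_index by (intro continuous_map_sum) auto
  moreover have "?\<theta> (act z \<xi>) = z * ?\<theta> \<xi>" if "\<xi> \<in> over S" "norm z = 1" for \<xi> z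
    using that frame_act p_act by (simp add: over_iff sum_distrib_left mult.assoc)
  ultimately show "equivariant_on S ?\<theta>" by (simp add: equivariant_on_def)
  fix \<xi> assume "\<xi> \<in> over S"
  then have \<xi>: "\<xi> \<in> topspace E" "p \<xi> \<in> S" by (auto simp: over_iff)
  obtain k where k: "k \<noteq> 0" "\<forall>i\<in>I. transport c M M (p \<xi>) i = k * \<Phi> i \<xi>"
    using transport_multiple[OF order_refl \<xi>(2,1)] M by auto
  have "?\<theta> \<xi> = cnj k * hprod \<xi> \<xi>"
    unfolding hprod_def sum_distrib_left using k by (intro sum.cong) auto
  then show "?\<theta> \<xi> \<noteq> 0" using k(1) hprod_self_nonzero[OF \<xi>(1)] by simp
qed

end

lemma trivialisation_exists_frame:
  assumes S: "compact S" "S \<subseteq> geom K" "star_at c S" obtains \<theta> where "trivialisation_on S \<theta>"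
proof -
  have "continuous_on (S \<times> S) (\<lambda>(x, y). overlap x y)"
    unfolding overlap_def case_prod_unfold
    by (intro continuous_intros continuous_on_compose2[OF continuous_on_subset[OF continuous_on_projector S(2)]]) auto
  moreover have "0 < overlap x x" if "x \<in> S" for x
    using overlap_p[of "point_over x" "point_over x"] hprod_self_nonzero point_over[of x] that S(2)
    by auto
  ultimately obtain M :: nat where "M > 0"
    "\<And>j x. j < M \<Longrightarrow> x \<in> S \<Longrightarrow> 0 < overlap (seg c x (real j / M)) (seg c x (real (Suc j) / M))"
    using star_at_uniform_steps[OF S(1,3)] by blast
  from trivialisation_transport[OF S this] show thesis by (rule that)
qed

end

lemma (in bundle_over_complex) trivialisation_exists:
  assumes "compact S" "S \<subseteq> geom K" "star_at c S" obtains \<theta> where "trivialisation_on S \<theta>"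
proof -
  obtain I :: "('v \<Rightarrow> real) set" and \<Phi> where "finite I" "\<And>i. i \<in> I \<Longrightarrow> equivariant_on (geom K) (\<Phi> i)"
    "\<And>\<xi>. \<xi> \<in> topspace E \<Longrightarrow> \<exists>i\<in>I. \<Phi> i \<xi> \<noteq> 0"
    by (rule equivariant_frame, rule that)
  then interpret framed_bundle V K E p act I \<Phi> by unfold_locales
  show thesis using trivialisation_exists_frame[OF assms] that .
qed

section \<open>Sections over the 1-skeleton and transition angles\<close>

locale skeleton_section = bundle_over_complex V K E p act
  for V :: "'v set" and K :: "'v set set" and E :: "'e topology" and p :: "'e \<Rightarrow> 'v \<Rightarrow> real"
    and act :: "complex \<Rightarrow> 'e \<Rightarrow> 'e" +
  fixes s :: "('v \<Rightarrow> real) \<Rightarrow> 'e"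
  assumes section_continuous: "continuous_map (top_of_set (geom (skel1 K))) E s"
    and p_section: "x \<in> geom (skel1 K) \<Longrightarrow> p (s x) = x"
begin

lemma section_over: "x \<in> geom (skel1 K) \<Longrightarrow> x \<in> S \<Longrightarrow> s x \<in> over S"
  using section_continuous p_section by (auto simp: over_iff continuous_map_def)

lemma edge_in_skel1: "{u, v} \<in> K \<Longrightarrow> y \<in> geom (faces {u, v}) \<Longrightarrow> y \<in> geom (skel1 K)"
  using edge_subset_skel1[OF complex] by blast

lemma vtx_in_skel1: "{v} \<in> K \<Longrightarrow> vtx v \<in> geom (skel1 K)"
  by (intro vtx_in_geom) (simp add: skel1_def)

lemma normalised_trivialisation_exists:
  assumes v: "{v} \<in> K" shows "\<exists>\<theta>. trivialisation_on (cstar K {v}) \<theta> \<and> \<theta> (s (vtx v)) = 1"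
proof -
  have star: "star_at (vtx v) (cstar K {v})" using star_at_cstar[OF v] by simp
  obtain \<theta> where \<theta>: "trivialisation_on (cstar K {v}) \<theta>"
    using trivialisation_exists[OF compact_cstar cstar_subset star] .
  have "s (vtx v) \<in> over (cstar K {v})"
    using vtx_in_skel1[OF v] star_at_center[OF star] by (rule section_over)
  then have norm: "norm (\<theta> (s (vtx v))) = 1" by (rule trivialisation_norm[OF \<theta>])
  then have "\<theta> (s (vtx v)) \<noteq> 0" by auto
  with norm have "norm (inverse (\<theta> (s (vtx v)))) = 1" "inverse (\<theta> (s (vtx v))) * \<theta> (s (vtx v)) = 1"
    by (auto simp: norm_inverse)
  then show ?thesis using trivialisation_scale[OF \<theta>] by blast
qed

definition star_triv :: "'v \<Rightarrow> 'e \<Rightarrow> complex" where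
  "star_triv v = (SOME \<theta>. trivialisation_on (cstar K {v}) \<theta> \<and> \<theta> (s (vtx v)) = 1)"

lemma star_triv:
  assumes "{v} \<in> K"
  shows "trivialisation_on (cstar K {v}) (star_triv v)" "star_triv v (s (vtx v)) = 1"
  using someI_ex[OF normalised_trivialisation_exists[OF assms]] by (simp_all add: star_triv_def)

lemma star_triv_on:
  assumes "\<sigma> \<in> K" "v \<in> \<sigma>" shows "trivialisation_on (cstar K \<sigma>) (star_triv v)"
proof (rule trivialisation_subset)
  show "trivialisation_on (cstar K {v}) (star_triv v)"
    using assms by (intro star_triv face[OF assms(1)]) auto
  show "cstar K \<sigma> \<subseteq> cstar K {v}" using assms(2) by (intro cstar_mono) simp
qed

lemma star_triv_nonzero:
  "\<sigma> \<in> K \<Longrightarrow> v \<in> \<sigma> \<Longrightarrow> \<xi> \<in> over (cstar K \<sigma>) \<Longrightarrow> star_triv v \<xi> \<noteq> 0"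
  using trivialisation_norm[OF star_triv_on] by fastforce

lemma continuous_on_star_triv_section:
  assumes v: "{v} \<in> K" and T: "T \<subseteq> geom (skel1 K)" "T \<subseteq> cstar K {v}"
  shows "continuous_on T (\<lambda>x. star_triv v (s x))"
proof -
  have "continuous_map (top_of_set T) (subtopology E (over (cstar K {v}))) s"
    using continuous_map_from_subtopology_mono[OF section_continuous T(1)] section_over T
    by (intro continuous_map_into_subtopology) auto
  from continuous_map_compose[OF this equivariant_continuous[OF trivialisation_equivariant[OF star_triv(1)[OF v]]]]
  show ?thesis by (simp add: o_def)
qed

definition ratio :: "'v \<Rightarrow> 'v \<Rightarrow> ('v \<Rightarrow> real) \<Rightarrow> complex" where
  "ratio u v x = star_triv v (point_over x) / star_triv u (point_over x)"

lemma point_over_cstar: "x \<in> cstar K \<sigma> \<Longrightarrow> point_over x \<in> over (cstar K \<sigma>)"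
  by (rule point_over_in[OF _ cstar_subset])

lemma ratio_norm:
  assumes "{u, v} \<in> K" "x \<in> cstar K {u, v}" shows "norm (ratio u v x) = 1"
  using trivialisation_norm[OF star_triv_on[OF assms(1)] point_over_cstar[OF assms(2)]]
  by (simp add: ratio_def norm_divide)

lemma ratio_mult:
  assumes "{u, v, w} \<in> K" "x \<in> cstar K {u, v, w}" shows "ratio u v x * ratio v w x = ratio u w x"
  using star_triv_nonzero[OF assms(1) _ point_over_cstar[OF assms(2)], of v]
  by (simp add: ratio_def)

lemma ratio_invariant:
  assumes "{u, v} \<in> K" "\<xi> \<in> over (cstar K {u, v})" "norm z = 1"
  shows "star_triv v (act z \<xi>) / star_triv u (act z \<xi>) = star_triv v \<xi> / star_triv u \<xi>"
  using equivariant_act[OF trivialisation_equivariant[OF star_triv_on[OF assms(1)]] assms(2,3)]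
    assms(3)
  by auto

lemma ratio_p:
  assumes uv: "{u, v} \<in> K" and \<xi>: "\<xi> \<in> over (cstar K {u, v})"
  shows "star_triv v \<xi> = star_triv u \<xi> * ratio u v (p \<xi>)"
proof -
  have "ratio u v (p \<xi>) = star_triv v \<xi> / star_triv u \<xi>"
    unfolding ratio_def using ratio_invariant[OF uv] \<xi>
    by (rule invariant_point_over[where F = "\<lambda>\<xi>. star_triv v \<xi> / star_triv u \<xi>"])
  then show ?thesis using star_triv_nonzero[OF uv _ \<xi>] by simp
qed

lemma continuous_on_ratio:
  assumes uv: "{u, v} \<in> K" shows "continuous_on (cstar K {u, v}) (ratio u v)"
  unfolding ratio_def
proof (rule continuous_on_descent[OF compact_cstar cstar_subset _ ratio_invariant[OF uv]])
  let ?X = "subtopology E (over (cstar K {u, v}))"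
  have triv: "continuous_map ?X euclidean (star_triv u)" "continuous_map ?X euclidean (star_triv v)"
    using equivariant_continuous[OF trivialisation_equivariant[OF star_triv_on[OF uv]]] by auto
  have "continuous_map ?X euclidean (\<lambda>\<xi>. inverse (star_triv u \<xi>))"
    using star_triv_nonzero[OF uv]
    by (intro continuous_map_compose_continuous_on[OF triv(1), of "- {0}"])
      (auto intro!: continuous_intros)
  from continuous_map_mult[OF triv(2) this]
  show "continuous_map ?X euclidean (\<lambda>\<xi>. star_triv v \<xi> / star_triv u \<xi>)"
    by (simp add: divide_inverse)
qed

definition edge_angle :: "'v \<Rightarrow> 'v \<Rightarrow> ('v \<Rightarrow> real) \<Rightarrow> real" where
  "edge_angle u v = (SOME h. continuous_on (geom (faces {u, v})) h \<and> h (vtx u) = 0 \<and>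
      (\<forall>y\<in>geom (faces {u, v}). star_triv u (s y) = qcis (h y)))"

lemma edge_angle:
  assumes uv: "{u, v} \<in> K"
  shows "continuous_on (geom (faces {u, v})) (edge_angle u v)" "edge_angle u v (vtx u) = 0"
    "y \<in> geom (faces {u, v}) \<Longrightarrow> star_triv u (s y) = qcis (edge_angle u v y)"
proof -
  let ?S = "geom (faces {u, v})"
  have u: "{u} \<in> K" "vtx u \<in> ?S" using face[OF uv] by (auto intro: vtx_in_geom_faces)
  have sub: "?S \<subseteq> geom (skel1 K)" "?S \<subseteq> cstar K {u}"
    using edge_in_skel1[OF uv] geom_faces_subset_cstar[OF uv] by auto
  obtain h where "continuous_on ?S h" "\<And>x. x \<in> ?S \<Longrightarrow> star_triv u (s x) = qcis (h x)"
    "\<And>x. x \<in> {vtx u} \<Longrightarrow> h x = 0"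
  proof (rule star_at_qcis_lift_extends[of ?S "vtx u" "\<lambda>x. star_triv u (s x)" "{vtx u}" "vtx u" "\<lambda>_. 0"])
    show "norm (star_triv u (s x)) = 1" if "x \<in> ?S" for x
      using trivialisation_norm[OF star_triv(1)[OF u(1)]] section_over sub that by blast
  qed (use u star_triv(2)[OF u(1)] continuous_on_star_triv_section[OF u(1) sub] in
      \<open>auto intro: compact_geom_faces star_at_geom_faces\<close>)
  then have "\<exists>h. continuous_on ?S h \<and> h (vtx u) = 0 \<and> (\<forall>y\<in>?S. star_triv u (s y) = qcis (h y))"
    by blast
  from someI_ex[OF this, folded edge_angle_def]
  show "continuous_on ?S (edge_angle u v)" "edge_angle u v (vtx u) = 0"
    "y \<in> ?S \<Longrightarrow> star_triv u (s y) = qcis (edge_angle u v y)"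
    by blast+
qed

lemma edge_angle_swap:
  assumes "{u, v} \<in> K"
  shows "continuous_on (geom (faces {u, v})) (edge_angle v u)"
    "y \<in> geom (faces {u, v}) \<Longrightarrow> star_triv v (s y) = qcis (edge_angle v u y)"
  using edge_angle(1,3)[of v u] assms by (simp_all add: insert_commute)

lemma ratio_on_edge:
  assumes uv: "{u, v} \<in> K" and y: "y \<in> geom (faces {u, v})"
  shows "ratio u v y = qcis (edge_angle v u y - edge_angle u v y)"
proof -
  have "y \<in> geom (skel1 K)" "y \<in> cstar K {u, v}"
    using edge_in_skel1[OF uv y] geom_faces_subset_cstar[OF uv] y by auto
  then have "star_triv v (s y) = star_triv u (s y) * ratio u v y"
    using ratio_p[OF uv section_over] p_section by simp
  then show ?thesis
    using edge_angle(3)[OF uv y] edge_angle_swap(2)[OF uv y]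
    by (simp add: qcis_diff)
qed

definition transition_angle :: "'v \<Rightarrow> 'v \<Rightarrow> ('v \<Rightarrow> real) \<Rightarrow> real" where
  "transition_angle u v = (SOME h. continuous_on (cstar K {u, v}) h \<and>
      (\<forall>x\<in>cstar K {u, v}. ratio u v x = qcis (h x)) \<and>
      (\<forall>y\<in>geom (faces {u, v}). h y = edge_angle v u y - edge_angle u v y))"

lemma transition_angle:
  assumes uv: "{u, v} \<in> K"
  shows "continuous_on (cstar K {u, v}) (transition_angle u v)"
    "x \<in> cstar K {u, v} \<Longrightarrow> ratio u v x = qcis (transition_angle u v x)"
    "y \<in> geom (faces {u, v}) \<Longrightarrow> transition_angle u v y = edge_angle v u y - edge_angle u v y"
proof -
  let ?T = "geom (faces {u, v})" and ?g = "\<lambda>y. edge_angle v u y - edge_angle u v y"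
  obtain h where "continuous_on (cstar K {u, v}) h"
    "\<And>x. x \<in> cstar K {u, v} \<Longrightarrow> ratio u v x = qcis (h x)"
    "\<And>y. y \<in> ?T \<Longrightarrow> h y = ?g y"
  proof (rule star_at_qcis_lift_extends[OF compact_cstar star_at_cstar[OF uv, of u], of "ratio u v" ?T "vtx u" ?g])
    show "connected ?T" using star_at_geom_faces[of "{u, v}" u] star_at_connected by blast
    show "?T \<subseteq> cstar K {u, v}" by (rule geom_faces_subset_cstar[OF uv order_refl])
    show "continuous_on ?T ?g"
      using edge_angle(1)[OF uv] edge_angle_swap(1)[OF uv] by (intro continuous_intros)
  qed (use continuous_on_ratio ratio_norm ratio_on_edge uv in \<open>auto intro: vtx_in_geom_faces\<close>)
  then have "\<exists>h. continuous_on (cstar K {u, v}) h \<and> (\<forall>x\<in>cstar K {u, v}. ratio u v x = qcis (h x))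
      \<and> (\<forall>y\<in>?T. h y = ?g y)" by blast
  from someI_ex[OF this, folded transition_angle_def]
  show "continuous_on (cstar K {u, v}) (transition_angle u v)"
    "x \<in> cstar K {u, v} \<Longrightarrow> ratio u v x = qcis (transition_angle u v x)"
    "y \<in> ?T \<Longrightarrow> transition_angle u v y = edge_angle v u y - edge_angle u v y"
    by blast+
qed

lemma transition_angle_swap:
  assumes uv: "{u, v} \<in> K" and x: "x \<in> cstar K {u, v}"
  shows "transition_angle v u x = - transition_angle u v x"
proof -
  let ?S = "cstar K {u, v}"
  have vu: "{v, u} = {u, v}" by auto
  note angle = transition_angle[OF uv] and angle' = transition_angle[of v u, unfolded vu, OF uv]
  have star: "star_at (vtx u) ?S" using star_at_cstar[OF uv] by simp
  have "transition_angle v u x - - transition_angle u v x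
      = transition_angle v u (vtx u) - - transition_angle u v (vtx u)"
  proof (rule qcis_lift_difference[OF star_at_connected[OF star] angle'(1) _ _ x star_at_center[OF star]])
    show "continuous_on ?S (\<lambda>x. - transition_angle u v x)"
      using angle(1) by (intro continuous_intros)
    show "qcis (transition_angle v u y) = qcis (- transition_angle u v y)" if "y \<in> ?S" for y
    proof -
      have "ratio v u y = inverse (ratio u v y)" by (simp add: ratio_def)
      then show ?thesis using angle(2)[OF that] angle'(2)[OF that] by (simp add: qcis_minus)
    qed
  qed
  moreover have "transition_angle v u (vtx u) = - transition_angle u v (vtx u)"
    using angle(3)[of "vtx u"] angle'(3)[of "vtx u"] by (simp add: vtx_in_geom_faces)
  ultimately show ?thesis by simp
qed

lemma section_angle_opposite_edge:
  assumes uvw: "{u, v, w} \<in> K" and y: "y \<in> geom (faces {v, w})"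
  shows "star_triv u (s y) = qcis (edge_angle v w y - transition_angle u v y)"
proof -
  have edges: "{u, v} \<in> K" "{v, w} \<in> K" using face[OF uvw] by auto
  have star: "y \<in> cstar K {u, v}"
    using y geom_faces_mono[of "{v, w}" "{u, v, w}"] geom_faces_subset_cstar[OF uvw, of "{u, v}"]
    by auto
  have "star_triv v (s y) = star_triv u (s y) * ratio u v y"
    using ratio_p[OF edges(1) section_over[OF _ star]] edge_in_skel1[OF edges(2) y] p_section
    by simp
  then show ?thesis
    using edge_angle(3)[OF edges(2) y] transition_angle(2)[OF edges(1) star]
    by (simp add: qcis_diff)
qed

lemma winding_number_section_vtx:
  assumes uvw: "{u, v, w} \<in> K"
  shows "winding_number (\<lambda>t. star_triv u (s (bdry u v w t))) 0 = of_real
    ((transition_angle u w (vtx w) - transition_angle v w (vtx w) - transition_angle u v (vtx w)) / 4)"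
proof -
  let ?uv = "geom (faces {u, v})" and ?vw = "geom (faces {v, w})" and ?wu = "geom (faces {w, u})"
  have edges: "{u} \<in> K" "{u, v} \<in> K" "{v, w} \<in> K" "{u, w} \<in> K" "{w, u} = {u, w}"
    using face[OF uvw] by auto
  have sub: "?uv \<union> ?vw \<union> ?wu \<subseteq> geom (faces {u, v, w})"
    using geom_faces_mono[of "{u, v}" "{u, v, w}"] geom_faces_mono[of "{v, w}" "{u, v, w}"]
      geom_faces_mono[of "{w, u}" "{u, v, w}"] by auto
  have "winding_number (\<lambda>t. star_triv u (s (bdry u v w t))) 0
    = of_real ((edge_angle u v (vtx v) - edge_angle u v (vtx u)
        + ((edge_angle v w (vtx w) - transition_angle u v (vtx w)) -
            (edge_angle v w (vtx v) - transition_angle u v (vtx v)))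
        + (edge_angle u w (vtx u) - edge_angle u w (vtx w))) / 4)"
  proof (rule winding_number_bdry[where F = "\<lambda>y. star_triv u (s y)"])
    show "continuous_on (?uv \<union> ?vw \<union> ?wu) (\<lambda>y. star_triv u (s y))"
      using edge_in_skel1 edges sub geom_faces_subset_cstar[OF uvw, of "{u}"]
      by (intro continuous_on_star_triv_section[OF edges(1)]) auto
    have "?vw \<subseteq> cstar K {u, v}"
      using sub geom_faces_subset_cstar[OF uvw, of "{u, v}"] by auto
    then show "continuous_on ?vw (\<lambda>y. edge_angle v w y - transition_angle u v y)"
      using edge_angle(1)[OF edges(3)] continuous_on_subset[OF transition_angle(1)[OF edges(2)]]
      by (intro continuous_intros) auto
  qed (use edge_angle(1,3) edges section_angle_opposite_edge[OF uvw] in auto)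
  moreover have "transition_angle u v (vtx v) = - edge_angle u v (vtx v)"
    "transition_angle v w (vtx w) = - edge_angle v w (vtx w)" "transition_angle u w (vtx w) = - edge_angle u w (vtx w)"
    using transition_angle(3)[OF edges(2), of "vtx v"] transition_angle(3)[OF edges(3), of "vtx w"]
      transition_angle(3)[OF edges(4), of "vtx w"] edge_angle(2)[of v u] edge_angle(2)[of w v]
        edge_angle(2)[of w u] edges
    by (simp_all add: vtx_in_geom_faces insert_commute)
  moreover have "edge_angle u v (vtx u) = 0" "edge_angle u w (vtx u) = 0"
    "edge_angle v w (vtx v) = 0"
    using edge_angle(2) edges by auto
  ultimately show ?thesis by (simp add: algebra_simps)
qed

lemma winding_number_section:
  assumes uvw: "{u, v, w} \<in> K" and x: "x \<in> cstar K {u, v, w}"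
  shows "winding_number (\<lambda>t. star_triv u (s (bdry u v w t))) 0 = of_real
    ((transition_angle u w x - transition_angle v w x - transition_angle u v x) / 4)"
proof -
  let ?S = "cstar K {u, v, w}"
  have edges: "{u, v} \<in> K" "{v, w} \<in> K" "{u, w} \<in> K" using face[OF uvw] by auto
  have sub: "?S \<subseteq> cstar K {u, v}" "?S \<subseteq> cstar K {v, w}" "?S \<subseteq> cstar K {u, w}"
    by (auto intro!: cstar_mono)
  have star: "star_at (vtx w) ?S" using star_at_cstar[OF uvw] by simp
  let ?composite = "\<lambda>y. transition_angle u v y + transition_angle v w y"
  have "transition_angle u w x - ?composite x = transition_angle u w (vtx w) - ?composite (vtx w)"
  proof (rule qcis_lift_difference[OF star_at_connected[OF star] _ _ _ x star_at_center[OF star]])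
    show "continuous_on ?S (transition_angle u w)" "continuous_on ?S ?composite"
      using sub transition_angle(1)[OF edges(1)] transition_angle(1)[OF edges(2)]
        transition_angle(1)[OF edges(3)]
      by (auto intro!: continuous_intros intro: continuous_on_subset)
    show "qcis (transition_angle u w y) = qcis (?composite y)" if "y \<in> ?S" for y
      using ratio_mult[OF uvw that] sub that transition_angle(2)[OF edges(1), of y]
        transition_angle(2)[OF edges(2), of y] transition_angle(2)[OF edges(3), of y]
      by (simp add: qcis_add subset_iff)
  qed
  then have "transition_angle u w x - transition_angle v w x - transition_angle u v x
      = transition_angle u w (vtx w) - transition_angle v w (vtx w) - transition_angle u v (vtx w)"
    by linarith
  then show ?thesis using winding_number_section_vtx[OF uvw] by (simp only:)
qed

end

section \<open>Realising the marks\<close>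

locale euler_bundle = skeleton_section V K E p act s + cyclic_system V K a eps
  for V :: "'v set" and K :: "'v set set" and E :: "'e topology" and p :: "'e \<Rightarrow> 'v \<Rightarrow> real"
    and act :: "complex \<Rightarrow> 'e \<Rightarrow> 'e" and s a eps +
  fixes e :: "'v \<Rightarrow> 'v \<Rightarrow> 'v \<Rightarrow> int" and b :: "'v \<Rightarrow> 'v \<Rightarrow> int"
  assumes e_eps: "{u, v, w} \<in> K \<Longrightarrow> distinct [u, v, w] \<Longrightarrow>
        cobd1 a u v w + eps u v w = 4 * (e u v w + cobd1 a u v w)"
    and b_alt: "alt1 K b"
    and winding: "{u, v, w} \<in> K \<Longrightarrow> distinct [u, v, w] \<Longrightarrow> local_triv E p act (geom (faces {u, v, w})) \<phi> \<Longrightarrow>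
        complex_of_int (e u v w - cobd1 b u v w) =
          winding_number (\<lambda>t. snd (\<phi> (s (bdry u v w t)))) 0"
begin

lemma transition_angle_euler:
  assumes uvw: "{u, v, w} \<in> K" "distinct [u, v, w]" and x: "x \<in> cstar K {u, v, w}"
  shows "transition_angle v w x - transition_angle u w x + transition_angle u v x
    = - 4 * of_int (e u v w - cobd1 b u v w)"
proof -
  let ?S = "geom (faces {u, v, w})"
  have "{u} \<in> K" using face[OF uvw(1)] by auto
  have sub: "?S \<subseteq> cstar K {u}" using geom_faces_subset_cstar[OF uvw(1)] by auto
  have "local_triv E p act ?S (\<lambda>\<xi>. (p \<xi>, star_triv u \<xi>))"
    using sub cstar_subset
    by (intro trivialisation_local_triv[OF trivialisation_subset[OF star_triv(1)[OF \<open>{u} \<in> K\<close>] sub]]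
        compact_geom_faces) auto
  from winding[OF uvw this] winding_number_section[OF uvw(1) x]
  have "complex_of_real (of_int (e u v w - cobd1 b u v w))
      = of_real ((transition_angle u w x - transition_angle v w x - transition_angle u v x) / 4)"
    by simp
  then have "of_int (e u v w - cobd1 b u v w)
      = (transition_angle u w x - transition_angle v w x - transition_angle u v x) / 4"
    by (simp only: of_real_eq_iff)
  then show ?thesis by (simp only:) (simp add: field_simps)
qed

definition phase :: "'v \<Rightarrow> 'v \<Rightarrow> ('v \<Rightarrow> real) \<Rightarrow> real" where
  "phase u v x = (if u = v then 0
     else transition_angle u v x + mark_diff u v x - 4 * of_int (a u v + b u v))"

lemma supp_cstar: "x \<in> geom K \<Longrightarrow> \<tau> \<subseteq> supp x \<Longrightarrow> x \<in> cstar K \<tau>"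
  using supp_in_complex[of x] by (simp add: cstar_def Un_absorb2)

lemma continuous_on_phase: "continuous_on (cstar K {u, v}) (phase u v)"
proof (cases "u = v \<or> {u, v} \<notin> K")
  case True
  have "cstar K {u, v} = {}" if "{u, v} \<notin> K"
    using that face[of _ "{u, v}"] by (auto simp: cstar_def)
  then show ?thesis using True by (auto simp: phase_def[abs_def])
next
  case False
  then show ?thesis
    using transition_angle(1)[of u v] continuous_on_mark_diff
    by (auto simp: phase_def[abs_def] intro!: continuous_intros)
qed

lemma phase_swap:
  assumes x: "x \<in> geom K" and u: "u \<in> supp x" and v: "v \<in> supp x"
  shows "phase v u x = - phase u v x"
proof (cases "u = v")
  case False
  have uv: "{u, v} \<in> K" using u v by (intro supp_face[OF x]) auto
  have "b v u = - b u v" using b_alt uv False by (simp add: alt1_def)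
  then show ?thesis
    using transition_angle_swap[OF uv supp_cstar[OF x]] mark_diff_swap[OF x u v False]
      a_swap[OF uv False] u v False
    by (simp add: phase_def)
qed (simp add: phase_def)

lemma phase_cobd:
  assumes x: "x \<in> geom K" and uvw: "u \<in> supp x" "v \<in> supp x" "w \<in> supp x"
  shows "phase u w x - phase v w x = phase u v x"
proof -
  consider "u = v \<or> v = w" | (eq_uw) "u = w" | (distinct) "distinct [u, v, w]" by force
  then show ?thesis
  proof cases
    case eq_uw
    then show ?thesis using phase_swap[OF x uvw(1,2)] by (simp add: phase_def)
  next
    case distinct
    have simplex: "{u, v, w} \<in> K" using uvw by (intro supp_face[OF x]) auto
    have "mark_diff v w x - mark_diff u w x + mark_diff u v x = of_int (cobd1 a u v w + eps u v w)"
      using drift_cobd[OF x uvw distinct] by (simp add: mark_diff_def cobd1_def)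
    also have "\<dots> = of_int (4 * (e u v w + cobd1 a u v w))"
      using e_eps[OF simplex distinct] by simp
    finally show ?thesis
      using transition_angle_euler[OF simplex distinct supp_cstar[OF x]] uvw distinct
      by (simp add: phase_def cobd1_def algebra_simps)
  qed (auto simp: phase_def)
qed

definition mean_phase :: "'v \<Rightarrow> ('v \<Rightarrow> real) \<Rightarrow> real" where
  "mean_phase v x = (\<Sum>w\<in>V. x w * phase v w x)"

lemma mean_phase_diff:
  assumes x: "x \<in> geom K" and u: "u \<in> supp x" and v: "v \<in> supp x"
  shows "mean_phase u x - mean_phase v x = phase u v x"
proof -
  have "x w * phase u w x - x w * phase v w x = x w * phase u v x" for w
    using phase_cobd[OF x u v, of w]
    by (cases "w \<in> supp x") (auto simp: supp_def simp flip: right_diff_distrib)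
  then have "mean_phase u x - mean_phase v x = (\<Sum>w\<in>V. x w * phase u v x)"
    by (simp add: mean_phase_def flip: sum_subtractf)
  then show ?thesis using geom_sum_vertices[OF x] by (simp flip: sum_distrib_right)
qed

lemma continuous_on_mean_phase: "continuous_on {x \<in> geom K. x v \<noteq> 0} (mean_phase v)"
  unfolding mean_phase_def[abs_def]
proof (intro continuous_on_sum)
  fix w
  show "continuous_on {x \<in> geom K. x v \<noteq> 0} (\<lambda>x. x w * phase v w x)"
  proof (rule continuous_on_mult_vanishing[OF _ compact_cstar continuous_on_phase])
    show "{x \<in> {x \<in> geom K. x v \<noteq> 0}. x w \<noteq> 0} \<subseteq> cstar K {v, w}"
      by (auto intro!: supp_cstar simp: supp_def)
  qed (auto intro: continuous_on_subset[OF continuous_on_product_coordinates])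
qed

definition mark :: "'v \<Rightarrow> 'e \<Rightarrow> complex" where
  "mark v \<xi> = (if p \<xi> v = 0 then 1 else star_triv v \<xi> * qcis (mean_phase v (p \<xi>)))"

lemma support_cstar:
  assumes "\<xi> \<in> topspace E" "p \<xi> v \<noteq> 0" shows "{v} \<in> K" "\<xi> \<in> over (cstar K {v})"
  using supp_face[OF p_in_geom[OF assms(1)], of "{v}"]
    supp_cstar[OF p_in_geom[OF assms(1)], of "{v}"] assms
  by (auto simp: over_iff supp_def)

lemma mark_norm: "\<xi> \<in> topspace E \<Longrightarrow> norm (mark v \<xi>) = 1"
  using support_cstar trivialisation_norm[OF star_triv(1)] by (auto simp: mark_def norm_mult)

lemma mark_continuous: "continuous_map (subtopology E {\<xi> \<in> topspace E. p \<xi> v \<noteq> 0}) euclidean (mark v)"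
proof (cases "{v} \<in> K")
  case True
  let ?X = "subtopology E {\<xi> \<in> topspace E. p \<xi> v \<noteq> 0}"
  have "continuous_map ?X euclidean (star_triv v)"
    using equivariant_continuous[OF trivialisation_equivariant[OF star_triv(1)[OF True]]]
    by (rule continuous_map_from_subtopology_mono) (use support_cstar in auto)
  moreover have "continuous_map ?X euclidean (\<lambda>\<xi>. qcis (mean_phase v (p \<xi>)))"
    by (rule continuous_map_compose_continuous_on[OF continuous_map_from_subtopology[OF p_continuous_euclidean]
          continuous_on_qcis[OF continuous_on_mean_phase[of v]]]) (use p_in_geom in auto)
  ultimately have "continuous_map ?X euclidean (\<lambda>\<xi>. star_triv v \<xi> * qcis (mean_phase v (p \<xi>)))"
    by (rule continuous_map_mult)
  then show ?thesis by (rule continuous_map_eq) (simp add: mark_def)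
next
  case False
  then have "topspace (subtopology E {\<xi> \<in> topspace E. p \<xi> v \<noteq> 0}) = {}"
    using support_cstar(1)
    by auto
  then show ?thesis by (simp only: null_topspace_iff_trivial continuous_map_on_empty)
qed

lemma mark_compatible:
  assumes \<xi>: "\<xi> \<in> topspace E" shows "compatible (p \<xi>) (\<lambda>v. mark v \<xi>)"
  unfolding compatible_def
proof (intro conjI ballI impI)
  fix u v assume u: "u \<in> supp (p \<xi>)" and v: "v \<in> supp (p \<xi>)" and "u \<noteq> v"
  let ?x = "p \<xi>"
  have x: "?x \<in> geom K" using p_in_geom[OF \<xi>] .
  have uv: "{u, v} \<in> K" using u v by (intro supp_face[OF x]) auto
  have star: "?x \<in> cstar K {u, v}" using u v by (intro supp_cstar[OF x]) auto
  have "transition_angle u v ?x + mean_phase v ?x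
      = mean_phase u ?x + - mark_diff u v ?x + 4 * of_int (a u v + b u v)"
    using mean_phase_diff[OF x u v] \<open>u \<noteq> v\<close> by (simp add: phase_def)
  moreover have "qcis (4 * of_int (a u v + b u v)) = 1" using qcis_eq_1_iff by blast
  ultimately have "qcis (transition_angle u v ?x) * qcis (mean_phase v ?x)
      = qcis (mean_phase u ?x) * qcis (- mark_diff u v ?x)"
    by (simp only: qcis_add mult_1_right flip: qcis_add[of "transition_angle u v ?x"])
  moreover have "star_triv v \<xi> = star_triv u \<xi> * qcis (transition_angle u v ?x)"
    using ratio_p[OF uv, of \<xi>] transition_angle(2)[OF uv star] star \<xi> by (simp add: over_iff)
  ultimately show "mark v \<xi> = mark u \<xi> * qcis (- mark_diff u v ?x)"
    using u v by (simp add: mark_def supp_def mult.assoc)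
qed (rule mark_norm[OF \<xi>])

lemma mark_act:
  assumes "\<xi> \<in> topspace E" "v \<in> supp (p \<xi>)" "norm z = 1" shows "mark v (act z \<xi>) = z * mark v \<xi>"
  using assms equivariant_act[OF trivialisation_equivariant[OF star_triv(1)]] support_cstar p_act
  by (simp add: mark_def supp_def)

end

section \<open>The triangulation\<close>

locale marked_bundle = bundle_over_complex V K E p act + cyclic_system V K a eps
  for V :: "'v set" and K :: "'v set set" and E :: "'e topology" and p :: "'e \<Rightarrow> 'v \<Rightarrow> real"
    and act :: "complex \<Rightarrow> 'e \<Rightarrow> 'e" and a eps +
  fixes q :: "'v \<Rightarrow> 'e \<Rightarrow> complex"
  assumes q_continuous: "continuous_map (subtopology E {\<xi> \<in> topspace E. p \<xi> v \<noteq> 0}) euclidean (q v)"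
    and q_norm: "\<xi> \<in> topspace E \<Longrightarrow> norm (q v \<xi>) = 1"
    and q_compatible: "\<xi> \<in> topspace E \<Longrightarrow> compatible (p \<xi>) (\<lambda>v. q v \<xi>)"
    and q_act: "\<xi> \<in> topspace E \<Longrightarrow> v \<in> supp (p \<xi>) \<Longrightarrow> norm z = 1 \<Longrightarrow> q v (act z \<xi>) = z * q v \<xi>"
begin

definition coord :: "'e \<Rightarrow> 'v \<times> bool \<times> bool \<Rightarrow> real" where
  "coord \<xi> = (\<lambda>(v, i). weight i (q v \<xi>) (p \<xi> v))"

definition total_vertices :: "('v \<times> bool \<times> bool) set" where
  "total_vertices = V \<times> UNIV"

definition total_complex :: "('v \<times> bool \<times> bool) set set" where
  "total_complex = {\<tau>. \<tau> \<noteq> {} \<and> (\<exists>\<xi>\<in>topspace E. \<tau> \<subseteq> supp (coord \<xi>))}"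

lemma finite_total_vertices: "finite total_vertices"
  using finite_vertices by (simp add: total_vertices_def)

lemma coord_bounds:
  assumes \<xi>: "\<xi> \<in> topspace E" shows "0 \<le> coord \<xi> w" "coord \<xi> w \<le> p \<xi> (fst w)"
  using weight_nonneg weight_le[OF q_norm[OF \<xi>]] geom_nonneg[OF p_in_geom[OF \<xi>]]
    geom_le_1[OF p_in_geom[OF \<xi>]]
  by (simp_all add: coord_def case_prod_unfold)

lemma coord_sum: "\<xi> \<in> topspace E \<Longrightarrow> (\<Sum>i\<in>UNIV. coord \<xi> (v, i)) = p \<xi> v"
  unfolding coord_def split_conv
  by (intro weight_sum q_norm geom_nonneg geom_le_1 p_in_geom)

lemma supp_coord:
  assumes \<xi>: "\<xi> \<in> topspace E"
  shows "fst ` supp (coord \<xi>) \<subseteq> supp (p \<xi>)"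
    "supp (coord \<xi>) \<subseteq> total_vertices"
proof -
  show "fst ` supp (coord \<xi>) \<subseteq> supp (p \<xi>)"
  proof (rule image_subsetI)
    show "fst w \<in> supp (p \<xi>)" if "w \<in> supp (coord \<xi>)" for w
      using that coord_bounds[OF \<xi>, of w] by (auto simp: supp_def)
  qed
  also have "supp (p \<xi>) \<subseteq> V" by (rule supp_subset[OF p_in_geom[OF \<xi>]])
  finally show "supp (coord \<xi>) \<subseteq> total_vertices"
    by (auto simp: total_vertices_def image_subset_iff)
qed

lemma push_fst_total_vertices:
  "push total_vertices fst y = (\<lambda>v. if v \<in> V then \<Sum>i\<in>UNIV. y (v, i) else 0)"
proof
  fix v
  have "{w \<in> total_vertices. fst w = v} = (if v \<in> V then Pair v ` UNIV else {})"
    by (auto simp: total_vertices_def)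
  then show "push total_vertices fst y v = (if v \<in> V then \<Sum>i\<in>UNIV. y (v, i) else 0)"
    by (simp add: push_def sum.reindex inj_on_def)
qed

lemma push_coord:
  assumes \<xi>: "\<xi> \<in> topspace E" shows "push total_vertices fst (coord \<xi>) = p \<xi>"
proof
  show "push total_vertices fst (coord \<xi>) v = p \<xi> v" for v
    using coord_sum[OF \<xi>, of v] supp_subset[OF p_in_geom[OF \<xi>]]
    by (cases "v \<in> V") (auto simp: push_fst_total_vertices supp_def)
qed

lemma coord_in_geom:
  assumes \<xi>: "\<xi> \<in> topspace E" shows "coord \<xi> \<in> geom total_complex"
proof -
  have "sum (coord \<xi>) total_vertices = (\<Sum>v\<in>V. \<Sum>i\<in>UNIV. coord \<xi> (v, i))"
    unfolding total_vertices_def by (simp add: sum.cartesian_product)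
  also have "\<dots> = 1"
    using geom_sum_vertices[OF p_in_geom[OF \<xi>]] by (simp add: coord_sum[OF \<xi>])
  finally have "sum (coord \<xi>) (supp (coord \<xi>)) = 1"
    using sum_supp[OF finite_total_vertices supp_coord(2)[OF \<xi>]] by simp
  moreover from this have "supp (coord \<xi>) \<noteq> {}" by auto
  ultimately show ?thesis
    using coord_bounds(1)[OF \<xi>] \<xi> by (auto simp: geom_iff total_complex_def)
qed

lemma total_vertex_attained:
  assumes v: "v \<in> V" obtains \<xi> where "\<xi> \<in> topspace E" "(v, i) \<in> supp (coord \<xi>)"
proof -
  obtain k s where i: "i = (k, s)" by (cases i)
  have x: "vtx v \<in> geom K" using vertex[OF v] by (rule vtx_in_geom)
  define \<eta> where "\<eta> = point_over (vtx v)"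
  have \<eta>: "\<eta> \<in> topspace E" "p \<eta> v = 1" "v \<in> supp (p \<eta>)"
    using point_over[OF x] by (simp_all add: \<eta>_def vtx_def supp_def)
  define c where "c = unit_sign s * qcis (if k then 0 else 1)"
  have z: "norm (c / q v \<eta>) = 1" "c / q v \<eta> * q v \<eta> = c"
    using q_norm[OF \<eta>(1), of v] by (auto simp: c_def norm_divide norm_mult)
  have "weight i c 1 = 1"
    using weight_arc[of 0 1 "(True, s)" s] weight_gap[of 1 1 "(False, s)" s]
    by (cases k) (simp_all add: i c_def)
  then have "coord (act (c / q v \<eta>) \<eta>) (v, i) = 1"
    using q_act[OF \<eta>(1,3) z(1)] p_act[OF \<eta>(1) z(1)] \<eta>(2) z(2) by (simp add: coord_def)
  then show thesis
    using that[OF act_in_total[OF \<eta>(1) z(1)]] by (simp add: supp_def)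
qed

lemma simplicial_complex_total: "simplicial_complex total_vertices total_complex"
proof -
  have "{w} \<in> total_complex" if "w \<in> total_vertices" for w
    using that total_vertex_attained[of "fst w" "snd w"]
    by (force simp: total_vertices_def total_complex_def)
  moreover have "\<sigma> \<noteq> {} \<and> \<sigma> \<subseteq> total_vertices" if "\<sigma> \<in> total_complex" for \<sigma>
    using that supp_coord(2) by (auto simp: total_complex_def)
  moreover have "\<tau> \<in> total_complex" if "\<sigma> \<in> total_complex" "\<tau> \<noteq> {}" "\<tau> \<subseteq> \<sigma>" for \<sigma> \<tau>
    using that unfolding total_complex_def by blast
  ultimately show ?thesis
    using finite_total_vertices unfolding simplicial_complex_def by blast
qed

lemma fst_simplicial:
  assumes "\<sigma> \<in> total_complex" shows "fst ` \<sigma> \<in> K"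
proof -
  obtain \<xi> where \<xi>: "\<xi> \<in> topspace E" "\<sigma> \<subseteq> supp (coord \<xi>)" "\<sigma> \<noteq> {}"
    using assms by (auto simp: total_complex_def)
  then have "fst ` \<sigma> \<subseteq> supp (p \<xi>)" using supp_coord(1)[OF \<xi>(1)] by blast
  then show ?thesis using supp_face[OF p_in_geom[OF \<xi>(1)]] \<xi>(3) by simp
qed

lemma coord_act:
  assumes "\<xi> \<in> topspace E" "norm z = 1" "v \<in> supp (p \<xi>)"
  shows "coord (act z \<xi>) (v, i) = weight i (z * q v \<xi>) (p \<xi> v)"
  using q_act p_act assms by (simp add: coord_def)

lemma inj_on_coord: "inj_on coord (topspace E)"
proof (rule inj_onI)
  fix \<xi> \<eta> assume \<xi>: "\<xi> \<in> topspace E" and \<eta>: "\<eta> \<in> topspace E" and eq: "coord \<xi> = coord \<eta>"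
  have "p \<xi> = p \<eta>" using push_coord[OF \<xi>] push_coord[OF \<eta>] eq by metis
  then obtain z where z: "norm z = 1" "\<eta> = act z \<xi>" using fibre_transitive[OF \<xi> \<eta>] by blast
  have "z = 1"
  proof (rule fibre_injective[OF p_in_geom[OF \<xi>] q_compatible[OF \<xi>] z(1)])
    show "weight i (z * q v \<xi>) (p \<xi> v) = weight i (q v \<xi>) (p \<xi> v)" if "v \<in> supp (p \<xi>)" for v i
    proof -
      have "weight i (z * q v \<xi>) (p \<xi> v) = coord \<eta> (v, i)"
        using coord_act[OF \<xi> z(1) that, of i] z(2) by simp
      also have "\<dots> = weight i (q v \<xi>) (p \<xi> v)" unfolding eq[symmetric] by (simp add: coord_def)
      finally show ?thesis .
    qed
  qed
  then show "\<xi> = \<eta>" using z(2) act_1[OF \<xi>] by simp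
qed

lemma coord_eqI:
  assumes \<xi>: "\<xi> \<in> topspace E" and zero: "\<And>w. fst w \<notin> supp (p \<xi>) \<Longrightarrow> y w = 0"
    and eq: "\<And>v i. v \<in> supp (p \<xi>) \<Longrightarrow> coord \<xi> (v, i) = y (v, i)"
  shows "coord \<xi> = y"
proof
  fix w
  show "coord \<xi> w = y w"
  proof (cases "fst w \<in> supp (p \<xi>)")
    case True
    then show ?thesis using eq[of "fst w" "snd w"] by simp
  next
    case False
    then show ?thesis using coord_bounds[OF \<xi>, of w] zero[OF False] by (simp add: supp_def)
  qed
qed

lemma coord_surj:
  assumes y: "y \<in> geom total_complex" shows "y \<in> coord ` topspace E"
proof -
  interpret total: finite_complex total_vertices total_complex
    using simplicial_complex_total by unfold_locales
  let ?x = "push total_vertices fst y"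
  have x: "?x \<in> geom K"
    by (rule push_in_geom[OF simplicial_complex_total y fst_simplicial])
  have supp_x: "supp ?x = fst ` supp y"
    by (rule supp_push[OF finite_total_vertices total.geom_nonneg[OF y] total.supp_subset[OF y]])
  obtain \<xi>\<^sub>0 where \<xi>\<^sub>0: "\<xi>\<^sub>0 \<in> topspace E" "supp y \<subseteq> supp (coord \<xi>\<^sub>0)"
    using total.supp_in_complex[OF y] by (auto simp: total_complex_def)
  have sub: "supp ?x \<subseteq> supp (p \<xi>\<^sub>0)"
    using supp_coord(1)[OF \<xi>\<^sub>0(1)] \<xi>\<^sub>0(2) unfolding supp_x by blast
  define \<eta> where "\<eta> = point_over ?x"
  have \<eta>: "\<eta> \<in> topspace E" "p \<eta> = ?x" using point_over[OF x] by (simp_all add: \<eta>_def)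
  have q: "compatible ?x (\<lambda>v. q v \<eta>)" using q_compatible[OF \<eta>(1)] \<eta>(2) by simp
  obtain z where z: "norm z = 1" "\<And>v i. v \<in> supp ?x \<Longrightarrow> weight i (z * q v \<eta>) (?x v) = y (v, i)"
  proof (rule fibre_surjective[OF p_in_geom[OF \<xi>\<^sub>0(1)] q_compatible[OF \<xi>\<^sub>0(1)] x q sub, of "\<lambda>v i. y (v, i)"])
    show "weight i (q v \<xi>\<^sub>0) (p \<xi>\<^sub>0 v) \<noteq> 0" if "y (v, i) \<noteq> 0" for v i
      using that \<xi>\<^sub>0(2) by (auto simp: supp_def coord_def)
    show "(\<Sum>i\<in>UNIV. y (v, i)) = ?x v" if "v \<in> supp ?x" for v
      using that supp_subset[OF x] by (auto simp: push_fst_total_vertices)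
  qed (use total.geom_nonneg[OF y] in auto)
  have "coord (act z \<eta>) = y"
  proof (rule coord_eqI[OF act_in_total[OF \<eta>(1) z(1)]])
    show "y w = 0" if "fst w \<notin> supp (p (act z \<eta>))" for w
      using that unfolding p_act[OF \<eta>(1) z(1)] \<eta>(2) supp_x by (auto simp: supp_def)
    show "coord (act z \<eta>) (v, i) = y (v, i)" if "v \<in> supp (p (act z \<eta>))" for v i
      using coord_act[OF \<eta>(1) z(1), of v i] z(2)[of v i] that p_act[OF \<eta>(1) z(1)] \<eta>(2) by simp
  qed
  then show ?thesis using act_in_total[OF \<eta>(1) z(1)] by (metis imageI)
qed

lemma coord_component_continuous: "continuous_map E euclideanreal (\<lambda>\<xi>. coord \<xi> (v, i))"
proof (rule continuous_map_dominated[OF p_coordinate_continuous, where B = 1])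
  let ?N = "{\<xi> \<in> topspace E. p \<xi> v \<noteq> 0}"
  have "continuous_map (subtopology E ?N) euclidean (\<lambda>\<xi>. (q v \<xi>, p \<xi> v))"
    using continuous_map_pairedI[OF q_continuous[of v]
        continuous_map_from_subtopology[OF p_coordinate_continuous]]
    by simp
  from continuous_map_compose_continuous_on[OF this continuous_on_weight[of i]]
  show "continuous_map (subtopology E ?N) euclideanreal (\<lambda>\<xi>. coord \<xi> (v, i))"
    using q_norm by (simp add: coord_def)
  show "norm (coord \<xi> (v, i)) \<le> 1 * \<bar>p \<xi> v\<bar>" if "\<xi> \<in> topspace E" for \<xi>
    using coord_bounds[OF that, of "(v, i)"] by simp
qed

lemma continuous_map_coord: "continuous_map E (top_of_set (geom total_complex)) coord"
proof -
  have "continuous_map E (product_topology (\<lambda>_. euclideanreal) UNIV) coord"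
    using coord_component_continuous by (auto simp: continuous_map_componentwise_UNIV)
  then show ?thesis
    using coord_in_geom by (auto simp: euclidean_product_topology continuous_map_in_subtopology)
qed

theorem classical_triangulation: "classical_triangulation K E p"
proof (rule classical_triangulationI[OF simplicial_complex_total _ fst_simplicial push_coord[symmetric]])
  show "homeomorphic_map E (top_of_set (geom total_complex)) coord"
    by (rule continuous_imp_homeomorphic_map[OF continuous_map_coord compact_total Hausdorff_space_top_of_set_fun _ inj_on_coord])
      (use coord_in_geom coord_surj in auto)
qed

end

sublocale euler_bundle \<subseteq> marked_bundle V K E p act a eps mark
  by unfold_locales (fact mark_continuous mark_norm mark_compatible mark_act)+

section \<open>The cyclic order of a cocycle\<close>

context finite_complex
begin

lemma cocycle2_cobd1:
  assumes b: "alt1 K b" shows "cocycle2 K (cobd1 b)"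
proof -
  have swap: "b v u = - b u v" if "{u, v} \<subseteq> \<sigma>" "\<sigma> \<in> K" "u \<noteq> v" for u v \<sigma>
    using b face[OF that(2,1)] that(3) by (simp add: alt1_def)
  have "alt2 K (cobd1 b)"
    unfolding alt2_def
  proof (intro allI impI)
    fix u v w assume uvw: "{u, v, w} \<in> K \<and> distinct [u, v, w]"
    then have "b v u = - b u v" "b w v = - b v w"
      using swap[of u v "{u, v, w}"] swap[of v w "{u, v, w}"] by auto
    then show "cobd1 b v u w = - cobd1 b u v w \<and> cobd1 b u w v = - cobd1 b u v w"
      by (simp add: cobd1_def)
  qed
  then show ?thesis by (simp add: cocycle2_def cobd2_def cobd1_def)
qed

lemma cocycle2_lincomb:
  assumes "cocycle2 K c" "cocycle2 K c'" shows "cocycle2 K (\<lambda>u v w. m * c u v w + n * c' u v w)"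
proof -
  have "cobd2 (\<lambda>u v w. m * c u v w + n * c' u v w) t u v w = m * cobd2 c t u v w + n * cobd2 c' t u v w" for t u v w
    by (simp add: cobd2_def algebra_simps)
  then show ?thesis using assms by (simp add: cocycle2_def alt2_def)
qed

lemma cocycle2_cong:
  assumes cocycle: "cocycle2 K c" and eq: "\<And>u v w. distinct [u, v, w] \<Longrightarrow> c' u v w = c u v w"
  shows "cocycle2 K c'"
proof -
  have "c' v u w = - c' u v w \<and> c' u w v = - c' u v w" if "{u, v, w} \<in> K \<and> distinct [u, v, w]"
    for u v w
    using cocycle that eq[of u v w] eq[of v u w] eq[of u w v] by (auto simp: cocycle2_def alt2_def)
  moreover have "cobd2 c' t u v w = 0" if "{t, u, v, w} \<in> K \<and> distinct [t, u, v, w]" for t u v w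
    using cocycle that eq[of u v w] eq[of t v w] eq[of t u w] eq[of t u v]
    by (simp add: cocycle2_def cobd2_def)
  ultimately show ?thesis unfolding cocycle2_def alt2_def by blast
qed

end

definition cyclic_order :: "('v \<Rightarrow> 'v \<Rightarrow> int) \<Rightarrow> ('v \<Rightarrow> 'v \<Rightarrow> 'v \<Rightarrow> int) \<Rightarrow> 'v \<Rightarrow> 'v \<Rightarrow> 'v \<Rightarrow> int" where
  "cyclic_order a e u v w = (if distinct [u, v, w] then 4 * e u v w + 3 * cobd1 a u v w else 0)"

lemma cyclic_order_eq_FF:
  assumes "of_int (e u v w) = GG a u v w" "distinct [u, v, w]"
  shows "of_int (cyclic_order a e u v w) = 4 * FF (cobd1 a u v w)"
  using assms by (simp add: cyclic_order_def GG_def)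

lemma cyclic_system_cyclic_order:
  assumes K: "simplicial_complex V K" and e: "cocycle2 K e" and a: "alt1 K a"
    and a_unit: "\<And>u v. {u, v} \<in> K \<Longrightarrow> u \<noteq> v \<Longrightarrow> a u v = 1 \<or> a u v = - 1"
    and e_GG: "\<And>u v w. {u, v, w} \<in> K \<Longrightarrow> distinct [u, v, w] \<Longrightarrow> of_int (e u v w) = GG a u v w"
  shows "cyclic_system V K a (cyclic_order a e)"
proof -
  interpret finite_complex V K using K by unfold_locales
  have "cocycle2 K (\<lambda>u v w. 4 * e u v w + 3 * cobd1 a u v w)"
    by (intro cocycle2_lincomb e cocycle2_cobd1 a)
  then have "cocycle2 K (cyclic_order a e)"
    by (rule cocycle2_cong) (simp add: cyclic_order_def)
  moreover have "\<bar>cyclic_order a e u v w\<bar> \<le> 1" if "{u, v, w} \<in> K" "distinct [u, v, w]" for u v w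
  proof -
    have "\<bar>real_of_int (cyclic_order a e u v w)\<bar> \<le> 1"
      using cyclic_order_eq_FF[of e u v w a] e_GG[OF that] that(2) by (simp add: FF_def)
    then show ?thesis by linarith
  qed
  ultimately show ?thesis
    using a a_unit by unfold_locales (auto simp: cyclic_order_def)
qed

theorem mainTheorem6:
  fixes V :: "'v set" and K :: "'v set set"
    and E :: "'e topology" and p :: "'e \<Rightarrow> 'v \<Rightarrow> real" and act :: "complex \<Rightarrow> 'e \<Rightarrow> 'e"
  assumes "simplicial_complex V K"
    and "circle_bundle E p act (geom K)"
    and "no_2torsion_H2 K"
    and "\<exists>e a. cocycle2 K e
           \<and> (\<forall>u v w. {u, v, w} \<in> K \<and> distinct [u, v, w] \<longrightarrow> e u v w \<in> {-2, -1, 1, 2})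
           \<and> represents_euler K E p act e
           \<and> (\<forall>u v. {u, v} \<in> K \<and> u \<noteq> v \<longrightarrow> a v u = - a u v \<and> a u v \<in> {-1, 1})
           \<and> (\<forall>u v w. {u, v, w} \<in> K \<and> distinct [u, v, w] \<longrightarrow> of_int (e u v w) = GG a u v w)"
  shows "classical_triangulation K E p"
proof -
  obtain e a where e: "cocycle2 K e" and euler: "represents_euler K E p act e"
    and a: "\<forall>u v. {u, v} \<in> K \<and> u \<noteq> v \<longrightarrow> a v u = - a u v \<and> a u v \<in> {-1, 1}"
    and e_GG: "\<forall>u v w. {u, v, w} \<in> K \<and> distinct [u, v, w] \<longrightarrow> of_int (e u v w) = GG a u v w"
    using assms(4) by (elim exE conjE) (rule that)
  obtain s b where s: "continuous_map (top_of_set (geom (skel1 K))) E s"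
    "\<forall>x\<in>geom (skel1 K). p (s x) = x"
    and b: "alt1 K b"
    and winding: "\<forall>u v w. {u, v, w} \<in> K \<and> distinct [u, v, w] \<longrightarrow>
      (\<forall>\<phi>. local_triv E p act (geom (faces {u, v, w})) \<phi> \<longrightarrow>
        complex_of_int (e u v w - cobd1 b u v w) =
          winding_number (\<lambda>t. snd (\<phi> (s (bdry u v w t)))) 0)"
    using euler unfolding represents_euler_def by (elim exE conjE) (rule that)
  interpret cyclic_system V K a "cyclic_order a e"
    using a e_GG by (intro cyclic_system_cyclic_order[OF assms(1) e]) (auto simp: alt1_def)
  interpret euler_bundle V K E p act s a "cyclic_order a e" e b
    by unfold_locales (use assms(2) s b winding in \<open>simp_all add: cyclic_order_def\<close>)
  show ?thesis by (rule classical_triangulation)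
qed

end
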